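(* There exist mixed $p$-spin models $\xi_0(r)=\sum_{p\ge2}\beta_p r^p$ (with non-negative coefficients $\beta_p$, only finitely many non-zero) with $\xi_0''(0)>0$, and choices of $\beta>0$ and $h\in\mathbb R$, for which the replica symmetric functional $$[0,1]\to\mathbb R,\qquad q\mapsto\mathcal P(\delta_q;\xi_0,\beta,h)$$ has a unique minimizer $q(\beta,h)$, and $$\alpha(q(\beta,h),\beta,h)<1,$$ and yet the Parisi measure associated with $(\xi_0,\beta,h)$ is not a Dirac mass.
   Context: A mixed $p$-spin model (with Ising spins) is specified by a function $\xi_0(r)=\sum_{p\ge2}\beta_p r^p$, $r\in\mathbb R$, where $(\beta_p)_{p\ge2}$ is a sequence of non-negative coefficients with only finitely many non-zero entries. Let $\beta>0$ (inverse temperature) and $h\in\mathbb R$ (external field), and set $\xi(r)=\beta^2\xi_0(r)$. Parisi functional and Parisi measure. For a probability measure $\mu$ on $[0,1]$ (we write $\mu\in\mathcal P([0,1])$), define $$\mathcal P(\mu;\xi_0,\beta,h)=u_\mu(0,h)-\frac12\int_0^1\xi''(s)\,\mu([0,s])\,s\,ds,$$ where $u_\mu$ is the unique weak solution of the Parisi PDE $$\partial_r u_\mu(r,x)+\frac{\xi''(r)}{2}\Bigl(\partial_{xx}u_\mu(r,x)+\mu([0,r])\bigl(\partial_x u_\mu(r,x)\bigr)^2\Bigr)=0,\quad (r,x)\in(0,1)\times\mathbb R,\qquad u_\mu(1,x)=\log\cosh(x).$$ It is known that $\mu\mapsto\mathcal P(\mu;\xi_0,\beta,h)$ has a unique minimizer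 over $\mathcal P([0,1])$; it is called the Parisi measure associated with $(\xi_0,\beta,h)$. Here $\delta_q$ denotes the Dirac mass at $q\in[0,1]$. AT quantity. With $Z$ a standard Gaussian random variable, for $q\in[0,1]$, $$\alpha(q,\beta,h)=\xi''(q)\,\mathbb E\bigl[\operatorname{sech}^4(\sqrt{\xi'(q)}\,Z+h)\bigr].$$ *)

theory Defs
  imports "HOL-Probability.Probability" "HOL-Computational_Algebra.Polynomial"
begin

definition mixed_pspin_model :: "real poly \<Rightarrow> bool" where
  "mixed_pspin_model \<xi>0 \<longleftrightarrow> (\<forall>p. coeff \<xi>0 p \<ge> 0) \<and> coeff \<xi>0 0 = 0 \<and> coeff \<xi>0 1 = 0"

definition xi :: "real poly \<Rightarrow> real \<Rightarrow> real poly" where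
  "xi \<xi>0 \<beta> = smult (\<beta>\<^sup>2) \<xi>0"

abbreviation xi' :: "real poly \<Rightarrow> real \<Rightarrow> real \<Rightarrow> real" where
  "xi' \<xi>0 \<beta> \<equiv> poly (pderiv (xi \<xi>0 \<beta>))"

abbreviation xi'' :: "real poly \<Rightarrow> real \<Rightarrow> real \<Rightarrow> real" where
  "xi'' \<xi>0 \<beta> \<equiv> poly (pderiv (pderiv (xi \<xi>0 \<beta>)))"

definition unit_borel :: "real measure" where
  "unit_borel = restrict_space borel {0..1}"

definition unit_prob_measures :: "real measure set" where
  "unit_prob_measures = space (prob_algebra unit_borel)"

abbreviation dirac :: "real \<Rightarrow> real measure" where
  "dirac q \<equiv> return unit_borel q"

text \<open>
  Infinitely differentiable functions of \<open>(r, x)\<close>: \<open>D i j\<close> is the partial derivative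
  of order \<open>i\<close> in \<open>r\<close> and \<open>j\<close> in \<open>x\<close>.
\<close>
definition smooth2 :: "(real \<times> real \<Rightarrow> real) \<Rightarrow> bool" where
  "smooth2 \<phi> \<longleftrightarrow> (\<exists>D :: nat \<Rightarrow> nat \<Rightarrow> real \<times> real \<Rightarrow> real. D 0 0 = \<phi> \<and>
     (\<forall>i j. continuous_on UNIV (D i j) \<and>
        (\<forall>r x. ((\<lambda>s. D i j (s, x)) has_real_derivative D (Suc i) j (r, x)) (at r)) \<and>
        (\<forall>r x. ((\<lambda>y. D i j (r, y)) has_real_derivative D i (Suc j) (r, x)) (at x))))"

definition open_strip :: "(real \<times> real) set" where
  "open_strip = {0<..<1} \<times> UNIV"

definition closed_strip :: "(real \<times> real) set" where
  "closed_strip = {0..1} \<times> UNIV"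

definition test_function :: "(real \<times> real \<Rightarrow> real) \<Rightarrow> bool" where
  "test_function \<phi> \<longleftrightarrow> smooth2 \<phi> \<and> compact (closure {z. \<phi> z \<noteq> 0})
     \<and> closure {z. \<phi> z \<noteq> 0} \<subseteq> open_strip"

definition partial_r :: "(real \<times> real \<Rightarrow> real) \<Rightarrow> real \<times> real \<Rightarrow> real" where
  "partial_r f z = deriv (\<lambda>s. f (s, snd z)) (fst z)"

definition partial_x :: "(real \<times> real \<Rightarrow> real) \<Rightarrow> real \<times> real \<Rightarrow> real" where
  "partial_x f z = deriv (\<lambda>y. f (fst z, y)) (snd z)"

definition weak_partial_x :: "(real \<times> real \<Rightarrow> real) \<Rightarrow> (real \<times> real \<Rightarrow> real) \<Rightarrow> bool" where
  "weak_partial_x u v \<longleftrightarrow> (\<forall>\<phi>. test_function \<phi> \<longrightarrow>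
     (LINT z:open_strip|lborel. u z * partial_x \<phi> z) = - (LINT z:open_strip|lborel. v z * \<phi> z))"

text \<open>
  Weak solutions of the Parisi PDE are continuous on \<open>[0,1] \<times> \<real>\<close> and have an essentially
  bounded weak derivative \<open>v = \<partial>\<^sub>x u\<close>; the equation is tested against smooth functions with compact
  support in \<open>(0,1) \<times> \<real>\<close>. By continuity the terminal condition can be imposed pointwise.
  Membership in \<open>extensional\<close> fixes the irrelevant values outside the strip, so that
  uniqueness of the solution is uniqueness as a HOL function.
\<close>
definition parisi_weak_solution ::
  "real poly \<Rightarrow> real \<Rightarrow> real measure \<Rightarrow> (real \<times> real \<Rightarrow> real) \<Rightarrow> bool" where
  "parisi_weak_solution \<xi>0 \<beta> \<mu> u \<longleftrightarrow>
     u \<in> extensional closed_strip \<and>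
     continuous_on closed_strip u \<and>
     (\<forall>x. u (1, x) = ln (cosh x)) \<and>
     (\<exists>v C. v \<in> borel_measurable lborel \<and>
        (AE z in lborel. z \<in> open_strip \<longrightarrow> \<bar>v z\<bar> \<le> C) \<and>
        weak_partial_x u v \<and>
        (\<forall>\<phi>. test_function \<phi> \<longrightarrow>
           (LINT z:open_strip|lborel.
              - u z * partial_r \<phi> z
              + xi'' \<xi>0 \<beta> (fst z) / 2 *
                  (u z * partial_x (partial_x \<phi>) z + measure \<mu> {0..fst z} * (v z)\<^sup>2 * \<phi> z)) = 0))"

definition parisi_u :: "real poly \<Rightarrow> real \<Rightarrow> real measure \<Rightarrow> real \<times> real \<Rightarrow> real" where
  "parisi_u \<xi>0 \<beta> \<mu> = (THE u. parisi_weak_solution \<xi>0 \<beta> \<mu> u)"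

definition parisi_functional :: "real measure \<Rightarrow> real poly \<Rightarrow> real \<Rightarrow> real \<Rightarrow> real" where
  "parisi_functional \<mu> \<xi>0 \<beta> h =
     parisi_u \<xi>0 \<beta> \<mu> (0, h)
     - 1 / 2 * (LINT s:{0..1}|lborel. xi'' \<xi>0 \<beta> s * measure \<mu> {0..s} * s)"

text \<open>
  A minimizer exists and is unique for all parameters (Auffinger and Chen), so a statement
  about every \<open>\<mu>\<close> with this property is a statement about the Parisi measure.
\<close>
definition is_parisi_measure :: "real poly \<Rightarrow> real \<Rightarrow> real \<Rightarrow> real measure \<Rightarrow> bool" where
  "is_parisi_measure \<xi>0 \<beta> h \<mu> \<longleftrightarrow>
     is_arg_min (\<lambda>\<nu>. parisi_functional \<nu> \<xi>0 \<beta> h) (\<lambda>\<nu>. \<nu> \<in> unit_prob_measures) \<mu>"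

definition at_quantity :: "real poly \<Rightarrow> real \<Rightarrow> real \<Rightarrow> real \<Rightarrow> real" where
  "at_quantity \<xi>0 q \<beta> h =
     xi'' \<xi>0 \<beta> q *
       (LINT z|density lborel std_normal_density. (1 / cosh (sqrt (xi' \<xi>0 \<beta> q) * z + h)) ^ 4)"

end

theory Submission
  imports Defs "HOL-Real_Asymp.Real_Asymp"
begin

text \<open>
  At zero field and \<open>\<beta> = 1\<close> take \<open>\<xi>(r) = r^2 / 100 + 6 r^1001\<close>. The replica symmetric functional has the
  closed form \<open>E lncosh (sqrt (\<xi>'(q)) Z) + (\<xi>(1) - \<xi>(q) - (1 - q) \<xi>'(q)) / 2\<close>, whose only minimizer is
  \<open>q = 0\<close>: the first term grows like \<open>sqrt (\<xi>'(q))\<close>, while \<open>(1 - q) \<xi>'(q)\<close> stays small because of the large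
  degree. There \<open>\<alpha> = \<xi>''(0) = 1/50\<close>. For the measure with mass 1/2 at 0 and at 1, the Cole-Hopf
  transformation turns the Parisi PDE into a heat equation, and \<open>sqrt (cosh x) \<le> exp (x/2) + exp (- x/2)\<close> bounds the
  functional by \<open>2 ln 2 + \<xi>(1) / 4\<close>. Since \<open>\<xi>(1) > 8 ln 2\<close>, this is less than the value \<open>\<xi>(1) / 2\<close> at
  the Dirac mass at 0, so no Dirac mass is a global minimizer.

  These values presuppose that weak solutions are unique. The difference \<open>w\<close> of two solutions satisfies a
  heat equation with source bounded by a multiple of \<open>d\<close>, the weak derivative of \<open>w\<close>. By Duhamel's formula
  and the \<open>L^1\<close> bound on differences of heat kernels, a bound \<open>M\<close> on \<open>d\<close> improves to \<open>M / 2\<close> on a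
  sufficiently short time slab ending where \<open>w\<close> vanishes; hence \<open>w\<close> vanishes on the slab.
\<close>

section \<open>Smooth cutoffs\<close>

text \<open>This is the discontinuous transition of the random energy model.

  The functional is defined through \<open>THE\<close> weak solution, so a value is available only
  once an explicit solution and uniqueness are both established. Explicit solutions exist because
  the distribution functions in question are piecewise constant. The obstacle in uniqueness is
  regularity: \<open>d\<close> is only a bounded measurable function, known through integrals
  against smooth compactly supported functions. The contraction therefore alternates between two
  equivalent forms of one bound, an almost everywhere bound on \<open>d\<close> and a Lipschitz
  bound in space on \<open>w\<close>; Duhamel's formula improves the second. Its test functions are
  cutoffs times a heat kernel with polynomial time change, and \<open>smooth2\<close> demands all
  their mixed partial derivatives at once, which explains the function classes closed under
  differentiation below.\<close>

definition flat_exp :: "real poly \<Rightarrow> real \<Rightarrow> real" where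
  "flat_exp P x = (if x > 0 then poly P (1 / x) * exp (- (1 / x)) else 0)"

text \<open>Since P(1/x) exp(-1/x) has derivative (1/x)^2 (P - P')(1/x) exp(-1/x), differentiation
  becomes an operation on polynomials, and derivatives of every order are explicit.\<close>

definition flat_deriv :: "real poly \<Rightarrow> real poly" where
  "flat_deriv P = [:0, 0, 1:] * (P - pderiv P)"

lemma poly_exp_tendsto_0: "((\<lambda>y. poly P y * exp (- y)) \<longlongrightarrow> 0) at_top" for P :: "real poly"
proof -
  have "((\<lambda>y. \<Sum>i\<le>degree P. coeff P i * (y ^ i / exp y)) \<longlongrightarrow> (\<Sum>i\<le>degree P. coeff P i * 0)) at_top"
    by (intro tendsto_intros tendsto_power_div_exp_0)
  then show ?thesis
    by (simp add: poly_altdef sum_distrib_right exp_minus divide_inverse mult.assoc)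
qed

lemma flat_exp_has_derivative: "(flat_exp P has_real_derivative flat_exp (flat_deriv P) x) (at x)"
proof -
  consider "x > 0" | "x < 0" | "x = 0" by linarith
  then show ?thesis
  proof cases
    case 1
    have "((\<lambda>x. poly P (1 / x) * exp (- (1 / x))) has_real_derivative flat_exp (flat_deriv P) x) (at x)"
      using 1 by (auto intro!: derivative_eq_intros DERIV_chain'[OF _ poly_DERIV]
          simp: flat_exp_def flat_deriv_def field_simps power2_eq_square)
    moreover have "\<forall>\<^sub>F y in nhds x. flat_exp P y = poly P (1 / y) * exp (- (1 / y))"
      using eventually_nhds_in_open[of "{0<..}" x] 1 by (auto elim!: eventually_mono simp: flat_exp_def)
    ultimately show ?thesis by (subst DERIV_cong_ev[OF refl _ refl])
  next
    case 2
    have "\<forall>\<^sub>F y in nhds x. flat_exp P y = 0"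
      using eventually_nhds_in_open[of "{..<0}" x] 2 by (auto elim!: eventually_mono simp: flat_exp_def)
    then show ?thesis using 2 by (subst DERIV_cong_ev[OF refl _ refl]) (auto simp: flat_exp_def)
  next
    case 3
    have "((\<lambda>h. flat_exp P h / h) \<longlongrightarrow> 0) (at_right 0)"
    proof -
      \<comment> \<open>The difference quotient at 0 from the right has the same shape:
        \<open>pCons 0 P\<close> supplies the extra factor 1/h, and in y = 1/h the exponential beats
        the polynomial.\<close>
      have "((\<lambda>h. poly (pCons 0 P) (inverse h) * exp (- (inverse h))) \<longlongrightarrow> 0) (at_right 0)"
        using filterlim_compose[OF poly_exp_tendsto_0 filterlim_inverse_at_top_right] .
      moreover have "\<forall>\<^sub>F h in at_right 0. poly (pCons 0 P) (inverse h) * exp (- (inverse h)) = flat_exp P h / h"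
        by (auto simp: eventually_at_filter flat_exp_def field_simps)
      ultimately show ?thesis by (rule Lim_transform_eventually)
    qed
    moreover have "((\<lambda>h. flat_exp P h / h) \<longlongrightarrow> 0) (at_left 0)"
      by (rule tendsto_eventually) (auto simp: eventually_at_filter flat_exp_def)
    ultimately have "((\<lambda>h. flat_exp P h / h) \<longlongrightarrow> 0) (at 0)"
      using filterlim_split_at_real by blast
    then show ?thesis using 3 by (simp add: DERIV_def flat_exp_def)
  qed
qed

text \<open>The product rule turns each summand into two summands of the same form, so lists of
  polynomial pairs represent all derivatives of the standard bump on [0,1].\<close>

definition bump :: "(real poly \<times> real poly) list \<Rightarrow> real \<Rightarrow> real" where
  "bump ps x = (\<Sum>(P, Q)\<leftarrow>ps. flat_exp P x * flat_exp Q (1 - x))"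

definition bump_deriv :: "(real poly \<times> real poly) list \<Rightarrow> (real poly \<times> real poly) list" where
  "bump_deriv ps = concat (map (\<lambda>(P, Q). [(flat_deriv P, Q), (P, - flat_deriv Q)]) ps)"

lemma flat_uminus: "flat_exp (- P) x = - flat_exp P x"
  by (simp add: flat_exp_def)

lemma bump_has_derivative: "(bump ps has_real_derivative bump (bump_deriv ps) x) (at x)"
proof (induction ps)
  case (Cons p ps)
  obtain P Q where p: "p = (P, Q)" by fastforce
  have "((\<lambda>x. flat_exp P x * flat_exp Q (1 - x) + bump ps x) has_real_derivative
      (flat_exp (flat_deriv P) x * flat_exp Q (1 - x) + (- flat_exp (flat_deriv Q) (1 - x)) * flat_exp P x) + bump (bump_deriv ps) x) (at x)"
  proof (intro DERIV_add DERIV_mult flat_exp_has_derivative Cons)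
    have "((\<lambda>x. 1 - x) has_real_derivative - 1) (at x)" by (auto intro!: derivative_eq_intros)
    from DERIV_chain2[OF flat_exp_has_derivative this, of Q]
    show "((\<lambda>x. flat_exp Q (1 - x)) has_real_derivative - flat_exp (flat_deriv Q) (1 - x)) (at x)"
      by simp
  qed
  then show ?case by (simp add: p bump_def[abs_def] bump_deriv_def flat_uminus algebra_simps)
qed (simp add: bump_def[abs_def] bump_deriv_def)

lemma bump_eq_0: "x \<le> 0 \<or> x \<ge> 1 \<Longrightarrow> bump ps x = 0"
  by (induction ps) (auto simp: bump_def flat_exp_def)

lemma continuous_bump: "continuous_on A (bump ps)"
  by (intro continuous_at_imp_continuous_on ballI DERIV_isCont[OF bump_has_derivative])

definition bump0 :: "real \<Rightarrow> real" where "bump0 = bump [(1, 1)]"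

lemma bump0_nonneg: "bump0 x \<ge> 0"
  and bump0_pos: "0 < x \<Longrightarrow> x < 1 \<Longrightarrow> bump0 x > 0"
  by (auto simp: bump0_def bump_def flat_exp_def)

definition bump_mass :: real where "bump_mass = integral {0..1} bump0"

lemma integrable_bump0: "bump0 integrable_on {a..b}"
  unfolding bump0_def by (rule integrable_continuous_real[OF continuous_bump])

lemma bump_mass_pos: "bump_mass > 0"
proof -
  have "bump_mass \<ge> 0"
    unfolding bump_mass_def by (rule integral_nonneg[OF integrable_bump0]) (simp add: bump0_nonneg)
  moreover have "bump_mass \<noteq> 0"
  proof
    assume "bump_mass = 0"
    then have "\<forall>x\<in>{0..1}. bump0 x = 0"
      unfolding bump_mass_def
      by (subst (asm) integral_eq_0_iff) (auto simp: bump0_nonneg, simp add: bump0_def continuous_bump)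
    then have "bump0 (1/2) = 0" by (rule bspec) simp
    then show False using bump0_pos[of "1/2"] by simp
  qed
  ultimately show ?thesis by simp
qed

text \<open>The index is the order of differentiation: order 0 is the normalised primitive of the
  bump, rising from 0 to 1 on [0,1]. The lower limit -1 lies left of the support, so that every x
  \<ge> 0 is interior to the interval on which the fundamental theorem is applied.\<close>

fun smooth_step :: "nat \<Rightarrow> real \<Rightarrow> real" where
  "smooth_step 0 x = integral {-1..x} bump0 / bump_mass"
| "smooth_step (Suc n) x = bump ((bump_deriv ^^ n) [(1, 1)]) x / bump_mass"

lemma integral_bump0_neg: "x \<le> 0 \<Longrightarrow> integral {a..x} bump0 = 0"
  by (subst Henstock_Kurzweil_Integration.integral_cong[of _ _ "\<lambda>_. 0"]) (auto simp: bump0_def bump_eq_0)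

lemma smooth_step_has_derivative:
  "(smooth_step n has_real_derivative smooth_step (Suc n) x) (at x)"
proof (cases n)
  case 0
  have "((\<lambda>x. integral {-1..x} bump0) has_real_derivative bump0 x) (at x)"
  proof (cases "x < 0")
    case True
    have "\<forall>\<^sub>F y in nhds x. integral {-1..y} bump0 = 0"
      using eventually_nhds_in_open[of "{..<0}" x] True
      by (auto elim!: eventually_mono simp: integral_bump0_neg)
    then show ?thesis using True
      by (subst DERIV_cong_ev[OF refl _ refl]) (auto simp: bump0_def bump_eq_0)
  next
    case False
    then have "((\<lambda>x. integral {-1..x} bump0) has_real_derivative bump0 x) (at x within {-1..x+1})"
      by (intro integral_has_real_derivative) (auto simp: bump0_def continuous_bump)
    then show ?thesis using False
      by (subst (asm) at_within_interior) (auto simp: interior_atLeastAtMost_real)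
  qed
  moreover have "smooth_step 0 = (\<lambda>x. integral {-1..x} bump0 / bump_mass)"
    by (rule ext) simp
  ultimately show ?thesis by (simp add: 0 bump0_def[symmetric] DERIV_cdivide)
next
  case (Suc m)
  show ?thesis
    unfolding Suc using DERIV_cdivide[OF bump_has_derivative[of "(bump_deriv ^^ m) [(1,1)]" x], of bump_mass]
    by (simp add: smooth_step.simps(2)[abs_def])
qed

lemma smooth_step_le_0 [simp]: "x \<le> 0 \<Longrightarrow> smooth_step n x = 0"
  by (cases n) (auto simp: integral_bump0_neg bump_eq_0)

lemma smooth_step_Suc_ge_1 [simp]: "x \<ge> 1 \<Longrightarrow> smooth_step (Suc n) x = 0"
  by (simp add: bump_eq_0)

lemma smooth_step_0_ge_1 [simp]: "x \<ge> 1 \<Longrightarrow> smooth_step 0 x = 1"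
proof -
  assume "x \<ge> 1"
  have "integral {-1..x} bump0 = integral {-1..0} bump0 + integral {0..1} bump0 + integral {1..x} bump0"
    using \<open>x \<ge> 1\<close> Henstock_Kurzweil_Integration.integral_combine[of "-1" 0 x bump0]
      Henstock_Kurzweil_Integration.integral_combine[of 0 1 x bump0] integrable_bump0 by simp
  also have "integral {1..x} bump0 = 0"
    by (subst Henstock_Kurzweil_Integration.integral_cong[of _ _ "\<lambda>_. 0"]) (auto simp: bump0_def bump_eq_0)
  finally show ?thesis using bump_mass_pos by (simp add: integral_bump0_neg bump_mass_def)
qed

lemma smooth_step_1_nonneg: "smooth_step (Suc 0) x \<ge> 0"
  using bump0_nonneg[of x] bump_mass_pos by (simp add: bump0_def)

lemma smooth_step_mono: "x \<le> y \<Longrightarrow> smooth_step 0 x \<le> smooth_step 0 y"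
  by (rule DERIV_nonneg_imp_nondecreasing) (use smooth_step_has_derivative smooth_step_1_nonneg in blast)+

lemma smooth_step_bounds: "0 \<le> smooth_step 0 x" "smooth_step 0 x \<le> 1"
proof -
  show "0 \<le> smooth_step 0 x"
    using smooth_step_mono[of "min x 0" x] by (simp del: smooth_step.simps)
  show "smooth_step 0 x \<le> 1"
    using smooth_step_mono[of x "max x 1"] smooth_step_0_ge_1[of "max x 1"] by (simp del: smooth_step.simps)
qed

lemma continuous_smooth_step: "continuous_on A (smooth_step n)"
  by (intro continuous_at_imp_continuous_on ballI DERIV_isCont[OF smooth_step_has_derivative])

lemma smooth_step_measurable [measurable]: "smooth_step n \<in> borel_measurable borel"
  by (intro borel_measurable_continuous_onI continuous_smooth_step)

lemma smooth_step_bounded: "\<exists>K. \<forall>x. \<bar>smooth_step n x\<bar> \<le> K"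
proof -
  have "bounded (smooth_step n ` {0..1})"
    by (intro compact_imp_bounded compact_continuous_image continuous_smooth_step) auto
  then obtain K where K: "\<And>x. x \<in> {0..1} \<Longrightarrow> \<bar>smooth_step n x\<bar> \<le> K"
    unfolding bounded_iff real_norm_def by blast
  have "\<bar>smooth_step n x\<bar> \<le> \<bar>K\<bar> + 1" for x
  proof -
    consider "x \<le> 0" | "x \<ge> 1" | "x \<in> {0..1}" by fastforce
    then show ?thesis
    proof cases
      case 2 then show ?thesis by (cases n) (auto simp del: smooth_step.simps)
    qed (use K[of x] in \<open>auto simp del: smooth_step.simps\<close>)
  qed
  then show ?thesis by blast
qed

declare smooth_step.simps [simp del]

lemma integral_smooth_step_1:
  "integrable lborel (smooth_step (Suc 0))" "(LINT x|lborel. smooth_step (Suc 0) x) = 1"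
proof -
  have "has_bochner_integral lborel (\<lambda>x. smooth_step (Suc 0) x * indicator {0..1} x)
     (smooth_step 0 1 - smooth_step 0 0)"
    by (rule has_bochner_integral_FTC_Icc_real)
       (auto intro: has_field_derivative_at_within[OF smooth_step_has_derivative] continuous_smooth_step DERIV_isCont[OF smooth_step_has_derivative])
  moreover have "smooth_step (Suc 0) x * indicator {0..1} x = smooth_step (Suc 0) x" for x
    using smooth_step_le_0[of x] smooth_step_Suc_ge_1[of x 0] by (cases "x \<le> 0"; cases "x \<ge> 1") auto
  ultimately have "has_bochner_integral lborel (smooth_step (Suc 0)) 1" by simp
  then show "integrable lborel (smooth_step (Suc 0))" "(LINT x|lborel. smooth_step (Suc 0) x) = 1"
    by (auto simp: has_bochner_integral_iff)
qed

text \<open>Derivatives of a smooth cutoff that increases to the indicator of the open interval from a to b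
  as n grows; for every n its support lies in \<open>[a, b - 1/n]\<close>.\<close>

definition cutoff :: "nat \<Rightarrow> real \<Rightarrow> real \<Rightarrow> nat \<Rightarrow> real \<Rightarrow> real" where
  "cutoff n a b k t = real n ^ k * smooth_step k (real n * (t - a))
     + (- real n) ^ k * smooth_step k (real n * (b - t) - 1) - (if k = 0 then 1 else 0)"

lemma cutoff_has_derivative:
  "(cutoff n a b k has_real_derivative cutoff n a b (Suc k) t) (at t)"
  unfolding cutoff_def
  by (auto intro!: derivative_eq_intros DERIV_chain'[OF _ smooth_step_has_derivative] simp: algebra_simps)

lemma cutoff_measurable [measurable]: "cutoff n a b k \<in> borel_measurable borel"
  unfolding cutoff_def by measurable

text \<open>The condition on \<open>n\<close> separates the ramps: where one step has argument at
  most 0, the other has argument at least 1, so the constant is cancelled and all higher derivatives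
  vanish. The gap 1/n before \<open>b\<close> keeps the support away from time 1 when
  \<open>b = 1\<close>.\<close>

lemma cutoff_eq_0:
  assumes "2 \<le> real n * (b - a)" "t \<le> a \<or> t \<ge> b - 1 / n"
  shows "cutoff n a b k t = 0"
proof -
  have n: "n > 0" using assms(1) by (cases n) auto
  have *: "real n * (b - a) = real n * (t - a) + real n * (b - t)" by (simp add: algebra_simps)
  show ?thesis
    using assms(2)
  proof
    assume "t \<le> a"
    then have "real n * (t - a) \<le> 0" by (simp add: mult_nonneg_nonpos)
    then show ?thesis using assms(1) * by (cases k) (auto simp: cutoff_def)
  next
    assume "t \<ge> b - 1 / n"
    then have "real n * (b - t) \<le> 1" using n by (simp add: field_simps)
    then show ?thesis using assms(1) * by (cases k) (auto simp: cutoff_def)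
  qed
qed

lemma cutoff_bounds: "\<bar>cutoff n a b 0 t\<bar> \<le> 1"
  using smooth_step_bounds[of "real n * (t - a)"] smooth_step_bounds[of "real n * (b - t) - 1"]
  by (auto simp: cutoff_def)

lemma cutoff_eq_1:
  assumes "real n * (t - a) \<ge> 1" "real n * (b - t) \<ge> 2"
  shows "cutoff n a b 0 t = 1"
  using assms by (auto simp: cutoff_def)

lemma cutoff_tendsto:
  assumes "a < b"
  shows "(\<lambda>n. cutoff n a b 0 t) \<longlonglongrightarrow> indicator {a<..<b} t"
proof (rule tendsto_eventually)
  have ev: "\<forall>\<^sub>F n in sequentially. 2 \<le> real n * c" if "c > 0" for c :: real
    using that by real_asymp
  show "\<forall>\<^sub>F n in sequentially. cutoff n a b 0 t = indicator {a<..<b} t"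
  proof (cases "t \<in> {a<..<b}")
    case True
    then have "\<forall>\<^sub>F n in sequentially. 2 \<le> real n * (t - a) \<and> 2 \<le> real n * (b - t)"
      using ev[of "t - a"] ev[of "b - t"] eventually_conj by auto
    then show ?thesis using True by (auto elim!: eventually_mono intro!: cutoff_eq_1)
  next
    case False
    then have "t \<le> a \<or> (\<forall>n. t \<ge> b - 1 / real n)" by (auto intro: order_trans[of _ b])
    then show ?thesis using False ev[of "b - a"] assms
      by (auto elim!: eventually_mono intro!: cutoff_eq_0)
  qed
qed

text \<open>The rescaled derivative of the step is an approximate identity living on one side of
  \<open>t0\<close>, because it vanishes for non-positive arguments; hence only a one-sided limit of
  \<open>\<Phi>\<close> enters. The sign of \<open>c\<close> selects the side. The substitution is t
  = t0 + c (r + \<delta>) / n.\<close>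

lemma smooth_step_delta:
  fixes \<Phi> :: "real \<Rightarrow> real"
  assumes [measurable]: "\<Phi> \<in> borel_measurable borel" and K: "\<And>t. \<bar>\<Phi> t\<bar> \<le> K"
    and lim: "((\<lambda>r. \<Phi> (t0 + c * r)) \<longlongrightarrow> L) (at_right 0)" and c: "c \<noteq> 0" and \<delta>: "\<delta> \<ge> 0"
  shows "(\<lambda>n. LINT t|lborel. real n * \<bar>inverse c\<bar> * smooth_step (Suc 0) (real n * inverse c * (t - t0) - \<delta>) * \<Phi> t) \<longlonglongrightarrow> L"
proof -
  have "(\<lambda>n. LINT r|lborel. smooth_step (Suc 0) r * \<Phi> (t0 + c * ((r + \<delta>) / real n)))
     \<longlonglongrightarrow> (LINT r|lborel. smooth_step (Suc 0) r * L)"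
  proof (rule integral_dominated_convergence[where w="\<lambda>r. smooth_step (Suc 0) r * K"])
    show "AE r in lborel. (\<lambda>n. smooth_step (Suc 0) r * \<Phi> (t0 + c * ((r + \<delta>) / real n))) \<longlonglongrightarrow> smooth_step (Suc 0) r * L"
    proof (rule AE_I2)
      fix r
      show "(\<lambda>n. smooth_step (Suc 0) r * \<Phi> (t0 + c * ((r + \<delta>) / real n))) \<longlonglongrightarrow> smooth_step (Suc 0) r * L"
      proof (cases "r > 0")
        case True
        have "filterlim (\<lambda>n. (r + \<delta>) / real n) (at_right 0) sequentially"
          using True \<delta> by real_asymp
        then show ?thesis by (intro tendsto_mult tendsto_const filterlim_compose[OF lim])
      qed (simp)
    qed
    show "AE r in lborel. norm (smooth_step (Suc 0) r * \<Phi> (t0 + c * ((r + \<delta>) / real n))) \<le> smooth_step (Suc 0) r * K" for n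
      using K by (intro AE_I2) (auto simp: abs_mult smooth_step_1_nonneg intro!: mult_left_mono)
  qed (use integral_smooth_step_1 in auto)
  moreover have "\<forall>\<^sub>F n in sequentially. (LINT r|lborel. smooth_step (Suc 0) r * \<Phi> (t0 + c * ((r + \<delta>) / real n)))
     = (LINT t|lborel. real n * \<bar>inverse c\<bar> * smooth_step (Suc 0) (real n * inverse c * (t - t0) - \<delta>) * \<Phi> t)"
  proof (rule eventually_mono[OF eventually_gt_at_top[of 0]])
    fix n :: nat assume n: "0 < n"
    have eq: "t0 + c * ((t + (- real n * inverse c * t0 - \<delta>) + \<delta> + real n * inverse c * t - t) / real n) = t" for t
      using n c by (simp add: field_simps)
    show "(LINT r|lborel. smooth_step (Suc 0) r * \<Phi> (t0 + c * ((r + \<delta>) / real n)))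
     = (LINT t|lborel. real n * \<bar>inverse c\<bar> * smooth_step (Suc 0) (real n * inverse c * (t - t0) - \<delta>) * \<Phi> t)"
      using n c
      by (subst lborel_integral_real_affine[where c="real n * inverse c" and t="- real n * inverse c * t0 - \<delta>"])
         (use eq in \<open>auto simp: algebra_simps abs_mult abs_inverse simp flip: integral_mult_right_zero intro!: Bochner_Integration.integral_cong\<close>)
  qed
  ultimately show ?thesis
    using integral_smooth_step_1 by (auto intro: Lim_transform_eventually)
qed

text \<open>The derivative of the cutoff converges to the difference of the point masses at
  \<open>a\<close> and \<open>b\<close>. The rising ramp is the case c = 1, \<delta> = 0 of
  \<open>smooth_step_delta\<close>, the falling ramp the case c = -1, \<delta> = 1.\<close>

lemma cutoff_Suc_0_tendsto:
  fixes \<Phi> :: "real \<Rightarrow> real"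
  assumes [measurable]: "\<Phi> \<in> borel_measurable borel" and K: "\<And>t. \<bar>\<Phi> t\<bar> \<le> K"
    and a: "(\<Phi> \<longlongrightarrow> A) (at_right a)" and b: "(\<Phi> \<longlongrightarrow> B) (at_left b)"
  shows "(\<lambda>n. LINT t|lborel. cutoff n a b (Suc 0) t * \<Phi> t) \<longlonglongrightarrow> A - B"
proof -
  have A: "(\<lambda>n. LINT t|lborel. real n * smooth_step (Suc 0) (real n * (t - a)) * \<Phi> t) \<longlonglongrightarrow> A"
    using smooth_step_delta[of \<Phi> K a 1 A 0] a K by (simp add: filterlim_at_right_to_0[of _ _ a] add.commute)
  have B: "(\<lambda>n. LINT t|lborel. real n * smooth_step (Suc 0) (real n * (b - t) - 1) * \<Phi> t) \<longlonglongrightarrow> B"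
    using smooth_step_delta[of \<Phi> K b "-1" B 1] b K
    by (simp add: filterlim_at_left_to_right filterlim_at_right_to_0[of _ _ "- b"] algebra_simps)
  have int: "integrable lborel (\<lambda>t. real n * smooth_step (Suc 0) (real n * c * (t - a) - \<delta>) * \<Phi> t)"
    if "c \<noteq> 0" for n a c \<delta>
  proof (cases "n = 0")
    case False
    define f where "f = real n * c"
    have f: "f = real n * c" "f \<noteq> 0" using False that by (auto simp: f_def)
    have "integrable lborel (\<lambda>t. smooth_step (Suc 0) (- f * a - \<delta> + f * t))"
      by (rule lborel_integrable_real_affine[OF integral_smooth_step_1(1) f(2)])
    then have "integrable lborel (\<lambda>t. K * real n * smooth_step (Suc 0) (- f * a - \<delta> + f * t))" by simp
    moreover have eq: "real n * c * (t - a) - \<delta> = - f * a - \<delta> + f * t" for t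
      by (simp add: f_def algebra_simps)
    moreover have "\<bar>real n * smooth_step (Suc 0) y * \<Phi> t\<bar> \<le> \<bar>K * real n * smooth_step (Suc 0) y\<bar>" for y t
      using mult_right_mono[OF order_trans[OF K[of t] abs_ge_self], of "\<bar>real n * smooth_step (Suc 0) y\<bar>"]
      by (simp add: abs_mult mult_ac)
    ultimately show ?thesis
      by (intro Bochner_Integration.integrable_bound[OF \<open>integrable lborel (\<lambda>t. K * real n * _ t)\<close>] AE_I2)
         (simp_all only: eq real_norm_def, simp_all)
  qed simp
  have "(LINT t|lborel. cutoff n a b (Suc 0) t * \<Phi> t)
     = (LINT t|lborel. real n * smooth_step (Suc 0) (real n * (t - a)) * \<Phi> t)
     - (LINT t|lborel. real n * smooth_step (Suc 0) (real n * (b - t) - 1) * \<Phi> t)" for n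
    using int[of 1 n a 0] int[of "-1" n b 1]
    by (subst Bochner_Integration.integral_diff[symmetric])
       (auto simp: cutoff_def algebra_simps intro!: Bochner_Integration.integral_cong)
  then show ?thesis using tendsto_diff[OF A B] by simp
qed

lemma cutoff_0_tendsto:
  fixes H :: "real \<Rightarrow> real"
  assumes [measurable]: "integrable lborel H" and "a < b"
  shows "(\<lambda>n. LINT t|lborel. cutoff n a b 0 t * H t) \<longlonglongrightarrow> (LINT t:{a<..<b}|lborel. H t)"
  unfolding set_lebesgue_integral_def real_scaleR_def
proof (rule integral_dominated_convergence[where w="\<lambda>t. \<bar>H t\<bar>"])
  show "AE t in lborel. (\<lambda>n. cutoff n a b 0 t * H t) \<longlonglongrightarrow> indicator {a<..<b} t * H t"
    by (intro AE_I2 tendsto_intros cutoff_tendsto assms)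
  show "AE t in lborel. norm (cutoff n a b 0 t * H t) \<le> \<bar>H t\<bar>" for n
    using cutoff_bounds[of n a b] by (intro AE_I2) (auto simp: abs_mult intro!: mult_left_le_one_le)
qed (use assms in auto)

section \<open>Smooth functions of two variables and test functions\<close>

text \<open>The second difference over a square of side h, evaluated by the mean value theorem in
  either order, is h^2 times \<open>ftx\<close> at one point and h^2 times \<open>fxt\<close> at
  another point of the square; continuity then lets h tend to 0.\<close>

lemma mixed_partials_commute:
  fixes f :: "real \<times> real \<Rightarrow> real"
  assumes ft: "\<And>r x. ((\<lambda>s. f (s, x)) has_real_derivative ft (r, x)) (at r)"
    and fx: "\<And>r x. ((\<lambda>y. f (r, y)) has_real_derivative fx (r, x)) (at x)"
    and ftx: "\<And>r x. ((\<lambda>y. ft (r, y)) has_real_derivative ftx (r, x)) (at x)"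
    and fxt: "\<And>r x. ((\<lambda>s. fx (s, x)) has_real_derivative fxt (r, x)) (at r)"
    and c1: "continuous_on UNIV ftx" and c2: "continuous_on UNIV fxt"
  shows "ftx = fxt"
proof
  fix z :: "real \<times> real"
  obtain r x where z: "z = (r, x)" by fastforce
  have "\<exists>s\<in>{r..r+h}. \<exists>y\<in>{x..x+h}. \<exists>s'\<in>{r..r+h}. \<exists>y'\<in>{x..x+h}. ftx (s, y) = fxt (s', y')"
    if h: "h > 0" for h
  proof -
    have "\<exists>s>r. s < r + h \<and> (f (r+h, x+h) - f (r+h, x)) - (f (r, x+h) - f (r, x)) = (r + h - r) * (ft (s, x+h) - ft (s, x))"
      using h by (intro MVT2) (auto intro!: DERIV_diff ft)
    then obtain s where s: "r < s" "s < r + h"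
      and 1: "(f (r+h, x+h) - f (r+h, x)) - (f (r, x+h) - f (r, x)) = h * (ft (s, x+h) - ft (s, x))" by auto
    have "\<exists>y>x. y < x + h \<and> ft (s, x+h) - ft (s, x) = (x + h - x) * ftx (s, y)"
      using h by (intro MVT2) (auto intro!: ftx)
    then obtain y where y: "x < y" "y < x + h" and 2: "ft (s, x+h) - ft (s, x) = h * ftx (s, y)" by auto
    have "\<exists>y>x. y < x + h \<and> (f (r+h, x+h) - f (r, x+h)) - (f (r+h, x) - f (r, x)) = (x + h - x) * (fx (r+h, y) - fx (r, y))"
      using h by (intro MVT2) (auto intro!: DERIV_diff fx)
    then obtain y' where y': "x < y'" "y' < x + h"
      and 3: "(f (r+h, x+h) - f (r, x+h)) - (f (r+h, x) - f (r, x)) = h * (fx (r+h, y') - fx (r, y'))" by auto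
    have "\<exists>s>r. s < r + h \<and> fx (r+h, y') - fx (r, y') = (r + h - r) * fxt (s, y')"
      using h by (intro MVT2) (auto intro!: fxt)
    then obtain s' where s': "r < s'" "s' < r + h" and 4: "fx (r+h, y') - fx (r, y') = h * fxt (s', y')" by auto
    have "h * (h * ftx (s, y)) = h * (h * fxt (s', y'))" using 1[unfolded 2] 3[unfolded 4] by linarith
    then show ?thesis using h s y s' y' by force
  qed
  then have "\<exists>s y s' y'. s \<in> {r..r + 1 / Suc n} \<and> y \<in> {x..x + 1 / Suc n} \<and> s' \<in> {r..r + 1 / Suc n} \<and> y' \<in> {x..x + 1 / Suc n}
      \<and> ftx (s, y) = fxt (s', y')" for n :: nat
    by (metis of_nat_0_less_iff zero_less_Suc zero_less_divide_1_iff)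
  then obtain s y s' y' where s: "\<And>n::nat. s n \<in> {r..r + 1 / Suc n}" and y: "\<And>n::nat. y n \<in> {x..x + 1 / Suc n}"
    and s': "\<And>n::nat. s' n \<in> {r..r + 1 / Suc n}" and y': "\<And>n::nat. y' n \<in> {x..x + 1 / Suc n}"
    and eq: "\<And>n. ftx (s n, y n) = fxt (s' n, y' n)" by metis
  have lim: "p \<longlonglongrightarrow> c" if "\<And>n::nat. p n \<in> {c..c + 1 / Suc n}" for p and c :: real
  proof (rule tendsto_sandwich[of "\<lambda>_. c" p _ "\<lambda>n. c + 1 / Suc n"])
    show "(\<lambda>n. c + 1 / real (Suc n)) \<longlonglongrightarrow> c" by real_asymp
  qed (use that in auto)
  have "(\<lambda>n. ftx (s n, y n)) \<longlonglongrightarrow> ftx (r, x)" "(\<lambda>n. fxt (s' n, y' n)) \<longlonglongrightarrow> fxt (r, x)"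
    using c1 c2 lim[OF s] lim[OF y] lim[OF s'] lim[OF y']
    by (auto simp: continuous_on_eq_continuous_at isCont_def intro!: isCont_tendsto_compose[of _ ftx] isCont_tendsto_compose[of _ fxt] tendsto_Pair)
  then show "ftx z = fxt z" unfolding z eq using LIMSEQ_unique by blast
qed

text \<open>Choosing derivative operators \<open>R\<close> and \<open>X\<close> on \<open>F\<close>
  gives the required family as R^i X^j \<phi>. The rule for the space derivative of this family
  needs \<open>X\<close> to commute with powers of \<open>R\<close>, which is the symmetry of mixed
  partials.\<close>

lemma smooth2I_closed_set:
  assumes \<phi>: "\<phi> \<in> F" and cont: "\<And>f. f \<in> F \<Longrightarrow> continuous_on UNIV f"
    and dr: "\<And>f. f \<in> F \<Longrightarrow> \<exists>g\<in>F. \<forall>r x. ((\<lambda>s. f (s, x)) has_real_derivative g (r, x)) (at r)"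
    and dx: "\<And>f. f \<in> F \<Longrightarrow> \<exists>g\<in>F. \<forall>r x. ((\<lambda>y. f (r, y)) has_real_derivative g (r, x)) (at x)"
  shows "smooth2 \<phi>"
proof -
  obtain R where R: "\<And>f. f \<in> F \<Longrightarrow> R f \<in> F"
    "\<And>f r x. f \<in> F \<Longrightarrow> ((\<lambda>s. f (s, x)) has_real_derivative R f (r, x)) (at r)"
    using dr by metis
  obtain X where X: "\<And>f. f \<in> F \<Longrightarrow> X f \<in> F"
    "\<And>f r x. f \<in> F \<Longrightarrow> ((\<lambda>y. f (r, y)) has_real_derivative X f (r, x)) (at x)"
    using dx by metis
  have comm: "X (R f) = R (X f)" if "f \<in> F" for f
    using that by (intro mixed_partials_commute[of f "R f" "X f"]) (auto intro: R X cont)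
  have RF: "(R ^^ i) f \<in> F" if "f \<in> F" for i f using that by (induction i) (auto intro: R)
  have XF: "(X ^^ i) f \<in> F" if "f \<in> F" for i f using that by (induction i) (auto intro: X)
  have comm': "X ((R ^^ i) f) = (R ^^ i) (X f)" if "f \<in> F" for i f
    using that by (induction i) (auto simp: comm RF)
  show ?thesis
    unfolding smooth2_def
  proof (intro exI[of _ "\<lambda>i j. (R ^^ i) ((X ^^ j) \<phi>)"] conjI allI)
    fix i j r x
    show "continuous_on UNIV ((R ^^ i) ((X ^^ j) \<phi>))" by (intro cont RF XF \<phi>)
    show "((\<lambda>s. (R ^^ i) ((X ^^ j) \<phi>) (s, x)) has_real_derivative (R ^^ Suc i) ((X ^^ j) \<phi>) (r, x)) (at r)"
      using R(2)[OF RF[OF XF[OF \<phi>]]] by simp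
    show "((\<lambda>y. (R ^^ i) ((X ^^ j) \<phi>) (r, y)) has_real_derivative (R ^^ i) ((X ^^ Suc j) \<phi>) (r, x)) (at x)"
      using X(2)[OF RF[OF XF[OF \<phi>]]] by (simp add: comm' XF \<phi>)
  qed simp
qed

inductive_set fun_algebra :: "(real \<times> real \<Rightarrow> real) set \<Rightarrow> (real \<times> real \<Rightarrow> real) set" for B where
  base: "f \<in> B \<Longrightarrow> f \<in> fun_algebra B"
| const: "(\<lambda>_. c) \<in> fun_algebra B"
| add: "f \<in> fun_algebra B \<Longrightarrow> g \<in> fun_algebra B \<Longrightarrow> (\<lambda>z. f z + g z) \<in> fun_algebra B"
| mult: "f \<in> fun_algebra B \<Longrightarrow> g \<in> fun_algebra B \<Longrightarrow> (\<lambda>z. f z * g z) \<in> fun_algebra B"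

text \<open>Sum and product rules propagate closure under both partials from the generators to the
  algebra. Smoothness of a concrete function thus reduces to generators whose first partials are
  polynomial expressions in the generators.\<close>

lemma smooth2_fun_algebra:
  assumes cont: "\<And>f. f \<in> B \<Longrightarrow> continuous_on UNIV f"
    and dr: "\<And>f. f \<in> B \<Longrightarrow> \<exists>g\<in>fun_algebra B. \<forall>r x. ((\<lambda>s. f (s, x)) has_real_derivative g (r, x)) (at r)"
    and dx: "\<And>f. f \<in> B \<Longrightarrow> \<exists>g\<in>fun_algebra B. \<forall>r x. ((\<lambda>y. f (r, y)) has_real_derivative g (r, x)) (at x)"
    and \<phi>: "\<phi> \<in> fun_algebra B"
  shows "smooth2 \<phi>"
  using \<phi>
proof (rule smooth2I_closed_set)
  fix f assume "f \<in> fun_algebra B"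
  then show "continuous_on UNIV f"
    by induction (auto intro: cont continuous_intros)
  show "\<exists>g\<in>fun_algebra B. \<forall>r x. ((\<lambda>s. f (s, x)) has_real_derivative g (r, x)) (at r)"
    using \<open>f \<in> fun_algebra B\<close>
  proof induction
    case (add f g)
    then obtain f' g' where *: "f' \<in> fun_algebra B" "g' \<in> fun_algebra B"
      "\<And>r x. ((\<lambda>s. f (s, x)) has_real_derivative f' (r, x)) (at r)"
      "\<And>r x. ((\<lambda>s. g (s, x)) has_real_derivative g' (r, x)) (at r)" by auto
    then show ?case
      by (intro bexI[of _ "\<lambda>z. f' z + g' z"]) (auto intro!: fun_algebra.add DERIV_add)
  next
    case (mult f g)
    then obtain f' g' where *: "f' \<in> fun_algebra B" "g' \<in> fun_algebra B"
      "\<And>r x. ((\<lambda>s. f (s, x)) has_real_derivative f' (r, x)) (at r)"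
      "\<And>r x. ((\<lambda>s. g (s, x)) has_real_derivative g' (r, x)) (at r)" by auto
    then show ?case
      by (intro bexI[of _ "\<lambda>z. f' z * g z + g' z * f z"])
         (auto intro!: fun_algebra.add fun_algebra.mult mult DERIV_mult)
  next
    case (const c)
    show ?case by (rule bexI[of _ "\<lambda>_. 0"]) (auto intro: fun_algebra.const)
  qed (use dr in auto)
  show "\<exists>g\<in>fun_algebra B. \<forall>r x. ((\<lambda>y. f (r, y)) has_real_derivative g (r, x)) (at x)"
    using \<open>f \<in> fun_algebra B\<close>
  proof induction
    case (add f g)
    then obtain f' g' where *: "f' \<in> fun_algebra B" "g' \<in> fun_algebra B"
      "\<And>r x. ((\<lambda>y. f (r, y)) has_real_derivative f' (r, x)) (at x)"
      "\<And>r x. ((\<lambda>y. g (r, y)) has_real_derivative g' (r, x)) (at x)" by auto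
    then show ?case
      by (intro bexI[of _ "\<lambda>z. f' z + g' z"]) (auto intro!: fun_algebra.add DERIV_add)
  next
    case (mult f g)
    then obtain f' g' where *: "f' \<in> fun_algebra B" "g' \<in> fun_algebra B"
      "\<And>r x. ((\<lambda>y. f (r, y)) has_real_derivative f' (r, x)) (at x)"
      "\<And>r x. ((\<lambda>y. g (r, y)) has_real_derivative g' (r, x)) (at x)" by auto
    then show ?case
      by (intro bexI[of _ "\<lambda>z. f' z * g z + g' z * f z"])
         (auto intro!: fun_algebra.add fun_algebra.mult mult DERIV_mult)
  next
    case (const c)
    show ?case by (rule bexI[of _ "\<lambda>_. 0"]) (auto intro: fun_algebra.const)
  qed (use dx in auto)
qed

lemma smooth2_const [intro]: "smooth2 (\<lambda>_. c)"
  by (rule smooth2_fun_algebra[where B="{}"]) (auto intro: fun_algebra.const)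

lemma smooth2_add [intro]:
  assumes "smooth2 f" "smooth2 g" shows "smooth2 (\<lambda>z. f z + g z)"
  and smooth2_mult [intro]:
  "smooth2 (\<lambda>z. f z * g z)"
proof -
  obtain D E where D: "D 0 0 = f" "\<And>i j. continuous_on UNIV (D i j)"
      "\<And>i j r x. ((\<lambda>s. D i j (s, x)) has_real_derivative D (Suc i) j (r, x)) (at r)"
      "\<And>i j r x. ((\<lambda>y. D i j (r, y)) has_real_derivative D i (Suc j) (r, x)) (at x)"
    and E: "E 0 0 = g" "\<And>i j. continuous_on UNIV (E i j)"
      "\<And>i j r x. ((\<lambda>s. E i j (s, x)) has_real_derivative E (Suc i) j (r, x)) (at r)"
      "\<And>i j r x. ((\<lambda>y. E i j (r, y)) has_real_derivative E i (Suc j) (r, x)) (at x)"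
    using assms unfolding smooth2_def by metis
  let ?B = "range (case_prod D) \<union> range (case_prod E)"
  have B: "D i j \<in> fun_algebra ?B" "E i j \<in> fun_algebra ?B" for i j
    by (auto intro!: fun_algebra.base simp: image_iff)
  have *: "smooth2 \<phi>" if "\<phi> \<in> fun_algebra ?B" for \<phi>
    using that
  proof (rule smooth2_fun_algebra[rotated 3])
    fix f assume "f \<in> ?B"
    then obtain i j where ij: "f = D i j \<or> f = E i j" by auto
    then show "continuous_on UNIV f" using D E by auto
    show "\<exists>g\<in>fun_algebra ?B. \<forall>r x. ((\<lambda>s. f (s, x)) has_real_derivative g (r, x)) (at r)"
      using ij
    proof
      assume "f = D i j" then show ?thesis using D(3) B(1) by blast
    next
      assume "f = E i j" then show ?thesis using E(3) B(2) by blast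
    qed
    show "\<exists>g\<in>fun_algebra ?B. \<forall>r x. ((\<lambda>y. f (r, y)) has_real_derivative g (r, x)) (at x)"
      using ij
    proof
      assume "f = D i j" then show ?thesis using D(4) B(1) by blast
    next
      assume "f = E i j" then show ?thesis using E(4) B(2) by blast
    qed
  qed
  show "smooth2 (\<lambda>z. f z + g z)" "smooth2 (\<lambda>z. f z * g z)"
    using fun_algebra.add[OF B(1)[of 0 0] B(2)[of 0 0]] fun_algebra.mult[OF B(1)[of 0 0] B(2)[of 0 0]] *
    by (auto simp: D(1) E(1))
qed

lemma smooth2_fst_deriv_seq:
  assumes "\<And>n t. (f n has_real_derivative f (Suc n) t) (at t)"
  shows "smooth2 (\<lambda>z. f k (fst z))"
proof (rule smooth2_fun_algebra[where B="range (\<lambda>k z. f k (fst z))"])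
  have c: "continuous_on UNIV (f k)" for k
    by (intro continuous_at_imp_continuous_on ballI DERIV_isCont[OF assms])
  fix g assume "g \<in> range (\<lambda>k (z :: real \<times> real). f k (fst z))"
  then obtain k where k: "g = (\<lambda>z. f k (fst z))" by auto
  show "continuous_on UNIV g"
    unfolding k by (intro continuous_on_compose2[OF c] continuous_intros) auto
  show "\<exists>h\<in>fun_algebra (range (\<lambda>k z. f k (fst z))). \<forall>r x. ((\<lambda>s. g (s, x)) has_real_derivative h (r, x)) (at r)"
    unfolding k by (rule bexI[of _ "\<lambda>z. f (Suc k) (fst z)"]) (auto intro: assms fun_algebra.base)
  show "\<exists>h\<in>fun_algebra (range (\<lambda>k z. f k (fst z))). \<forall>r x. ((\<lambda>y. g (r, y)) has_real_derivative h (r, x)) (at x)"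
    unfolding k by (rule bexI[of _ "\<lambda>z. 0"]) (auto intro: fun_algebra.const)
qed (auto intro: fun_algebra.base)

lemma smooth2_snd_deriv_seq:
  assumes "\<And>n t. (f n has_real_derivative f (Suc n) t) (at t)"
  shows "smooth2 (\<lambda>z. f k (snd z))"
proof (rule smooth2_fun_algebra[where B="range (\<lambda>k z. f k (snd z))"])
  have c: "continuous_on UNIV (f k)" for k
    by (intro continuous_at_imp_continuous_on ballI DERIV_isCont[OF assms])
  fix g assume "g \<in> range (\<lambda>k (z :: real \<times> real). f k (snd z))"
  then obtain k where k: "g = (\<lambda>z. f k (snd z))" by auto
  show "continuous_on UNIV g"
    unfolding k by (intro continuous_on_compose2[OF c] continuous_intros) auto
  show "\<exists>h\<in>fun_algebra (range (\<lambda>k z. f k (snd z))). \<forall>r x. ((\<lambda>s. g (s, x)) has_real_derivative h (r, x)) (at r)"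
    unfolding k by (rule bexI[of _ "\<lambda>z. 0"]) (auto intro: fun_algebra.const)
  show "\<exists>h\<in>fun_algebra (range (\<lambda>k z. f k (snd z))). \<forall>r x. ((\<lambda>y. g (r, y)) has_real_derivative h (r, x)) (at x)"
    unfolding k by (rule bexI[of _ "\<lambda>z. f (Suc k) (snd z)"]) (auto intro: assms fun_algebra.base)
qed (auto intro: fun_algebra.base)

lemma smooth2_poly_fst [intro]: "smooth2 (\<lambda>z. poly p (fst z))"
  using smooth2_fst_deriv_seq[of "\<lambda>n. poly ((pderiv ^^ n) p)" 0] poly_DERIV by simp

lemma smooth2_smooth_step_poly:
  "smooth2 (\<lambda>z. smooth_step k (poly p (fst z)))"
proof (rule smooth2_fun_algebra[where B="range (\<lambda>k z. smooth_step k (poly p (fst z))) \<union> range (\<lambda>q z. poly q (fst z))"])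
  let ?B = "range (\<lambda>k z. smooth_step k (poly p (fst z))) \<union> range (\<lambda>q z. poly q (fst z)) :: (real \<times> real \<Rightarrow> real) set"
  fix g assume "g \<in> ?B"
  then consider k where "g = (\<lambda>z. smooth_step k (poly p (fst z)))" | q where "g = (\<lambda>z. poly q (fst z))" by auto
  note g = this
  show "continuous_on UNIV g"
    using g by cases (auto intro!: continuous_on_compose2[OF continuous_smooth_step] continuous_intros)
  show "\<exists>h\<in>fun_algebra ?B. \<forall>r x. ((\<lambda>s. g (s, x)) has_real_derivative h (r, x)) (at r)"
    using g
  proof cases
    case 1
    have "(\<lambda>z. smooth_step (Suc k) (poly p (fst z)) * poly (pderiv p) (fst z)) \<in> fun_algebra ?B"
      by (intro fun_algebra.mult fun_algebra.base) auto
    then show ?thesis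
      by (rule bexI[rotated]) (auto simp: 1 intro!: DERIV_chain2[OF smooth_step_has_derivative] poly_DERIV)
  next
    case 2
    then show ?thesis
      by (intro bexI[of _ "\<lambda>z. poly (pderiv q) (fst z)"] fun_algebra.base) (auto intro: poly_DERIV)
  qed
  show "\<exists>h\<in>fun_algebra ?B. \<forall>r x. ((\<lambda>y. g (r, y)) has_real_derivative h (r, x)) (at x)"
    by (rule bexI[OF _ fun_algebra.const[of 0]]) (rule disjE[of "\<exists>k. g = (\<lambda>z. smooth_step k (poly p (fst z)))" "\<exists>q. g = (\<lambda>z. poly q (fst z))"], use g in blast, auto)
qed (auto intro: fun_algebra.base)

text \<open>With S = T^(-1/2), E the exponential and X = x - x0, division disappears: 1/T is S^2, so
  S_r = -T' S^3 / 2, E_r = T' E X^2 S^4 / 2 and E_x = -X E S^2. Together with the partials of T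
  these generate an algebra closed under differentiation.\<close>

lemma smooth2_gaussian:
  assumes T: "smooth2 (\<lambda>z. T (fst z))" and pos: "\<And>t. T t > (0 :: real)"
  shows "smooth2 (\<lambda>z. 1 / sqrt (T (fst z)) * exp (- (snd z - x0)\<^sup>2 / (2 * T (fst z))))"
proof -
  obtain D where D: "D 0 0 = (\<lambda>z. T (fst z))" "\<And>i j. continuous_on UNIV (D i j)"
      "\<And>i j r x. ((\<lambda>s. D i j (s, x)) has_real_derivative D (Suc i) j (r, x)) (at r)"
      "\<And>i j r x. ((\<lambda>y. D i j (r, y)) has_real_derivative D i (Suc j) (r, x)) (at x)"
    using T unfolding smooth2_def by metis
  define S where "S = (\<lambda>z :: real \<times> real. 1 / sqrt (T (fst z)))"
  define E where "E = (\<lambda>z :: real \<times> real. exp (- (snd z - x0)\<^sup>2 / (2 * T (fst z))))"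
  define X where "X = (\<lambda>z :: real \<times> real. snd z - x0)"
  let ?B = "range (case_prod D) \<union> {S, E, X}"
  have B: "D i j \<in> fun_algebra ?B" "S \<in> fun_algebra ?B" "E \<in> fun_algebra ?B" "X \<in> fun_algebra ?B" for i j
    by (auto intro!: fun_algebra.base simp: image_iff)
  have cT: "continuous_on UNIV (\<lambda>z :: real \<times> real. T (fst z))" using D(2)[of 0 0] D(1) by simp
  have dT: "(T has_real_derivative D 1 0 (r, x)) (at r)" for r x
    using D(3)[of 0 0 x r] by (simp add: D(1))
  have S2: "S (r, x) * S (r, x) = 1 / T r" for r x
    using pos[of r] by (simp add: S_def)
  have "smooth2 \<phi>" if "\<phi> \<in> fun_algebra ?B" for \<phi>
    using that
  proof (rule smooth2_fun_algebra[rotated 3])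
    fix f assume "f \<in> ?B"
    then consider i j where "f = D i j" | "f = S" | "f = E" | "f = X" by auto
    note f = this
    have T0: "T r \<noteq> 0" for r using pos[of r] by simp
    show "continuous_on UNIV f"
      using f by cases (use D pos T0 in \<open>auto simp: S_def E_def X_def less_imp_le intro!: continuous_intros cT\<close>)
    show "\<exists>g\<in>fun_algebra ?B. \<forall>r x. ((\<lambda>s. f (s, x)) has_real_derivative g (r, x)) (at r)"
      using f
    proof cases
      case 2
      have a: "(\<lambda>z. (- 1 / 2) * (D 1 0 z * (S z * (S z * S z)))) \<in> fun_algebra ?B"
        by (intro fun_algebra.mult fun_algebra.const B)
      have b: "((\<lambda>s. S (s, x)) has_real_derivative (- 1 / 2) * (D 1 0 (r, x) * (S (r, x) * (S (r, x) * S (r, x))))) (at r)" for r x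
        unfolding S_def fst_conv using pos[of r]
        by (auto intro!: derivative_eq_intros dT simp: field_simps)
      show ?thesis unfolding 2 by (rule bexI[OF _ a]) (intro allI b)
    next
      case 3
      have a: "(\<lambda>z. (1 / 2) * (D 1 0 z * (E z * (X z * X z * (S z * S z * (S z * S z)))))) \<in> fun_algebra ?B"
        by (intro fun_algebra.mult fun_algebra.const B)
      have b: "((\<lambda>s. E (s, x)) has_real_derivative (1 / 2) * (D 1 0 (r, x) * (E (r, x) * (X (r, x) * X (r, x) * (S (r, x) * S (r, x) * (S (r, x) * S (r, x))))))) (at r)" for r x
        unfolding S2 unfolding E_def X_def fst_conv snd_conv using pos[of r]
        by (auto intro!: derivative_eq_intros dT simp: field_simps power2_eq_square)
      show ?thesis unfolding 3 by (rule bexI[OF _ a]) (intro allI b)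
    next
      case 4
      show ?thesis unfolding 4 X_def by (intro bexI[OF _ fun_algebra.const[of 0]]) auto
    qed (use D(3) B(1) in blast)
    show "\<exists>g\<in>fun_algebra ?B. \<forall>r x. ((\<lambda>y. f (r, y)) has_real_derivative g (r, x)) (at x)"
      using f
    proof cases
      case 2
      show ?thesis unfolding 2 S_def by (intro bexI[OF _ fun_algebra.const[of 0]]) auto
    next
      case 3
      have a: "(\<lambda>z. (- 1) * (X z * (E z * (S z * S z)))) \<in> fun_algebra ?B"
        by (intro fun_algebra.mult fun_algebra.const B)
      have b: "((\<lambda>y. E (r, y)) has_real_derivative (- 1) * (X (r, x) * (E (r, x) * (S (r, x) * S (r, x))))) (at x)" for r x
        unfolding S2 unfolding E_def X_def fst_conv snd_conv using pos[of r]
        by (auto intro!: derivative_eq_intros simp: field_simps power2_eq_square)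
      show ?thesis unfolding 3 by (rule bexI[OF _ a]) (intro allI b)
    next
      case 4
      show ?thesis unfolding 4 X_def by (intro bexI[OF _ fun_algebra.const[of 1]]) (auto intro!: derivative_eq_intros)
    qed (use D(4) B(1) in blast)
  qed
  from this[OF fun_algebra.mult[OF B(2,3)]] show ?thesis by (simp add: S_def E_def)
qed

section \<open>Partial derivatives and supports of test functions\<close>

lemma smooth2_partials:
  assumes "smooth2 \<phi>"
  shows smooth2_continuous: "continuous_on UNIV \<phi>"
    and smooth2_partial_r: "((\<lambda>s. \<phi> (s, x)) has_real_derivative partial_r \<phi> (r, x)) (at r)"
    and smooth2_partial_x: "((\<lambda>y. \<phi> (r, y)) has_real_derivative partial_x \<phi> (r, x)) (at x)"
    and smooth2_continuous_partial_r: "continuous_on UNIV (partial_r \<phi>)"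
    and smooth2_smooth2_partial_x: "smooth2 (partial_x \<phi>)"
proof -
  obtain D where D: "D 0 0 = \<phi>" "\<And>i j. continuous_on UNIV (D i j)"
      "\<And>i j r x. ((\<lambda>s. D i j (s, x)) has_real_derivative D (Suc i) j (r, x)) (at r)"
      "\<And>i j r x. ((\<lambda>y. D i j (r, y)) has_real_derivative D i (Suc j) (r, x)) (at x)"
    using assms unfolding smooth2_def by metis
  have r: "partial_r \<phi> = D 1 0"
    using DERIV_imp_deriv[OF D(3)[of 0 0]] by (auto simp: partial_r_def D(1))
  have x: "partial_x \<phi> = D 0 1"
    using DERIV_imp_deriv[OF D(4)[of 0 0]] by (auto simp: partial_x_def D(1))
  show "continuous_on UNIV \<phi>" "continuous_on UNIV (partial_r \<phi>)" using D(2)[of 0 0] D(2) by (auto simp: D(1) r)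
  show "((\<lambda>s. \<phi> (s, x)) has_real_derivative partial_r \<phi> (r, x)) (at r)" using D(3)[of 0 0] by (simp add: D(1) r)
  show "((\<lambda>y. \<phi> (r, y)) has_real_derivative partial_x \<phi> (r, x)) (at x)" using D(4)[of 0 0] by (simp add: D(1) x)
  show "smooth2 (partial_x \<phi>)"
    unfolding smooth2_def x by (rule exI[of _ "\<lambda>i j. D i (Suc j)"]) (use D in auto)
qed

lemma partial_r_eqI:
  "(\<And>r x. ((\<lambda>s. f (s, x)) has_real_derivative g (r, x)) (at r)) \<Longrightarrow> partial_r f = g"
  unfolding partial_r_def by (intro ext) (auto intro!: DERIV_imp_deriv)

lemma partial_x_eqI:
  "(\<And>r x. ((\<lambda>y. f (r, y)) has_real_derivative g (r, x)) (at x)) \<Longrightarrow> partial_x f = g"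
  unfolding partial_x_def by (intro ext) (auto intro!: DERIV_imp_deriv)

lemma test_functionI:
  assumes "smooth2 \<phi>" and supp: "\<And>t x. \<phi> (t, x) \<noteq> 0 \<Longrightarrow> t \<in> {a..b} \<and> x \<in> {c..d}" and "0 < a" "b < 1"
  shows "test_function \<phi>"
proof -
  have "{z. \<phi> z \<noteq> 0} \<subseteq> {a..b} \<times> {c..d}" using supp by auto
  then have *: "closure {z. \<phi> z \<noteq> 0} \<subseteq> {a..b} \<times> {c..d}"
    by (rule closure_minimal) (auto intro: closed_Times)
  have "compact ({a..b} \<times> {c..d})" by (intro compact_Times) auto
  then have "compact (closure {z. \<phi> z \<noteq> 0})"
    using * by (meson closed_closure compact_Int_closed inf.absorb_iff2 compact_closure bounded_subset compact_imp_bounded closure_subset order_trans)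
  then show ?thesis using assms * by (auto simp: test_function_def open_strip_def)
qed

lemma test_function_support:
  assumes "test_function \<phi>"
  obtains a b R where "0 < a" "a < b" "b < 1" "0 < R" "\<And>t x. t \<le> a \<or> t \<ge> b \<or> \<bar>x\<bar> \<ge> R \<Longrightarrow> \<phi> (t, x) = 0"
proof (cases "\<forall>z. \<phi> z = 0")
  case True
  then show ?thesis using that[of "1/3" "1/2" 1] by auto
next
  case False
  let ?K = "closure {z. \<phi> z \<noteq> 0}"
  have K: "compact ?K" "?K \<subseteq> open_strip" using assms by (auto simp: test_function_def)
  have ne: "?K \<noteq> {}" using False closure_subset[of "{z. \<phi> z \<noteq> 0}"] by auto
  have "compact (fst ` ?K)" "compact (snd ` ?K)"
    by (auto intro!: compact_continuous_image continuous_intros K)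
  then obtain R where R: "\<And>z. z \<in> ?K \<Longrightarrow> \<bar>snd z\<bar> \<le> R"
    by (metis bounded_iff compact_imp_bounded image_eqI real_norm_def)
  obtain s1 where s1: "s1 \<in> fst ` ?K" "\<And>t. t \<in> fst ` ?K \<Longrightarrow> s1 \<le> t"
    using compact_attains_inf[OF \<open>compact (fst ` ?K)\<close>] ne by auto
  obtain s2 where s2: "s2 \<in> fst ` ?K" "\<And>t. t \<in> fst ` ?K \<Longrightarrow> t \<le> s2"
    using compact_attains_sup[OF \<open>compact (fst ` ?K)\<close>] ne by auto
  have s: "0 < s1" "s2 < 1" "s1 \<le> s2" using s1 s2 K(2) by (auto simp: open_strip_def)
  show ?thesis
  \<comment> \<open>Moving halfway from the support towards the edges of the strip, and enlarging
    \<open>R\<close> by 1, makes \<phi> vanish on the sides of the rectangle as well.\<close>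
  proof (rule that[of "s1 / 2" "(s2 + 1) / 2" "\<bar>R\<bar> + 1"])
    fix t x assume *: "t \<le> s1 / 2 \<or> t \<ge> (s2 + 1) / 2 \<or> \<bar>x\<bar> \<ge> \<bar>R\<bar> + 1"
    show "\<phi> (t, x) = 0"
    proof (rule ccontr)
      assume "\<phi> (t, x) \<noteq> 0"
      then have "(t, x) \<in> ?K" using closure_subset[of "{z. \<phi> z \<noteq> 0}"] by auto
      then have "s1 \<le> t" "t \<le> s2" "\<bar>x\<bar> \<le> R" using s1(2)[of t] s2(2)[of t] R[of "(t,x)"] by force+
      then show False using * s by (auto simp: field_simps)
    qed
  qed (use s in auto)
qed

section \<open>Box integrals of the weak derivative\<close>

lemma fst_snd_borel_measurable [measurable]:
  "fst \<in> borel_measurable (borel :: (real \<times> real) measure)"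
  "snd \<in> borel_measurable (borel :: (real \<times> real) measure)"
  by (auto intro!: borel_measurable_continuous_onI continuous_intros)

lemma Pair_borel_measurable [measurable]:
  "Pair t \<in> borel \<rightarrow>\<^sub>M (borel :: (real \<times> real) measure)"
  by (auto intro!: borel_measurable_continuous_onI continuous_intros)

lemma strip_borel [measurable]: "open_strip \<in> sets borel" "closed_strip \<in> sets borel"
  unfolding open_strip_def closed_strip_def
  by (auto intro!: borel_Times)

lemma Pair2_borel_measurable [measurable]:
  "(\<lambda>t. (t, x)) \<in> borel \<rightarrow>\<^sub>M (borel :: (real \<times> real) measure)"
  by (auto intro!: borel_measurable_continuous_onI continuous_intros)

lemma cutoff_outside:
  assumes "2 \<le> real n * (b - a)" "t \<notin> {a..b}"
  shows "cutoff n a b k t = 0"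
proof (rule cutoff_eq_0[OF assms(1)])
  have "b - 1 / real n \<le> b" by simp
  then show "t \<le> a \<or> b - 1 / real n \<le> t" using assms(2) unfolding atLeastAtMost_iff by linarith
qed

lemma cutoff_bounded: "\<exists>K. \<forall>a b t. \<bar>cutoff n a b k t\<bar> \<le> K"
proof -
  obtain K where K: "\<And>x. \<bar>smooth_step k x\<bar> \<le> K" using smooth_step_bounded by blast
  have "\<bar>cutoff n a b k t\<bar> \<le> real n ^ k * K + real n ^ k * K + 1" for a b t
  proof -
    have "\<bar>real n ^ k * smooth_step k (real n * (t - a))\<bar> \<le> real n ^ k * K"
      "\<bar>(- real n) ^ k * smooth_step k (real n * (b - t) - 1)\<bar> \<le> real n ^ k * K"
      unfolding abs_mult power_abs by (auto intro!: mult_left_mono K)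
    moreover have "\<bar>X\<bar> \<le> M \<Longrightarrow> \<bar>Y\<bar> \<le> M \<Longrightarrow> \<bar>X + Y - (if b then 1 else 0)\<bar> \<le> M + M + 1" for X Y M :: real and b
      by (smt (verit))
    ultimately show ?thesis unfolding cutoff_def by blast
  qed
  then show ?thesis by blast
qed

lemma integral_lborel_prod:
  fixes F :: "real \<times> real \<Rightarrow> real"
  assumes "integrable lborel F"
  shows "(LINT z|lborel. F z) = (LINT t|lborel. LINT x|lborel. F (t, x))"
    and "integrable lborel (\<lambda>t. LINT x|lborel. F (t, x))"
    and "AE t in lborel. integrable lborel (\<lambda>x. F (t, x))"
  using assms lborel_pair.integral_fst'[of F] lborel_pair.integrable_fst'[of F] lborel_pair.AE_integrable_fst'[of F]
  by (auto simp: lborel_prod)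

lemma integrable_bounded_support:
  fixes F :: "'a::euclidean_space \<Rightarrow> real"
  assumes [measurable]: "F \<in> borel_measurable borel" and "\<And>z. z \<in> cbox a b \<Longrightarrow> \<bar>F z\<bar> \<le> K" "\<And>z. z \<notin> cbox a b \<Longrightarrow> F z = 0"
  shows "integrable lborel F"
proof (rule Bochner_Integration.integrable_bound)
  show "integrable lborel (\<lambda>z. K * indicator (cbox a b) z)"
    by (intro integrable_mult_right integrable_real_indicator emeasure_lborel_cbox_finite) auto
  show "AE z in lborel. norm (F z) \<le> norm (K * indicator (cbox a b) z)"
    using assms(2,3) by (intro AE_I2) (fastforce simp: indicator_def)
qed auto

lemma integrable_bounded_support_prod:
  fixes F :: "real \<times> real \<Rightarrow> real"
  assumes "F \<in> borel_measurable borel"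
    and "\<And>t x. t \<in> {a..b} \<Longrightarrow> x \<in> {c..d} \<Longrightarrow> \<bar>F (t, x)\<bar> \<le> K"
    and "\<And>t x. \<not> (t \<in> {a..b} \<and> x \<in> {c..d}) \<Longrightarrow> F (t, x) = 0"
  shows "integrable lborel F"
  by (rule integrable_bounded_support[where a="(a,c)" and b="(b,d)" and K=K])
     (use assms in \<open>auto simp: cbox_Pair_eq simp del: atLeastAtMost_iff\<close>)

text \<open>Each ramp has total variation 1 whatever \<open>n\<close> is. The resulting bound is
  uniform in \<open>n\<close> and serves as the majorant for dominated convergence in
  \<open>box_integral\<close>.\<close>

lemma cutoff_Suc_0_bound:
  fixes \<Phi> :: "real \<Rightarrow> real"
  assumes [measurable]: "\<Phi> \<in> borel_measurable borel" and K: "\<And>t. \<bar>\<Phi> t\<bar> \<le> K"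
  shows "\<bar>LINT t|lborel. cutoff n a b (Suc 0) t * \<Phi> t\<bar> \<le> 2 * K"
proof (cases "n = 0")
  case False
  let ?s = "smooth_step (Suc 0)"
  have K0: "K \<ge> 0" using K[of 0] by simp
  have a: "real n * (t - a) = - real n * a + real n * t" and b: "real n * (b - t) - 1 = (real n * b - 1) + (- real n) * t" for t
    by (auto simp: algebra_simps)
  have i1: "integrable lborel (\<lambda>t. real n * ?s (real n * (t - a)))"
    and i2: "integrable lborel (\<lambda>t. real n * ?s (real n * (b - t) - 1))"
    using False unfolding a b by (intro integrable_mult_right lborel_integrable_real_affine integral_smooth_step_1; simp)+
  have v1: "(LINT t|lborel. real n * ?s (real n * (t - a))) = 1"
    using lborel_integral_real_affine[of "real n" ?s "- real n * a"] False
    unfolding a by (simp add: integral_smooth_step_1)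
  have v2: "(LINT t|lborel. real n * ?s (real n * (b - t) - 1)) = 1"
    using lborel_integral_real_affine[of "- real n" ?s "real n * b - 1"] False
    unfolding b by (simp add: integral_smooth_step_1)
  have "\<bar>LINT t|lborel. cutoff n a b (Suc 0) t * \<Phi> t\<bar> \<le> (LINT t|lborel. K * (real n * ?s (real n * (t - a)) + real n * ?s (real n * (b - t) - 1)))"
  proof (rule integral_abs_bound_integral)
    have dom: "\<bar>cutoff n a b (Suc 0) t * \<Phi> t\<bar> \<le> K * (real n * ?s (real n * (t - a)) + real n * ?s (real n * (b - t) - 1))" for t
    proof -
      have "\<bar>cutoff n a b (Suc 0) t\<bar> \<le> real n * ?s (real n * (t - a)) + real n * ?s (real n * (b - t) - 1)"
        using smooth_step_1_nonneg[of "real n * (t - a)"] smooth_step_1_nonneg[of "real n * (b - t) - 1"]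
        by (auto simp: cutoff_def abs_le_iff mult_nonneg_nonneg)
      then show ?thesis using K[of t] K0 by (auto simp: abs_mult mult.commute[of K] intro!: mult_mono)
    qed
    show "integrable lborel (\<lambda>t. K * (real n * ?s (real n * (t - a)) + real n * ?s (real n * (b - t) - 1)))"
      by (rule integrable_mult_right[OF Bochner_Integration.integrable_add[OF i1 i2]])
    then show "integrable lborel (\<lambda>t. cutoff n a b (Suc 0) t * \<Phi> t)"
      by (rule Bochner_Integration.integrable_bound) (auto intro!: AE_I2 order_trans[OF dom abs_ge_self])
    show "\<bar>cutoff n a b (Suc 0) t * \<Phi> t\<bar> \<le> K * (real n * ?s (real n * (t - a)) + real n * ?s (real n * (b - t) - 1))" for t
      by (rule dom)
  qed
  also have "\<dots> = 2 * K"
    by (subst integral_mult_right_zero, subst Bochner_Integration.integral_add[OF i1 i2]) (simp only: v1 v2, simp)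
  finally show ?thesis .
qed (use K[of 0] in \<open>simp add: cutoff_def\<close>)

text \<open>The time cutoff already vanishes at \<open>t2 - 1 / n\<close>, so the support stays
  compactly inside the open strip even for \<open>t2 = 1\<close>.\<close>

lemma test_function_cutoff_product:
  assumes "0 < t1" "t1 < t2" "t2 \<le> 1" "x1 < x2"
    "2 \<le> real n * (t2 - t1)" "2 \<le> real k * (x2 - x1)" "smooth2 G"
  shows "test_function (\<lambda>z. cutoff n t1 t2 0 (fst z) * cutoff k x1 x2 0 (snd z) * G z)"
proof (rule test_functionI[where a=t1 and b="t2 - 1 / real n" and c=x1 and d=x2])
  have n: "n > 0" using assms(5) by (cases n) auto
  show "t2 - 1 / real n < 1" using n assms(3) by (smt (verit) divide_pos_pos of_nat_0_less_iff)
  show "smooth2 (\<lambda>z. cutoff n t1 t2 0 (fst z) * cutoff k x1 x2 0 (snd z) * G z)"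
    by (intro smooth2_mult smooth2_fst_deriv_seq[of "cutoff n t1 t2"] smooth2_snd_deriv_seq[of "cutoff k x1 x2"]
        cutoff_has_derivative assms)
  fix t x assume "cutoff n t1 t2 0 (fst (t, x)) * cutoff k x1 x2 0 (snd (t, x)) * G (t, x) \<noteq> 0"
  then have "cutoff n t1 t2 0 t \<noteq> 0" "cutoff k x1 x2 0 x \<noteq> 0" by auto
  then show "t \<in> {t1..t2 - 1 / real n} \<and> x \<in> {x1..x2}"
    using cutoff_eq_0[OF assms(5), of t 0] cutoff_outside[OF assms(6), of x 0]
    by (smt (verit) atLeastAtMost_iff)
qed (use assms in auto)

text \<open>The linear equation satisfied by the difference of two weak solutions: \<open>w\<close> is the difference,
  \<open>d\<close> its weak space derivative, and \<open>f\<close> the difference of the nonlinear terms.\<close>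

locale linear_weak =
  fixes P :: "real poly" and w d f :: "real \<times> real \<Rightarrow> real" and C :: real
  assumes w_cont: "continuous_on closed_strip w"
    and w_outside: "\<And>z. z \<notin> closed_strip \<Longrightarrow> w z = 0"
    and d_meas [measurable]: "d \<in> borel_measurable borel"
    and f_meas [measurable]: "f \<in> borel_measurable borel"
    and d_bound: "\<And>z. \<bar>d z\<bar> \<le> C"
    and f_bound: "\<And>z. \<bar>f z\<bar> \<le> C * \<bar>d z\<bar>"
    and A_mono: "\<And>t. t \<in> {0..1} \<Longrightarrow> poly (pderiv P) t \<ge> 0"
    and weak_deriv: "\<And>\<phi>. test_function \<phi> \<Longrightarrow>
      (LINT z:open_strip|lborel. w z * partial_x \<phi> z) = - (LINT z:open_strip|lborel. d z * \<phi> z)"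
    and weak_eq: "\<And>\<phi>. test_function \<phi> \<Longrightarrow>
      (LINT z:open_strip|lborel. - w z * partial_r \<phi> z
         + poly (pderiv P) (fst z) / 2 * (w z * partial_x (partial_x \<phi>) z + f z * \<phi> z)) = 0"
    and terminal: "\<And>x. w (1, x) = 0"
begin

lemma C_nonneg: "C \<ge> 0"
  using d_bound[of 0] by simp

lemma w_meas [measurable]: "w \<in> borel_measurable borel"
proof -
  have "(\<lambda>z. indicator closed_strip z *\<^sub>R w z) \<in> borel_measurable borel"
    by (rule borel_measurable_continuous_on_indicator[OF _ w_cont]) simp
  also have "(\<lambda>z. indicator closed_strip z *\<^sub>R w z) = w"
  proof
    fix z show "indicator closed_strip z *\<^sub>R w z = w z" using w_outside[of z] by (auto simp: indicator_def)
  qed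
  finally show ?thesis .
qed

lemma w_cont_x: "t \<in> {0..1} \<Longrightarrow> continuous_on A (\<lambda>x. w (t, x))"
  by (rule continuous_on_compose2[OF w_cont]) (auto intro!: continuous_intros simp: closed_strip_def)

lemma w_cont_t: "continuous_on {0..1} (\<lambda>t. w (t, x))"
  by (rule continuous_on_compose2[OF w_cont]) (auto intro!: continuous_intros simp: closed_strip_def)

lemma w_locally_bounded:
  obtains K where "K \<ge> 0" "\<And>t x. \<bar>x\<bar> \<le> R \<Longrightarrow> \<bar>w (t, x)\<bar> \<le> K"
proof -
  have "compact (w ` ({0..1} \<times> {-R..R}))"
    by (intro compact_continuous_image continuous_on_subset[OF w_cont] compact_Times) (auto simp: closed_strip_def)
  then obtain K where K: "\<And>z. z \<in> {0..1} \<times> {-R..R} \<Longrightarrow> \<bar>w z\<bar> \<le> K"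
    by (metis bounded_iff compact_imp_bounded image_eqI real_norm_def)
  show ?thesis
  proof (rule that[of "\<bar>K\<bar>"])
    fix t x :: real assume "\<bar>x\<bar> \<le> R"
    then show "\<bar>w (t, x)\<bar> \<le> \<bar>K\<bar>"
      using K[of "(t, x)"] w_outside[of "(t, x)"] by (cases "t \<in> {0..1}") (fastforce simp: closed_strip_def)+
  qed simp
qed

text \<open>The definition of the weak derivative is tested with a product of cutoffs of the box. In
  the limit the space derivative of the cutoff becomes the difference of the point masses at
  \<open>x1\<close> and \<open>x2\<close>, which recovers increments of \<open>w\<close> at fixed
  positions from purely integral information.\<close>

lemma box_integral:
  assumes t: "0 < t1" "t1 < t2" "t2 \<le> 1" and x: "x1 < x2"
  shows "(LINT z|lborel. indicator ({t1<..<t2} \<times> {x1<..<x2}) z * d z)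
       = (LINT t|lborel. indicator {t1<..<t2} t * (w (t, x2) - w (t, x1)))"
proof -
  obtain K where K: "K \<ge> 0" "\<And>t x. \<bar>x\<bar> \<le> max \<bar>x1\<bar> \<bar>x2\<bar> \<Longrightarrow> \<bar>w (t, x)\<bar> \<le> K"
    using w_locally_bounded by blast
  have Kx: "\<bar>w (t, x)\<bar> \<le> K" if "x \<in> {x1..x2}" for t x using that by (intro K) auto
  let ?\<phi> = "\<lambda>n z. cutoff n t1 t2 0 (fst z) * cutoff n x1 x2 0 (snd z)"
  have big: "\<forall>\<^sub>F n in sequentially. 2 \<le> real n * c" if "c > 0" for c :: real
    using that by real_asymp
  have ev: "\<forall>\<^sub>F n in sequentially. 2 \<le> real n * (t2 - t1) \<and> 2 \<le> real n * (x2 - x1)"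
    using big[of "t2 - t1"] big[of "x2 - x1"] t x eventually_conj by auto
  have cm: "(\<lambda>z :: real \<times> real. cutoff n a b k (fst z)) \<in> borel_measurable borel"
    "(\<lambda>z :: real \<times> real. cutoff n a b k (snd z)) \<in> borel_measurable borel" for n a b k
    by measurable
  have px: "partial_x (?\<phi> n) z = cutoff n t1 t2 0 (fst z) * cutoff n x1 x2 (Suc 0) (snd z)" for n z
    by (subst partial_x_eqI[where g="\<lambda>z. cutoff n t1 t2 0 (fst z) * cutoff n x1 x2 (Suc 0) (snd z)"])
       (auto intro!: DERIV_cmult cutoff_has_derivative)
  have lim1: "(\<lambda>n. LINT z|lborel. ?\<phi> n z * d z) \<longlonglongrightarrow> (LINT z|lborel. indicator ({t1<..<t2} \<times> {x1<..<x2}) z * d z)"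
  proof (rule Lim_transform_eventually[OF _ eventually_mono[OF ev]])
    show "(\<lambda>n. LINT z|lborel. indicator ({t1..t2} \<times> {x1..x2}) z * (?\<phi> n z * d z)) \<longlonglongrightarrow> (LINT z|lborel. indicator ({t1<..<t2} \<times> {x1<..<x2}) z * d z)"
    proof (rule integral_dominated_convergence[where w="\<lambda>z. C * indicator ({t1..t2} \<times> {x1..x2}) z"])
      show "integrable lborel (\<lambda>z. C * indicator ({t1..t2} \<times> {x1..x2}) z)"
        by (rule integrable_bounded_support_prod[where K=C and a=t1 and b=t2 and c=x1 and d=x2])
           (auto simp: C_nonneg intro!: borel_Times borel_measurable_times borel_measurable_indicator)
      show "AE z in lborel. (\<lambda>n. indicator ({t1..t2} \<times> {x1..x2}) z * (?\<phi> n z * d z)) \<longlonglongrightarrow> indicator ({t1<..<t2} \<times> {x1<..<x2}) z * d z"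
      proof (rule AE_I2)
        fix z :: "real \<times> real"
        have "(\<lambda>n. indicator ({t1..t2} \<times> {x1..x2}) z * (?\<phi> n z * d z)) \<longlonglongrightarrow> indicator ({t1..t2} \<times> {x1..x2}) z * (indicator {t1<..<t2} (fst z) * indicator {x1<..<x2} (snd z) * d z)"
          by (intro tendsto_intros cutoff_tendsto t x)
        also have "indicator ({t1..t2} \<times> {x1..x2}) z * (indicator {t1<..<t2} (fst z) * indicator {x1<..<x2} (snd z) * d z) = indicator ({t1<..<t2} \<times> {x1<..<x2}) z * d z"
          by (auto simp: indicator_def)
        finally show "(\<lambda>n. indicator ({t1..t2} \<times> {x1..x2}) z * (?\<phi> n z * d z)) \<longlonglongrightarrow> indicator ({t1<..<t2} \<times> {x1<..<x2}) z * d z" .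
      qed
      show "AE z in lborel. norm (indicator ({t1..t2} \<times> {x1..x2}) z * (?\<phi> n z * d z)) \<le> C * indicator ({t1..t2} \<times> {x1..x2}) z" for n
      proof (rule AE_I2)
        fix z :: "real \<times> real"
        have "\<bar>?\<phi> n z * d z\<bar> \<le> 1 * 1 * C"
          unfolding abs_mult by (intro mult_mono cutoff_bounds d_bound) auto
        then show "norm (indicator ({t1..t2} \<times> {x1..x2}) z * (?\<phi> n z * d z)) \<le> C * indicator ({t1..t2} \<times> {x1..x2}) z"
          by (auto simp: indicator_def)
      qed
    qed (use cm in \<open>auto intro!: borel_measurable_times borel_measurable_indicator borel_Times\<close>)
    fix n assume n: "2 \<le> real n * (t2 - t1) \<and> 2 \<le> real n * (x2 - x1)"
    have "indicator ({t1..t2} \<times> {x1..x2}) z * (?\<phi> n z * d z) = ?\<phi> n z * d z" for z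
    proof (cases "z \<in> {t1..t2} \<times> {x1..x2}")
      case False
      then have "?\<phi> n z = 0"
        using n cutoff_outside[of n t2 t1 "fst z" 0] cutoff_outside[of n x2 x1 "snd z" 0] by (cases z) auto
      then show ?thesis by simp
    qed simp
    then show "(LINT z|lborel. indicator ({t1..t2} \<times> {x1..x2}) z * (?\<phi> n z * d z)) = (LINT z|lborel. ?\<phi> n z * d z)" by presburger
  qed
  have inner: "(\<lambda>n. LINT x|lborel. cutoff n x1 x2 (Suc 0) x * (indicator {x1..x2} x * w (t, x))) \<longlonglongrightarrow> w (t, x1) - w (t, x2)"
    if "t \<in> {0..1}" for t
  proof (rule cutoff_Suc_0_tendsto)
    show "\<bar>indicator {x1..x2} x * w (t, x)\<bar> \<le> K" for x using Kx[of x t] K(1) by (auto simp: indicator_def)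
    have "((\<lambda>x. w (t, x)) \<longlongrightarrow> w (t, x1)) (at_right x1)" "((\<lambda>x. w (t, x)) \<longlongrightarrow> w (t, x2)) (at_left x2)"
      using w_cont_x[OF that, of UNIV] by (auto simp: continuous_on_def intro: tendsto_within_subset)
    moreover have "\<forall>\<^sub>F x in at_right x1. w (t, x) = indicator {x1..x2} x * w (t, x)"
      by (rule eventually_at_rightI[OF _ x]) auto
    moreover have "\<forall>\<^sub>F x in at_left x2. w (t, x) = indicator {x1..x2} x * w (t, x)"
      by (rule eventually_at_leftI[OF _ x]) auto
    ultimately show "((\<lambda>x. indicator {x1..x2} x * w (t, x)) \<longlongrightarrow> w (t, x1)) (at_right x1)"
       "((\<lambda>x. indicator {x1..x2} x * w (t, x)) \<longlongrightarrow> w (t, x2)) (at_left x2)"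
      by (blast intro: Lim_transform_eventually)+
  qed measurable
  \<comment> \<open>For small \<open>n\<close> the cutoffs need not be supported in the box. The
    inserted indicators make \<open>F n\<close> integrable for every \<open>n\<close> and change
    nothing once \<open>n\<close> is large.\<close>
  define F where "F = (\<lambda>n (z :: real \<times> real). indicator {t1..t2} (fst z) * cutoff n t1 t2 0 (fst z) * (cutoff n x1 x2 (Suc 0) (snd z) * (indicator {x1..x2} (snd z) * w z)))"
  have F_int: "integrable lborel (F n)" for n
  proof -
    obtain K' where K': "\<And>a b t. \<bar>cutoff n a b (Suc 0) t\<bar> \<le> K'" using cutoff_bounded by blast
    show ?thesis
    proof (rule integrable_bounded_support_prod[where a=t1 and b=t2 and c=x1 and d=x2])
      show "F n \<in> borel_measurable borel" unfolding F_def using cm by measurable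
      fix t x assume "t \<in> {t1..t2}" "x \<in> {x1..x2}"
      then have "\<bar>F n (t, x)\<bar> = \<bar>cutoff n t1 t2 0 t\<bar> * (\<bar>cutoff n x1 x2 (Suc 0) x\<bar> * \<bar>w (t, x)\<bar>)"
        by (simp add: F_def abs_mult)
      also have "\<dots> \<le> 1 * (K' * K)"
        using K(1) order_trans[OF abs_ge_zero K'] \<open>x \<in> _\<close> by (intro mult_mono cutoff_bounds K' Kx) auto
      finally show "\<bar>F n (t, x)\<bar> \<le> 1 * (K' * K)" .
    qed (auto simp: F_def indicator_def)
  qed
  let ?I = "\<lambda>n t. LINT x|lborel. cutoff n x1 x2 (Suc 0) x * (indicator {x1..x2} x * w (t, x))"
  have F_x: "(LINT x|lborel. F n (t, x)) = indicator {t1..t2} t * (cutoff n t1 t2 0 t * ?I n t)" for n t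
    by (simp add: F_def mult.assoc)
  have lim2: "(\<lambda>n. LINT z|lborel. F n z)
     \<longlonglongrightarrow> (LINT t|lborel. indicator {t1<..<t2} t * (w (t, x1) - w (t, x2)))"
    unfolding integral_lborel_prod(1)[OF F_int] F_x
    proof (rule integral_dominated_convergence[where w="\<lambda>t. 2 * K * indicator {t1..t2} t"])
      show "integrable lborel (\<lambda>t. 2 * K * indicator {t1..t2} t)"
        by (rule integrable_bounded_support[where a=t1 and b=t2 and K="2 * K"]) (auto simp: K)
      show "AE t in lborel. (\<lambda>n. indicator {t1..t2} t * (cutoff n t1 t2 0 t * ?I n t)) \<longlonglongrightarrow> indicator {t1<..<t2} t * (w (t, x1) - w (t, x2))"
      proof (rule AE_I2)
        fix t
        show "(\<lambda>n. indicator {t1..t2} t * (cutoff n t1 t2 0 t * ?I n t)) \<longlonglongrightarrow> indicator {t1<..<t2} t * (w (t, x1) - w (t, x2))"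
        proof (cases "t \<in> {t1..t2}")
          case True
          then have "t \<in> {0..1}" using t by auto
          have "(\<lambda>n. indicator {t1..t2} t * (cutoff n t1 t2 0 t * ?I n t)) \<longlonglongrightarrow> indicator {t1..t2} t * (indicator {t1<..<t2} t * (w (t, x1) - w (t, x2)))"
            by (intro tendsto_intros cutoff_tendsto t inner \<open>t \<in> {0..1}\<close>)
          then show ?thesis using True by simp
        qed (auto simp: indicator_def)
      qed
      show "AE t in lborel. norm (indicator {t1..t2} t * (cutoff n t1 t2 0 t * ?I n t)) \<le> 2 * K * indicator {t1..t2} t" for n
      proof (rule AE_I2)
        fix t
        have "\<bar>?I n t\<bar> \<le> 2 * K"
          by (rule cutoff_Suc_0_bound) (measurable, use Kx K(1) in \<open>auto simp: indicator_def\<close>)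
        then have "\<bar>cutoff n t1 t2 0 t * ?I n t\<bar> \<le> 1 * (2 * K)"
          unfolding abs_mult using K(1) by (intro mult_mono cutoff_bounds) auto
        then show "norm (indicator {t1..t2} t * (cutoff n t1 t2 0 t * ?I n t)) \<le> 2 * K * indicator {t1..t2} t"
          by (auto simp: indicator_def)
      qed
      show "(\<lambda>t. indicator {t1..t2} t * (cutoff n t1 t2 0 t * ?I n t)) \<in> borel_measurable lborel" for n
        using borel_measurable_integrable[OF integral_lborel_prod(2)[OF F_int]] unfolding F_x .
      show "(\<lambda>t. indicator {t1<..<t2} t * (w (t, x1) - w (t, x2))) \<in> borel_measurable lborel"
        by measurable
    qed
  have "\<forall>\<^sub>F n in sequentially. (LINT z|lborel. F n z) = - (LINT z|lborel. ?\<phi> n z * d z)"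
  proof (rule eventually_mono[OF ev])
    fix n assume n: "2 \<le> real n * (t2 - t1) \<and> 2 \<le> real n * (x2 - x1)"
    have npos: "n > 0" using n by (cases n) auto
    have tf: "test_function (?\<phi> n)"
      using test_function_cutoff_product[OF t x, of n n "\<lambda>_. 1"] n by (simp add: smooth2_const)
    \<comment> \<open>The time cutoff vanishes outside (0,1), so integrals over the open strip and
      over the whole plane agree.\<close>
    have t0: "cutoff n t1 t2 k s = 0" if "\<not> (0 < s \<and> s < 1)" for s k
      using that cutoff_eq_0[of n t2 t1 s k] n t npos
      by (smt (verit) divide_pos_pos of_nat_0_less_iff)
    have "F n z = indicator open_strip z *\<^sub>R (w z * partial_x (?\<phi> n) z)" for z
    proof (cases "fst z \<in> {t1..t2} \<and> snd z \<in> {x1..x2}")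
      case True
      then show ?thesis using t0[of "fst z" 0] unfolding px
        by (cases z) (auto simp: F_def indicator_def open_strip_def)
    next
      case False
      then have "cutoff n t1 t2 0 (fst z) = 0 \<or> cutoff n x1 x2 (Suc 0) (snd z) = 0"
        using n cutoff_outside[of n t2 t1 "fst z" 0] cutoff_outside[of n x2 x1 "snd z" "Suc 0"] by auto
      then show ?thesis unfolding px F_def by auto
    qed
    moreover have "?\<phi> n z * d z = indicator open_strip z *\<^sub>R (d z * ?\<phi> n z)" for z
      using t0[of "fst z" 0] by (cases z) (auto simp: indicator_def open_strip_def)
    ultimately show "(LINT z|lborel. F n z) = - (LINT z|lborel. ?\<phi> n z * d z)"
      using weak_deriv[OF tf] unfolding set_lebesgue_integral_def by presburger
  qed
  from Lim_transform_eventually[OF lim2 this]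
  have "(LINT t|lborel. indicator {t1<..<t2} t * (w (t, x1) - w (t, x2))) = - (LINT z|lborel. indicator ({t1<..<t2} \<times> {x1<..<x2}) z * d z)"
    using tendsto_minus[OF lim1] LIMSEQ_unique by blast
  moreover have "(LINT t|lborel. indicator {t1<..<t2} t * (w (t, x2) - w (t, x1))) = - (LINT t|lborel. indicator {t1<..<t2} t * (w (t, x1) - w (t, x2)))"
    by (subst Bochner_Integration.integral_minus[symmetric]) (auto intro!: Bochner_Integration.integral_cong simp: algebra_simps)
  ultimately show ?thesis by simp
qed

end

section \<open>Almost everywhere bounds on the weak derivative versus Lipschitz bounds\<close>

lemma antiderivative_real:
  fixes f :: "real \<Rightarrow> real"
  assumes "continuous_on UNIV f"
  obtains F where "\<And>x. (F has_real_derivative f x) (at x)"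
proof -
  have "((\<lambda>u. LBINT y=0..u. f y) has_real_derivative f x) (at x)" for x
  proof -
    have "((\<lambda>u. LBINT y=0..u. f y) has_vector_derivative f x) (at x within {-\<bar>x\<bar>-1..\<bar>x\<bar>+1})"
      by (rule interval_integral_FTC2[where c=0, unfolded zero_ereal_def[symmetric]])
         (use assms in \<open>auto intro: continuous_on_subset\<close>)
    then have "((\<lambda>u. LBINT y=0..u. f y) has_real_derivative f x) (at x within {-\<bar>x\<bar>-1..\<bar>x\<bar>+1})"
      by (simp add: has_real_derivative_iff_has_vector_derivative)
    then show ?thesis
      by (subst (asm) at_within_interior) (auto simp: interior_atLeastAtMost_real)
  qed
  then show ?thesis using that by blast
qed

lemma box_Pair_eq: "box (a, c) (b, d) = {a<..<b} \<times> {c<..<d}" for a b c d :: real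
  by (auto simp: box_def Basis_prod_def)

lemma integral_indicator_Ioo:
  fixes a b c :: real assumes "a \<le> b"
  shows "(LINT t|lborel. indicator {a<..<b} t * c) = (b - a) * c"
    and "integrable lborel (\<lambda>t. indicator {a<..<b} t * c)"
proof -
  have "integrable lborel (indicator {a<..<b} :: real \<Rightarrow> real)"
    by (intro integrable_real_indicator) (auto simp: assms)
  then show "integrable lborel (\<lambda>t. indicator {a<..<b} t * c)" by simp
  show "(LINT t|lborel. indicator {a<..<b} t * c) = (b - a) * c" using assms by simp
qed

lemma integrable_box_indicator:
  fixes t1 t2 x1 x2 :: real and F :: "real \<times> real \<Rightarrow> real"
  assumes [measurable]: "F \<in> borel_measurable borel"
    and "\<And>t x. t1 < t \<Longrightarrow> t < t2 \<Longrightarrow> x1 < x \<Longrightarrow> x < x2 \<Longrightarrow> \<bar>F (t, x)\<bar> \<le> K"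
  shows "integrable lborel (\<lambda>z. indicator ({t1<..<t2} \<times> {x1<..<x2}) z * F z)"
proof (rule integrable_bounded_support_prod[where a=t1 and b=t2 and c=x1 and d=x2 and K="max K 0"])
  show "(\<lambda>z. indicator ({t1<..<t2} \<times> {x1<..<x2}) z * F z) \<in> borel_measurable borel"
    by (intro borel_measurable_times borel_measurable_indicator borel_Times) auto
qed (use assms(2) in \<open>force simp: indicator_def\<close>)+

lemma integral_box_const:
  fixes t1 t2 x1 x2 c :: real
  assumes "t1 \<le> t2" "x1 \<le> x2"
  shows "(LINT z|lborel. indicator ({t1<..<t2} \<times> {x1<..<x2}) z * c) = (t2 - t1) * (x2 - x1) * c"
proof -
  have "(LINT z|lborel. indicator ({t1<..<t2} \<times> {x1<..<x2}) z * c)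
     = (LINT t|lborel. LINT x|lborel. indicator {t1<..<t2} t * (indicator {x1<..<x2} x * c))"
    by (subst integral_lborel_prod(1)[OF integrable_box_indicator[where K="\<bar>c\<bar>"]])
       (auto simp: indicator_times mult.assoc)
  also have "\<dots> = (t2 - t1) * ((x2 - x1) * c)"
    unfolding integral_mult_right_zero integral_indicator_Ioo[OF assms(2)]
    using integral_indicator_Ioo[OF assms(1), of "(x2 - x1) * c"] by simp
  finally show ?thesis by simp
qed

text \<open>Open boxes form an intersection-stable generator of the Borel sets, so the convergence
  extends by induction over the generated sigma-algebra. Complements are handled by linearity; for
  disjoint unions the uniform bound \<open>M\<close> allows limit and series to be exchanged by
  Tannery's theorem.\<close>

lemma box_limit_imp_borel_limit:
  fixes g :: "nat \<Rightarrow> real \<times> real \<Rightarrow> real"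
  assumes gm [measurable]: "\<And>n. g n \<in> borel_measurable borel" and hm [measurable]: "h \<in> borel_measurable borel"
    and gM: "\<And>n z. \<bar>g n z\<bar> \<le> M" and hM: "\<And>z. \<bar>h z\<bar> \<le> M"
    and lim: "\<And>a b. box a b \<subseteq> box p q \<Longrightarrow>
      (\<lambda>n. LINT z|lborel. indicator (box a b) z * g n z) \<longlonglongrightarrow> (LINT z|lborel. indicator (box a b) z * h z)"
    and A: "A \<in> sets borel"
  shows "(\<lambda>n. LINT z|lborel. indicator (A \<inter> box p q) z * g n z) \<longlonglongrightarrow> (LINT z|lborel. indicator (A \<inter> box p q) z * h z)"
proof -
  have int: "integrable lborel (\<lambda>z. indicator (S \<inter> box p q) z * k z)"
    if [measurable]: "S \<in> sets borel" "k \<in> borel_measurable borel" and "\<And>z. \<bar>k z\<bar> \<le> M" for S and k :: "real \<times> real \<Rightarrow> real"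
    by (rule integrable_bounded_support[where a=p and b=q and K=M])
       (use that(3) box_subset_cbox[of p q] order_trans[OF abs_ge_zero that(3)] in \<open>auto simp: indicator_def\<close>)
  have "Int_stable (range (\<lambda>(a, b). box a b :: (real \<times> real) set))"
    by (auto simp: Int_stable_def box_Int_box)
  moreover have "range (\<lambda>(a, b). box a b :: (real \<times> real) set) \<subseteq> Pow UNIV" by simp
  moreover have "A \<in> sigma_sets UNIV (range (\<lambda>(a, b). box a b :: (real \<times> real) set))"
    using A by (simp add: borel_eq_box)
  ultimately show ?thesis
  proof (induction rule: sigma_sets_induct_disjoint)
    case (basic S)
    then obtain c d where "S = box c d" by auto
    have "\<exists>a b. S \<inter> box p q = box a b" unfolding \<open>S = box c d\<close> by (rule exI, rule exI, rule box_Int_box)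
    then obtain a b where ab: "S \<inter> box p q = box a b" by blast
    have "box a b \<subseteq> box p q" unfolding ab[symmetric] by (rule inf_le2)
    from lim[OF this] show ?case unfolding ab .
  next
    case empty
    show ?case by simp
  next
    case (compl S)
    then have [measurable]: "S \<in> sets borel" by (simp add: borel_eq_box)
    have *: "(LINT z|lborel. indicator ((UNIV - S) \<inter> box p q) z * k z) = (LINT z|lborel. indicator (box p q) z * k z) - (LINT z|lborel. indicator (S \<inter> box p q) z * k z)"
      if "k \<in> borel_measurable borel" "\<And>z. \<bar>k z\<bar> \<le> M" for k :: "real \<times> real \<Rightarrow> real"
    proof -
      have "(LINT z|lborel. indicator (UNIV \<inter> box p q) z * k z) - (LINT z|lborel. indicator (S \<inter> box p q) z * k z)
        = (LINT z|lborel. indicator (UNIV \<inter> box p q) z * k z - indicator (S \<inter> box p q) z * k z)"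
        by (rule Bochner_Integration.integral_diff[symmetric]) (intro int that; simp)+
      also have "\<dots> = (LINT z|lborel. indicator ((UNIV - S) \<inter> box p q) z * k z)"
        by (intro Bochner_Integration.integral_cong) (auto simp: indicator_def)
      finally show ?thesis by simp
    qed
    show ?case
      unfolding *[OF gm gM] *[OF hm hM] by (intro tendsto_diff lim compl.IH) auto
  next
    case (union S)
    have Sm [measurable]: "S i \<in> sets borel" for i using union(2) by (auto simp: borel_eq_box)
    have disj: "disjoint_family (\<lambda>i. S i \<inter> box p q)"
      using union(1) by (auto simp: disjoint_family_on_def)
    have *: "(LINT z|lborel. indicator (\<Union>(range S) \<inter> box p q) z * k z) = (\<Sum>i. LINT z|lborel. indicator (S i \<inter> box p q) z * k z)"
      if [measurable]: "k \<in> borel_measurable borel" and "\<And>z. \<bar>k z\<bar> \<le> M" for k :: "real \<times> real \<Rightarrow> real"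
    proof -
      have "(LINT z:(\<Union>i. S i \<inter> box p q)|lborel. k z) = (\<Sum>i. LINT z:(S i \<inter> box p q)|lborel. k z)"
        using int[of "\<Union>(range S)" k] that disj
        by (intro lebesgue_integral_countable_add)
           (auto simp: set_integrable_def disjoint_family_on_def)
      then show ?thesis by (simp add: set_lebesgue_integral_def Int_UN_distrib2[symmetric] flip: Int_UN_distrib2)
    qed
    \<comment> \<open>A majorant independent of \<open>n\<close>; it is summable because the pieces
      are disjoint subsets of a box of finite measure.\<close>
    define W where "W = (\<lambda>i. M * measure lborel (S i \<inter> box p q))"
    have fin: "emeasure lborel (box p q) < \<infinity>" using emeasure_lborel_box_finite .
    have M0: "M \<ge> 0" using hM[of 0] by simp
    have "summable (\<lambda>i. measure lborel (S i \<inter> box p q))"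
    proof (rule sums_summable[OF measure_UNION])
      have "emeasure lborel (\<Union>i. S i \<inter> box p q) \<le> emeasure lborel (box p q)" by (rule emeasure_mono) auto
      then show "emeasure lborel (\<Union>i. S i \<inter> box p q) \<noteq> \<infinity>" using fin by (auto simp: top_unique)
    qed (use disj in auto)
    then have "summable W" unfolding W_def by (rule summable_mult)
    have bd: "\<bar>LINT z|lborel. indicator (S i \<inter> box p q) z * g n z\<bar> \<le> W i" for i n
    proof -
      have i1: "integrable lborel (\<lambda>z. indicator (S i \<inter> box p q) z * M)"
        using int[of "S i" "\<lambda>_. M"] M0 by simp
      have "\<bar>LINT z|lborel. indicator (S i \<inter> box p q) z * g n z\<bar> \<le> (LINT z|lborel. indicator (S i \<inter> box p q) z * M)"
        by (rule integral_abs_bound_integral[OF int[OF Sm gm gM] i1])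
           (use gM in \<open>auto simp: indicator_def\<close>)
      also have "\<dots> = W i" by (simp add: W_def)
      finally show ?thesis .
    qed
    have "\<forall>\<^sub>F (k, n) in at_top \<times>\<^sub>F sequentially. norm (LINT z|lborel. indicator (S k \<inter> box p q) z * g n z) \<le> W k"
      by (rule always_eventually) (use bd in auto)
    then show ?case
      unfolding *[OF gm gM] *[OF hm hM]
      using tannerys_theorem[of "\<lambda>i n. LINT z|lborel. indicator (S i \<inter> box p q) z * g n z" "\<lambda>i. LINT z|lborel. indicator (S i \<inter> box p q) z * h z" sequentially W]
        union(3) \<open>summable W\<close> by auto
  qed
qed

context linear_weak begin

text \<open>If the increment were too large at one time, continuity would keep it too large, with
  the same sign, on a short time interval. Integrating over that interval contradicts the box
  formula with \<open>d\<close> bounded by \<open>M\<close>.\<close>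

lemma lipschitz_of_derivative_bound:
  assumes s: "0 < s1" "s1 < s2" "s2 \<le> 1" and M: "AE z in lborel. fst z \<in> {s1<..<s2} \<longrightarrow> \<bar>d z\<bar> \<le> M"
    and t: "t \<in> {s1..s2}" and x: "x1 < x2"
  shows "\<bar>w (t, x2) - w (t, x1)\<bar> \<le> M * (x2 - x1)"
proof (rule ccontr)
  define g where "g = (\<lambda>t. w (t, x2) - w (t, x1))"
  define L where "L = M * (x2 - x1)"
  \<comment> \<open>Half the excess over the claimed bound: times at which \<open>g\<close> moves by
    less than \<eta> still exceed \<open>L\<close> by at least \<eta>.\<close>
  define \<eta> where "\<eta> = (\<bar>g t\<bar> - L) / 2"
  assume "\<not> ?thesis"
  then have \<eta>: "\<eta> > 0" by (simp add: \<eta>_def g_def L_def)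
  have "continuous_on {s1..s2} g"
    unfolding g_def using s by (intro continuous_intros continuous_on_subset[OF w_cont_t]) auto
  then obtain e where e: "e > 0" "\<And>t'. t' \<in> {s1..s2} \<Longrightarrow> \<bar>t' - t\<bar> < e \<Longrightarrow> \<bar>g t' - g t\<bar> < \<eta>"
    using t \<eta> unfolding continuous_on_iff dist_real_def by metis
  define t1 where "t1 = max s1 (t - e / 2)"
  define t2 where "t2 = min s2 (t + e / 2)"
  have t12: "t1 < t2" "s1 \<le> t1" "t2 \<le> s2" using t s e(1) by (auto simp: t1_def t2_def)
  have near: "sgn (g t) * g t' \<ge> L + \<eta>" if "t' \<in> {t1<..<t2}" for t'
  proof -
    have "\<bar>g t' - g t\<bar> < \<eta>" using that t12 t e(1) by (intro e) (auto simp: t1_def t2_def abs_less_iff)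
    then show ?thesis by (auto simp: \<eta>_def sgn_real_def field_simps abs_if split: if_splits)
  qed
  have g_int: "integrable lborel (\<lambda>t. indicator {t1<..<t2} t * (sgn (g t0) * g t))" for t0
  proof -
    have "compact (g ` {s1..s2})" using \<open>continuous_on {s1..s2} g\<close> by (rule compact_continuous_image) auto
    then obtain K where K: "\<And>t. t \<in> {s1..s2} \<Longrightarrow> \<bar>g t\<bar> \<le> K"
      by (metis bounded_iff compact_imp_bounded image_eqI real_norm_def)
    show ?thesis
    proof (rule integrable_bounded_support[where a=t1 and b=t2 and K=K])
      show "(\<lambda>t. indicator {t1<..<t2} t * (sgn (g t0) * g t)) \<in> borel_measurable borel"
        unfolding g_def by measurable
      fix t' assume "t' \<in> cbox t1 t2"
      then have "\<bar>g t'\<bar> \<le> K" using t12 by (intro K) auto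
      then show "\<bar>indicator {t1<..<t2} t' * (sgn (g t0) * g t')\<bar> \<le> K"
        using abs_ge_zero[of "g t'"] by (auto simp: indicator_def abs_mult sgn_real_def simp del: abs_ge_zero)
    qed (auto simp: indicator_def)
  qed
  have "(t2 - t1) * (L + \<eta>) = (LINT t|lborel. indicator {t1<..<t2} t * (L + \<eta>))"
    using integral_indicator_Ioo(1)[of t1 t2 "L + \<eta>"] t12 by simp
  also have "\<dots> \<le> (LINT t'|lborel. indicator {t1<..<t2} t' * (sgn (g t) * g t'))"
    by (rule integral_mono[OF integral_indicator_Ioo(2) g_int]) (use t12 near in \<open>auto simp: indicator_def\<close>)
  also have "\<dots> = sgn (g t) * (LINT t'|lborel. indicator {t1<..<t2} t' * (w (t', x2) - w (t', x1)))"
    by (subst integral_mult_right_zero[symmetric]) (simp add: g_def mult.left_commute)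
  also have "\<dots> = sgn (g t) * (LINT z|lborel. indicator ({t1<..<t2} \<times> {x1<..<x2}) z * d z)"
    using box_integral[of t1 t2 x1 x2] s t12 x by simp
  also have "\<dots> \<le> \<bar>LINT z|lborel. indicator ({t1<..<t2} \<times> {x1<..<x2}) z * d z\<bar>"
    by (auto simp: sgn_real_def)
  also have "\<dots> \<le> (LINT z|lborel. indicator ({t1<..<t2} \<times> {x1<..<x2}) z * M)"
  proof (rule order_trans[OF integral_abs_bound])
    show "(LINT z|lborel. \<bar>indicator ({t1<..<t2} \<times> {x1<..<x2}) z * d z\<bar>) \<le> (LINT z|lborel. indicator ({t1<..<t2} \<times> {x1<..<x2}) z * M)"
    proof (rule integral_mono_AE)
      show "integrable lborel (\<lambda>z. \<bar>indicator ({t1<..<t2} \<times> {x1<..<x2}) z * d z\<bar>)"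
        by (intro integrable_abs integrable_box_indicator[where K=C] d_bound) measurable
      show "integrable lborel (\<lambda>z. indicator ({t1<..<t2} \<times> {x1<..<x2}) z * M)"
        by (intro integrable_box_indicator[where K="\<bar>M\<bar>"]) auto
      show "AE z in lborel. \<bar>indicator ({t1<..<t2} \<times> {x1<..<x2}) z * d z\<bar> \<le> indicator ({t1<..<t2} \<times> {x1<..<x2}) z * M"
        using M by eventually_elim (use t12 in \<open>auto simp: indicator_def\<close>)
    qed
  qed
  also have "\<dots> = (t2 - t1) * L"
    using integral_box_const[of t1 t2 x1 x2 M] t12 x by (simp add: L_def)
  finally have "(t2 - t1) * \<eta> \<le> 0" by (simp add: distrib_left)
  moreover have "(t2 - t1) * \<eta> > 0" using t12(1) \<eta> by (intro mult_pos_pos) auto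
  ultimately show False by linarith
qed

text \<open>Difference quotients of \<open>w\<close> are bounded by \<open>M\<close> and converge
  weakly to \<open>d\<close>: on boxes by the box formula, hence on Borel sets. So the integral of
  \<open>d\<close> over any Borel set S is at most M times the measure of S in absolute value, and
  applying this to the set where \<open>d\<close> or its negative exceeds \<open>M\<close> shows
  that this set is null.\<close>

lemma derivative_bound_of_lipschitz:
  assumes s: "0 < s1" "s1 < s2" "s2 \<le> 1"
    and M: "\<And>t x1 x2. t \<in> {s1<..<s2} \<Longrightarrow> x1 < x2 \<Longrightarrow> \<bar>w (t, x2) - w (t, x1)\<bar> \<le> M * (x2 - x1)"
  shows "AE z in lborel. fst z \<in> {s1<..<s2} \<longrightarrow> \<bar>d z\<bar> \<le> M"
proof -
  have M0: "M \<ge> 0" using M[of "(s1 + s2) / 2" 0 1] s by (simp add: field_simps)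
  have "AE z in lborel. z \<in> box (s1, - R) (s2, R) \<longrightarrow> \<bar>d z\<bar> \<le> M" for R
  proof -
    let ?Q = "box (s1, - R) (s2, R)"
    define g where "g = (\<lambda>n (z :: real \<times> real). indicator ?Q z * (real (Suc n) * (w (fst z, snd z + 1 / real (Suc n)) - w z)))"
    have shift [measurable]: "(\<lambda>z :: real \<times> real. w (fst z, snd z + c)) \<in> borel_measurable borel" for c
      by (rule measurable_compose[OF _ w_meas]) (auto intro!: borel_measurable_continuous_onI continuous_intros)
    have g_bound: "\<bar>g n z\<bar> \<le> M" for n z
    proof (cases "z \<in> ?Q")
      case True
      then have "\<bar>w (fst z, snd z + 1 / real (Suc n)) - w (fst z, snd z)\<bar> \<le> M * (1 / real (Suc n))"
        using M[of "fst z" "snd z" "snd z + 1 / real (Suc n)"] by (cases z) (auto simp: box_Pair_eq)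
      then have "real (Suc n) * \<bar>w (fst z, snd z + 1 / real (Suc n)) - w z\<bar> \<le> M"
        by (simp add: field_simps)
      then show ?thesis using True by (simp add: g_def abs_mult)
    qed (simp add: g_def M0)
    have g_meas [measurable]: "g n \<in> borel_measurable borel" for n
      unfolding g_def by measurable
    have lim: "(\<lambda>n. LINT z|lborel. indicator (box a b) z * g n z) \<longlonglongrightarrow> (LINT z|lborel. indicator (box a b) z * d z)"
      if sub: "box a b \<subseteq> ?Q" for a b
    proof (cases "box a b = {}")
      case False
      obtain t1 x1 where a: "a = (t1, x1)" by fastforce
      obtain t2 x2 where b: "b = (t2, x2)" by fastforce
      have box: "box a b = {t1<..<t2} \<times> {x1<..<x2}" by (auto simp: a b box_Pair_eq)
      have t12: "t1 < t2" "x1 < x2" using False unfolding box by (auto simp: not_less)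
      have "closure (box a b) \<subseteq> closure ?Q" using sub by (rule closure_mono)
      moreover have "?Q \<noteq> {}" using sub False by blast
      ultimately have "cbox a b \<subseteq> cbox (s1, - R) (s2, R)" using False by (simp add: closure_box)
      then have t: "s1 \<le> t1" "t2 \<le> s2" "{t1..t2} \<times> {x1..x2} \<subseteq> {s1..s2} \<times> {-R..R}"
        using t12 unfolding a b by (auto simp: cbox_Pair_eq times_subset_iff)
      have gi: "integrable lborel (\<lambda>z. indicator (box a b) z * g n z)" for n
        unfolding box by (rule integrable_box_indicator[where K=M]) (use g_bound in auto)
      have in_Q: "indicator (box a b) (t, x) * g n (t, x) = indicator {t1<..<t2} t * (indicator {x1<..<x2} x * (real (Suc n) * (w (t, x + 1 / real (Suc n)) - w (t, x))))" for n t x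
        using subsetD[OF sub, of "(t, x)"] unfolding box g_def by (auto simp: indicator_def)
      let ?I = "\<lambda>n t. LINT x|lborel. indicator {x1<..<x2} x * (real (Suc n) * (w (t, x + 1 / real (Suc n)) - w (t, x)))"
      have I_lim: "(\<lambda>n. ?I n t) \<longlonglongrightarrow> w (t, x2) - w (t, x1)" if t01: "t \<in> {0..1}" for t
      proof -
        \<comment> \<open>With a primitive F of w(t, .), the integral of a difference quotient of w
          collapses to difference quotients of F at the two endpoints, which converge to the values
          of w there.\<close>
        obtain F where F: "\<And>x. (F has_real_derivative w (t, x)) (at x)"
          using antiderivative_real[OF w_cont_x[OF t01, of UNIV]] by blast
        have I: "?I n t = (F (x2 + 1 / real (Suc n)) - F x2) / (1 / real (Suc n)) - (F (x1 + 1 / real (Suc n)) - F x1) / (1 / real (Suc n))" for n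
        proof -
          have "(LINT x|lborel. (real (Suc n) * (w (t, x + 1 / real (Suc n)) - w (t, x))) * indicator {x1..x2} x) =
            real (Suc n) * (F (x2 + 1 / real (Suc n)) - F x2) - real (Suc n) * (F (x1 + 1 / real (Suc n)) - F x1)"
          proof (rule integral_FTC_Icc_real)
            fix x
            have "((\<lambda>x. F (x + 1 / real (Suc n))) has_real_derivative w (t, x + 1 / real (Suc n))) (at x)"
              using F[of "x + 1 / real (Suc n)"] unfolding DERIV_shift .
            then show "((\<lambda>x. real (Suc n) * (F (x + 1 / real (Suc n)) - F x)) has_real_derivative real (Suc n) * (w (t, x + 1 / real (Suc n)) - w (t, x))) (at x)"
              by (intro DERIV_cmult DERIV_diff F)
            have "continuous_on UNIV (\<lambda>x. real (Suc n) * (w (t, x + 1 / real (Suc n)) - w (t, x)))"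
              by (intro continuous_intros w_cont_x t01 continuous_on_compose2[OF w_cont_x[OF t01, of UNIV]]) auto
            then show "isCont (\<lambda>x. real (Suc n) * (w (t, x + 1 / real (Suc n)) - w (t, x))) x"
              by (simp add: continuous_on_eq_continuous_at)
          qed (use t12 in simp)
          moreover have "?I n t = (LINT x|lborel. (real (Suc n) * (w (t, x + 1 / real (Suc n)) - w (t, x))) * indicator {x1..x2} x)"
          proof (rule integral_cong_AE)
            show "AE x in lborel. indicator {x1<..<x2} x * (real (Suc n) * (w (t, x + 1 / real (Suc n)) - w (t, x)))
               = real (Suc n) * (w (t, x + 1 / real (Suc n)) - w (t, x)) * indicator {x1..x2} x"
              using AE_lborel_singleton[of x1] AE_lborel_singleton[of x2]
              by eventually_elim (auto simp: indicator_def)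
            have [measurable]: "(\<lambda>x. w (t, x + c)) \<in> borel_measurable borel" for c
              using measurable_compose[OF Pair_borel_measurable shift, of t c] by simp
            show "(\<lambda>x. indicator {x1<..<x2} x * (real (Suc n) * (w (t, x + 1 / real (Suc n)) - w (t, x)))) \<in> borel_measurable lborel"
              "(\<lambda>x. real (Suc n) * (w (t, x + 1 / real (Suc n)) - w (t, x)) * indicator {x1..x2} x) \<in> borel_measurable lborel"
              by measurable
          qed
          ultimately show ?thesis by simp
        qed
        have h: "filterlim (\<lambda>n. 1 / real (Suc n)) (at 0) sequentially"
          by real_asymp
        have "(\<lambda>n. (F (x + 1 / real (Suc n)) - F x) / (1 / real (Suc n))) \<longlonglongrightarrow> w (t, x)" for x
          using filterlim_compose[OF F[unfolded DERIV_def] h] .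
        then show ?thesis unfolding I by (intro tendsto_diff)
      qed
      have I_bd: "\<bar>?I n t\<bar> \<le> M * (x2 - x1)" if "t \<in> {t1<..<t2}" for n t
      proof -
        have "\<bar>?I n t\<bar> \<le> (LINT x|lborel. indicator {x1<..<x2} x * M)"
        proof (rule order_trans[OF integral_abs_bound integral_mono'])
          show "integrable lborel (\<lambda>x. indicator {x1<..<x2} x * M)" using integral_indicator_Ioo(2) t12 by simp
          fix x
          show "\<bar>indicator {x1<..<x2} x * (real (Suc n) * (w (t, x + 1 / real (Suc n)) - w (t, x)))\<bar> \<le> indicator {x1<..<x2} x * M"
          proof (cases "x \<in> {x1<..<x2}")
            case True
            then show ?thesis using g_bound[of n "(t, x)"] in_Q[of t x n] that by (simp add: box)
          qed simp
        qed (use M0 in simp)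
        then show ?thesis using integral_indicator_Ioo(1)[of x1 x2 M] t12 by (simp add: mult.commute)
      qed
      have "(\<lambda>n. LINT t|lborel. indicator {t1<..<t2} t * ?I n t) \<longlonglongrightarrow> (LINT t|lborel. indicator {t1<..<t2} t * (w (t, x2) - w (t, x1)))"
      proof (rule integral_dominated_convergence[where w="\<lambda>t. indicator {t1<..<t2} t * (M * (x2 - x1))"])
        show "integrable lborel (\<lambda>t. indicator {t1<..<t2} t * (M * (x2 - x1)))" using integral_indicator_Ioo(2) t12 by simp
        show "AE t in lborel. (\<lambda>n. indicator {t1<..<t2} t * ?I n t) \<longlonglongrightarrow> indicator {t1<..<t2} t * (w (t, x2) - w (t, x1))"
        proof (rule AE_I2)
          fix t' show "(\<lambda>n. indicator {t1<..<t2} t' * ?I n t') \<longlonglongrightarrow> indicator {t1<..<t2} t' * (w (t', x2) - w (t', x1))"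
            using I_lim[of t'] s t by (cases "t' \<in> {t1<..<t2}") auto
        qed
        show "AE t in lborel. norm (indicator {t1<..<t2} t * ?I n t) \<le> indicator {t1<..<t2} t * (M * (x2 - x1))" for n
          using I_bd by (intro AE_I2) (auto simp: indicator_def)
        show "(\<lambda>t. indicator {t1<..<t2} t * ?I n t) \<in> borel_measurable lborel" for n
          using borel_measurable_integrable[OF integral_lborel_prod(2)[OF gi[of n]]] unfolding in_Q by simp
      qed measurable
      then show ?thesis
        unfolding integral_lborel_prod(1)[OF gi] in_Q integral_mult_right_zero
        using box_integral[of t1 t2 x1 x2] t t12 s by (simp add: box)
    qed simp
    have bd: "\<bar>LINT z|lborel. indicator (S \<inter> ?Q) z * d z\<bar> \<le> M * measure lborel (S \<inter> ?Q)" if [measurable]: "S \<in> sets borel" for S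
    proof -
      have "(\<lambda>n. LINT z|lborel. indicator (S \<inter> ?Q) z * g n z) \<longlonglongrightarrow> (LINT z|lborel. indicator (S \<inter> ?Q) z * d z)"
        by (rule box_limit_imp_borel_limit[where M="max M C"])
           (use g_bound d_bound lim that in \<open>auto simp: le_max_iff_disj\<close>)
      moreover have "\<bar>LINT z|lborel. indicator (S \<inter> ?Q) z * g n z\<bar> \<le> M * measure lborel (S \<inter> ?Q)" for n
      proof -
        have i: "integrable lborel (\<lambda>z. indicator (S \<inter> ?Q) z * M)"
          by (rule integrable_bounded_support[where a="(s1,-R)" and b="(s2,R)" and K=M])
             (use M0 box_subset_cbox[of "(s1,-R)" "(s2,R)"] in \<open>auto simp: indicator_def\<close>)
        have "\<bar>LINT z|lborel. indicator (S \<inter> ?Q) z * g n z\<bar> \<le> (LINT z|lborel. indicator (S \<inter> ?Q) z * M)"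
          by (rule order_trans[OF integral_abs_bound integral_mono'[OF i]]) (use g_bound M0 in \<open>auto simp: indicator_def\<close>)
        then show ?thesis by (simp add: mult.commute)
      qed
      ultimately show ?thesis
        by (intro tendsto_upperbound[OF tendsto_rabs]) auto
    qed
    \<comment> \<open>The two signs \<sigma> treat \<open>d > M\<close> and \<open>- d > M\<close>
      together: a positive integrand with non-positive integral forces its set to be null.\<close>
    have null: "AE z in lborel. \<not> (z \<in> ?Q \<and> \<sigma> * d z > M)" if \<sigma>: "\<bar>\<sigma>\<bar> = 1" for \<sigma>
    proof -
      define S where "S = {z. \<sigma> * d z > M}"
      have [measurable]: "S \<in> sets borel" unfolding S_def by measurable
      have i1: "integrable lborel (\<lambda>z. indicator (S \<inter> ?Q) z * (\<sigma> * d z - M))"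
        by (rule integrable_bounded_support[where a="(s1,-R)" and b="(s2,R)" and K="C + M"])
           (use box_subset_cbox[of "(s1,-R)" "(s2,R)"] d_bound M0 \<sigma> C_nonneg in \<open>auto simp: indicator_def abs_mult intro!: order_trans[OF abs_triangle_ineq4] add_mono\<close>)
      have i2: "integrable lborel (\<lambda>z. indicator (S \<inter> ?Q) z * d z)"
        by (rule integrable_bounded_support[where a="(s1,-R)" and b="(s2,R)" and K="C"])
           (use box_subset_cbox[of "(s1,-R)" "(s2,R)"] d_bound C_nonneg in \<open>auto simp: indicator_def\<close>)
      have i3: "integrable lborel (\<lambda>z. indicator (S \<inter> ?Q) z * M)"
        by (rule integrable_bounded_support[where a="(s1,-R)" and b="(s2,R)" and K="M"])
           (use box_subset_cbox[of "(s1,-R)" "(s2,R)"] M0 in \<open>auto simp: indicator_def\<close>)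
      have "(LINT z|lborel. indicator (S \<inter> ?Q) z * (\<sigma> * d z - M)) = \<sigma> * (LINT z|lborel. indicator (S \<inter> ?Q) z * d z) - (LINT z|lborel. indicator (S \<inter> ?Q) z * M)"
        using i2 i3 by (simp add: right_diff_distrib mult.left_commute[of _ \<sigma>])
      also have "\<dots> \<le> \<bar>\<sigma> * (LINT z|lborel. indicator (S \<inter> ?Q) z * d z)\<bar> - M * measure lborel (S \<inter> ?Q)"
        by (simp add: mult.commute)
      also have "\<dots> \<le> 0" using bd[of S] \<sigma> by (simp add: abs_mult)
      finally have le0: "(LINT z|lborel. indicator (S \<inter> ?Q) z * (\<sigma> * d z - M)) \<le> 0" .
      have nn: "0 \<le> indicator (S \<inter> ?Q) z * (\<sigma> * d z - M)" for z by (auto simp: indicator_def S_def)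
      have "(LINT z|lborel. indicator (S \<inter> ?Q) z * (\<sigma> * d z - M)) = 0"
        using le0 by (rule antisym) (rule Bochner_Integration.integral_nonneg[OF nn])
      then have "AE z in lborel. indicator (S \<inter> ?Q) z * (\<sigma> * d z - M) = 0"
        using integral_nonneg_eq_0_iff_AE[OF i1] nn by auto
      then show ?thesis by eventually_elim (auto simp: indicator_def S_def split: if_splits)
    qed
    from null[of 1] null[of "-1"] show ?thesis
      by (auto elim!: AE_mp)
  qed
  then have "AE z in lborel. \<forall>n::nat. z \<in> box (s1, - real n) (s2, real n) \<longrightarrow> \<bar>d z\<bar> \<le> M"
    unfolding AE_all_countable by blast
  then show ?thesis
  proof eventually_elim
    case (elim z)
    obtain n :: nat where "\<bar>snd z\<bar> < real n" using reals_Archimedean2 by blast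
    then show ?case using elim[rule_format, of n] by (cases z) (auto simp: box_Pair_eq abs_less_iff)
  qed
qed

end

section \<open>Duhamel's formula\<close>

lemma poly_borel_measurable [measurable]: "poly p \<in> borel_measurable (borel :: real measure)"
  by (intro borel_measurable_continuous_onI continuous_intros)

lemma AE_fst_neq: "AE z in lborel :: (real \<times> real) measure. fst z \<noteq> (c :: real)" for c
proof -
  have "AE z in lborel \<Otimes>\<^sub>M (lborel :: real measure). fst z \<noteq> c"
    by (rule lborel_pair.AE_pair_measure) (measurable, use AE_lborel_singleton[of c] in auto)
  then show ?thesis unfolding lborel_prod .
qed

text \<open>The heat kernel without its factor \<open>1 / sqrt (2 pi)\<close>.\<close>

definition heat :: "real \<Rightarrow> real \<Rightarrow> real" where
  "heat \<tau> y = 1 / sqrt \<tau> * exp (- y\<^sup>2 / (2 * \<tau>))"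

lemma heat_measurable [measurable]: "heat \<tau> \<in> borel_measurable borel"
  unfolding heat_def by measurable

lemma heat_nonneg: "\<tau> > 0 \<Longrightarrow> heat \<tau> y \<ge> 0"
  by (simp add: heat_def)

lemma heat_le: "\<tau> > 0 \<Longrightarrow> heat \<tau> y \<le> 1 / sqrt \<tau>"
  by (simp add: heat_def divide_right_mono)

lemma heat_normal_density:
  assumes "\<tau> > 0"
  shows "heat \<tau> (x - c) = sqrt (2 * pi) * normal_density c (sqrt \<tau>) x"
  using assms by (simp add: heat_def normal_density_def real_sqrt_mult field_simps)

lemma heat_integral:
  assumes "\<tau> > 0"
  shows "integrable lborel (\<lambda>x. heat \<tau> (x - c))" "(LINT x|lborel. heat \<tau> (x - c)) = sqrt (2 * pi)"
  using assms unfolding heat_normal_density[OF assms] by simp_all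

text \<open>The two kernels cross only at the midpoint of their centres, so their L^1 distance is
  twice the mass of one kernel on an interval of length |c - c'|. Bounding the kernel by its maximum
  gives the singularity \<tau>^(-1/2), which is integrable in time; this makes the contraction
  possible.\<close>

lemma heat_L1_diff:
  assumes \<tau>: "\<tau> > 0"
  shows "(LINT x|lborel. \<bar>heat \<tau> (x - c) - heat \<tau> (x - c')\<bar>) \<le> 2 * \<bar>c - c'\<bar> / sqrt \<tau>"
proof -
  have main: "(LINT x|lborel. \<bar>heat \<tau> (x - c) - heat \<tau> (x - c')\<bar>) \<le> 2 * (c' - c) / sqrt \<tau>" if cc: "c \<le> c'" for c c'
  proof -
    define m where "m = (c + c') / 2"
    define h where "h = (c' - c) / 2"
    define D where "D = (\<lambda>x. heat \<tau> (x - c) - heat \<tau> (x - c'))"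
    have i: "integrable lborel (\<lambda>x. indicator {..b} x * heat \<tau> (x - c))" for b c
      using integrable_real_mult_indicator[OF _ heat_integral(1)[OF \<tau>], of "{..b}" c] by (simp add: mult.commute)
    have shift: "(LINT x|lborel. indicator {..m} x * heat \<tau> (x - c)) = (LINT y|lborel. indicator {..m - c} y * heat \<tau> y)" for c
      by (subst lborel_integral_real_affine[where c=1 and t=c]) (auto simp: indicator_def intro!: Bochner_Integration.integral_cong)
    \<comment> \<open>|D| is twice the positive part of D minus D, and D has integral 0, so only the
      positive part on the half-line up to the midpoint remains.\<close>
    have "\<bar>D x\<bar> = 2 * (indicator {..m} x * heat \<tau> (x - c) - indicator {..m} x * heat \<tau> (x - c')) - (heat \<tau> (x - c) - heat \<tau> (x - c'))" for x
    proof -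
      have "(x - c)\<^sup>2 - (x - c')\<^sup>2 = 2 * (c' - c) * (x - m)"
        by (simp add: m_def power2_eq_square field_simps)
      moreover have "x \<le> m \<Longrightarrow> 2 * (c' - c) * (x - m) \<le> 0" "x > m \<Longrightarrow> 2 * (c' - c) * (x - m) \<ge> 0"
        using cc by (auto intro!: mult_nonneg_nonpos mult_nonneg_nonneg)
      ultimately have *: "x \<le> m \<Longrightarrow> (x - c)\<^sup>2 \<le> (x - c')\<^sup>2" "x > m \<Longrightarrow> (x - c)\<^sup>2 \<ge> (x - c')\<^sup>2"
        by linarith+
      have "x \<le> m \<Longrightarrow> D x \<ge> 0" "x > m \<Longrightarrow> D x \<le> 0"
        using * \<tau> by (auto simp: D_def heat_def divide_right_mono)
      then show ?thesis by (cases "x \<le> m") (auto simp: D_def)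
    qed
    then have "(LINT x|lborel. \<bar>D x\<bar>) = (LINT x|lborel. 2 * (indicator {..m} x * heat \<tau> (x - c) - indicator {..m} x * heat \<tau> (x - c')) - (heat \<tau> (x - c) - heat \<tau> (x - c')))"
      by presburger
    also have "\<dots> = 2 * ((LINT x|lborel. indicator {..m} x * heat \<tau> (x - c)) - (LINT x|lborel. indicator {..m} x * heat \<tau> (x - c')))"
      by (subst Bochner_Integration.integral_diff, (intro integrable_mult_right Bochner_Integration.integrable_diff i heat_integral \<tau>)+)
         (simp only: integral_mult_right_zero Bochner_Integration.integral_diff[OF i i]
           Bochner_Integration.integral_diff[OF heat_integral(1)[OF \<tau>] heat_integral(1)[OF \<tau>]] heat_integral(2)[OF \<tau>] diff_self diff_zero)
    also have "(LINT x|lborel. indicator {..m} x * heat \<tau> (x - c)) - (LINT x|lborel. indicator {..m} x * heat \<tau> (x - c'))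
      = (LINT y|lborel. indicator {..h} y * heat \<tau> y) - (LINT y|lborel. indicator {..-h} y * heat \<tau> y)"
    proof -
      have "m - c = h" "m - c' = - h" by (simp_all add: m_def h_def field_simps)
      then show ?thesis unfolding shift by simp
    qed
    also have "\<dots> = (LINT y|lborel. indicator {..h} y * heat \<tau> y - indicator {..-h} y * heat \<tau> y)"
      using i[of h 0] i[of "-h" 0] by (subst Bochner_Integration.integral_diff) simp_all
    also have "\<dots> \<le> (LINT y|lborel. indicator {-h<..h} y * (1 / sqrt \<tau>))"
    proof (rule integral_mono)
      show "integrable lborel (\<lambda>y. indicator {..h} y * heat \<tau> y - indicator {..-h} y * heat \<tau> y)"
        using i[of h 0] i[of "-h" 0] by simp
      show "integrable lborel (\<lambda>y. indicator {-h<..h} y * (1 / sqrt \<tau>))"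
      proof (intro integrable_mult_left integrable_real_indicator)
        have "h \<ge> 0" using cc unfolding h_def by simp
        then have "- h \<le> h" by linarith
        then show "emeasure lborel {-h<..h} < \<infinity>" by (simp only: emeasure_lborel_Ioc) simp
      qed simp
      show "indicator {..h} y * heat \<tau> y - indicator {..-h} y * heat \<tau> y \<le> indicator {-h<..h} y * (1 / sqrt \<tau>)" for y
        using cc heat_le[OF \<tau>, of y] heat_nonneg[OF \<tau>, of y] by (auto simp: indicator_def h_def)
    qed
    also have "\<dots> = (c' - c) / sqrt \<tau>"
    proof -
      have "measure lborel {-h<..h} = c' - c"
      proof -
        have "h \<ge> 0" using cc unfolding h_def by simp
        then have "emeasure lborel {-h<..h} = ennreal (h - - h)" by (intro emeasure_lborel_Ioc) linarith
        then show ?thesis using \<open>h \<ge> 0\<close> by (simp add: measure_def) (simp add: h_def)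
      qed
      then show ?thesis by simp
    qed
    finally show ?thesis by (simp add: D_def)
  qed
  show ?thesis
  proof (cases "c \<le> c'")
    case True then show ?thesis using main[of c c'] by simp
  next
    case False then show ?thesis using main[of c' c] by (simp add: abs_minus_commute)
  qed
qed

lemma heat_has_derivative_x:
  assumes "\<tau> > 0"
  shows "((\<lambda>y. heat \<tau> (y - c)) has_real_derivative - (x - c) / \<tau> * heat \<tau> (x - c)) (at x)"
proof -
  have "((\<lambda>y. exp (- (y - c)\<^sup>2 / (2 * \<tau>))) has_real_derivative - (x - c) / \<tau> * exp (- (x - c)\<^sup>2 / (2 * \<tau>))) (at x)"
    using assms by (auto intro!: derivative_eq_intros simp: field_simps power2_eq_square)
  from DERIV_cmult[OF this, of "1 / sqrt \<tau>"] show ?thesis by (simp add: heat_def mult_ac)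
qed

lemma heat_has_derivative_xx:
  assumes "\<tau> > 0"
  shows "((\<lambda>y. - (y - c) / \<tau> * heat \<tau> (y - c)) has_real_derivative ((x - c)\<^sup>2 / \<tau>\<^sup>2 - 1 / \<tau>) * heat \<tau> (x - c)) (at x)"
  using assms by (auto intro!: derivative_eq_intros heat_has_derivative_x simp: field_simps power2_eq_square)

text \<open>In changed time \<open>T\<close> the kernel solves the heat equation with coefficient
  T'/2; the bracket is the second space derivative from
  \<open>heat_has_derivative_xx\<close>.\<close>

lemma heat_has_derivative_t:
  assumes T: "(T has_real_derivative T') (at t)" and pos: "T t > 0"
  shows "((\<lambda>s. heat (T s) y) has_real_derivative T' / 2 * ((y\<^sup>2 / (T t)\<^sup>2 - 1 / T t) * heat (T t) y)) (at t)"
proof -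
  define i where "i = inverse (sqrt (T t))"
  define e where "e = exp (- y\<^sup>2 / (2 * T t))"
  have i2: "i * i = 1 / T t" using pos by (simp add: i_def inverse_eq_divide)
  have "((\<lambda>s. inverse (sqrt (T s))) has_real_derivative - (i * (T' * i / 2) * i)) (at t)"
    unfolding i_def using pos by (auto intro!: derivative_eq_intros T simp: mult_ac)
  moreover have "((\<lambda>s. exp (- y\<^sup>2 / (2 * T s))) has_real_derivative e * (y\<^sup>2 * T' / (2 * (T t)\<^sup>2))) (at t)"
    unfolding e_def using pos by (auto intro!: derivative_eq_intros T simp: field_simps power2_eq_square)
  ultimately have "((\<lambda>s. inverse (sqrt (T s)) * exp (- y\<^sup>2 / (2 * T s))) has_real_derivative
     - (i * (T' * i / 2) * i) * e + e * (y\<^sup>2 * T' / (2 * (T t)\<^sup>2)) * i) (at t)"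
    unfolding e_def i_def by (rule DERIV_mult)
  moreover have "- (i * (T' * i / 2) * i) * e + e * (y\<^sup>2 * T' / (2 * (T t)\<^sup>2)) * i = T' / 2 * ((y\<^sup>2 / (T t)\<^sup>2 - i * i) * (i * e))"
    using pos by (simp add: field_simps)
  ultimately show ?thesis
    unfolding heat_def i2 by (simp add: inverse_eq_divide i_def e_def)
qed

text \<open>One factor absorbs the linear growth of \<open>w\<close>, the other the factor |x - c|
  produced by a space derivative of the kernel.\<close>

lemma integrable_gaussian_weight:
  fixes c \<Theta> :: real
  assumes "\<Theta> > 0"
  shows "integrable lborel (\<lambda>x. (1 + \<bar>x\<bar>) * (1 + \<bar>x - c\<bar>) * exp (- (x - c)\<^sup>2 / (2 * \<Theta>)))"
proof (rule Bochner_Integration.integrable_bound)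
  have "integrable lborel (\<lambda>x. heat \<Theta> (x - c) * \<bar>x - c\<bar> ^ k)" for k
    unfolding heat_normal_density[OF assms] mult.assoc
    using integrable_normal_moment_abs[of "sqrt \<Theta>" c k] assms by (intro integrable_mult_right) simp
  from this[of 0] this[of 1] this[of 2]
  show "integrable lborel (\<lambda>x. sqrt \<Theta> * (1 + \<bar>c\<bar>) * (heat \<Theta> (x - c) * \<bar>x - c\<bar> ^ 0 + 2 * (heat \<Theta> (x - c) * \<bar>x - c\<bar> ^ 1) + heat \<Theta> (x - c) * \<bar>x - c\<bar> ^ 2))"
    by (intro integrable_mult_right Bochner_Integration.integrable_add)
  show "AE x in lborel. norm ((1 + \<bar>x\<bar>) * (1 + \<bar>x - c\<bar>) * exp (- (x - c)\<^sup>2 / (2 * \<Theta>)))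
     \<le> norm (sqrt \<Theta> * (1 + \<bar>c\<bar>) * (heat \<Theta> (x - c) * \<bar>x - c\<bar> ^ 0 + 2 * (heat \<Theta> (x - c) * \<bar>x - c\<bar> ^ 1) + heat \<Theta> (x - c) * \<bar>x - c\<bar> ^ 2))"
  proof (rule AE_I2)
    fix x
    have h: "sqrt \<Theta> * heat \<Theta> (x - c) = exp (- (x - c)\<^sup>2 / (2 * \<Theta>))" using assms by (simp add: heat_def)
    have "1 + \<bar>x\<bar> \<le> (1 + \<bar>c\<bar>) * (1 + \<bar>x - c\<bar>)"
      using abs_triangle_ineq[of "x - c" c] by (auto simp: algebra_simps intro: order_trans)
    then have "(1 + \<bar>x\<bar>) * (1 + \<bar>x - c\<bar>) * exp (- (x - c)\<^sup>2 / (2 * \<Theta>)) \<le> ((1 + \<bar>c\<bar>) * (1 + \<bar>x - c\<bar>)) * (1 + \<bar>x - c\<bar>) * exp (- (x - c)\<^sup>2 / (2 * \<Theta>))"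
      by (intro mult_right_mono) auto
    also have "\<dots> = sqrt \<Theta> * (1 + \<bar>c\<bar>) * (heat \<Theta> (x - c) * \<bar>x - c\<bar> ^ 0 + 2 * (heat \<Theta> (x - c) * \<bar>x - c\<bar> ^ 1) + heat \<Theta> (x - c) * \<bar>x - c\<bar> ^ 2)"
      unfolding h[symmetric] by (simp only: power2_eq_square power_0 power_one_right) algebra
    finally show "norm ((1 + \<bar>x\<bar>) * (1 + \<bar>x - c\<bar>) * exp (- (x - c)\<^sup>2 / (2 * \<Theta>)))
     \<le> norm (sqrt \<Theta> * (1 + \<bar>c\<bar>) * (heat \<Theta> (x - c) * \<bar>x - c\<bar> ^ 0 + 2 * (heat \<Theta> (x - c) * \<bar>x - c\<bar> ^ 1) + heat \<Theta> (x - c) * \<bar>x - c\<bar> ^ 2))"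
      unfolding real_norm_def by (subst abs_of_nonneg[of "(1 + _) * _ * _"]) (auto intro: order_trans[OF _ abs_ge_self])
  qed
qed measurable

lemma integrable_time_times_space:
  fixes a b :: real and g :: "real \<Rightarrow> real"
  assumes g: "integrable lborel g" and "a \<le> b"
  shows "integrable lborel (\<lambda>z. indicator {a..b} (fst z) * g (snd z) :: real)"
proof -
  have [measurable]: "g \<in> borel_measurable borel" using g by auto
  have i: "integrable lborel (indicator {a..b} :: real \<Rightarrow> real)"
    using assms(2) by (intro integrable_real_indicator) auto
  have "integrable (lborel \<Otimes>\<^sub>M lborel) (\<lambda>z. indicator {a..b} (fst z) * g (snd z))"
  proof (rule lborel_pair.Fubini_integrable)
    have "(\<lambda>z. indicator {a..b} (fst z) * g (snd z)) \<in> borel_measurable (borel :: (real \<times> real) measure)" by measurable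
    then show "(\<lambda>z. indicator {a..b} (fst z) * g (snd z)) \<in> borel_measurable (lborel \<Otimes>\<^sub>M lborel)"
      by (simp add: lborel_prod)
    show "integrable lborel (\<lambda>x. LINT y|lborel. norm (indicator {a..b} (fst (x, y)) * g (snd (x, y))))"
      using i by (simp add: abs_mult)
    show "AE x in lborel. integrable lborel (\<lambda>y. indicator {a..b} (fst (x, y)) * g (snd (x, y)))"
      using g by simp
  qed
  then show ?thesis by (simp add: lborel_prod)
qed


section \<open>Testing the linear equation with the heat kernel\<close>

context linear_weak begin

definition a_bound :: real where
  "a_bound = (SUP t\<in>{0..1}. poly (pderiv P) t)"

lemma a_le_bound: "t \<in> {0..1} \<Longrightarrow> poly (pderiv P) t \<le> a_bound"
  unfolding a_bound_def
  by (rule cSUP_upper) (auto intro!: bounded_imp_bdd_above compact_imp_bounded compact_continuous_image continuous_intros)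

lemma A_le: "s \<le> t \<Longrightarrow> 0 \<le> s \<Longrightarrow> t \<le> 1 \<Longrightarrow> poly P s \<le> poly P t"
proof (rule DERIV_nonneg_imp_nondecreasing[of s t "poly P"])
  fix x assume "0 \<le> s" "t \<le> 1" "s \<le> x" "x \<le> t"
  then show "\<exists>y. (poly P has_real_derivative y) (at x) \<and> 0 \<le> y"
    using A_mono[of x] by (intro exI[of _ "poly (pderiv P) x"] conjI poly_DERIV) auto
qed

text \<open>The bound on \<open>d\<close> makes \<open>w\<close> Lipschitz in space with constant
  \<open>C\<close>, up to and including time 1. Linear growth suffices for pairing \<open>w\<close>
  with Gaussian kernels.\<close>

lemma w_linear_growth:
  assumes "0 < t0" "t0 < 1"
  obtains K where "K \<ge> 0" "\<And>t x. t \<in> {t0..1} \<Longrightarrow> \<bar>w (t, x)\<bar> \<le> K * (1 + \<bar>x\<bar>)"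
proof -
  obtain K where K: "K \<ge> 0" "\<And>t x. \<bar>x\<bar> \<le> 0 \<Longrightarrow> \<bar>w (t, x)\<bar> \<le> K"
    using w_locally_bounded by blast
  show ?thesis
  proof (rule that[of "K + C"])
    fix t x assume t: "t \<in> {t0..1}"
    have lip: "\<bar>w (t, x2) - w (t, x1)\<bar> \<le> C * (x2 - x1)" if "x1 < x2" for x1 x2
      by (rule lipschitz_of_derivative_bound[of t0 1]) (use assms d_bound t that in auto)
    have "\<bar>w (t, x) - w (t, 0)\<bar> \<le> C * \<bar>x\<bar>"
      using lip[of 0 x] lip[of x 0] by (cases x "0 :: real" rule: linorder_cases) (auto simp: abs_minus_commute)
    then have "\<bar>w (t, x)\<bar> \<le> K + C * \<bar>x\<bar>" using K(2)[of 0 t] by linarith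
    also have "\<dots> \<le> (K + C) * (1 + \<bar>x\<bar>)"
      using K(1) C_nonneg by (simp add: algebra_simps)
    finally show "\<bar>w (t, x)\<bar> \<le> (K + C) * (1 + \<bar>x\<bar>)" .
  qed (use K C_nonneg in simp)
qed

text \<open>Duhamel's formula: test the equation with a cutoff of the backward heat kernel.\<close>

lemma duhamel:
  fixes t0 T0 \<sigma> c :: real
  assumes t0: "0 < t0" "t0 < T0" "T0 \<le> 1" and \<sigma>: "\<sigma> > 0" and wT: "\<And>x. w (T0, x) = 0"
  defines "H \<equiv> \<lambda>z. indicator {t0..T0} (fst z) * (poly (pderiv P) (fst z) / 2 * f z * heat (\<sigma> + poly P (fst z) - poly P t0) (snd z - c))"
  shows "integrable lborel (\<lambda>x. w (t0, x) * heat \<sigma> (x - c))"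
    and "integrable lborel H"
    and "(LINT x|lborel. w (t0, x) * heat \<sigma> (x - c)) = (LINT z|lborel. H z)"
proof -
  \<comment> \<open>The clock starts at \<sigma> and runs with speed P', so that the kernel solves
    the adjoint equation and its second space derivative cancels in the weak equation. As a
    polynomial, \<tau> may become non-positive outside [t0,1], while a test function must be smooth
    on the whole plane.\<close>
  define \<tau> where "\<tau> = (\<lambda>t. poly (P + [:\<sigma> - poly P t0:]) t)"
  have \<tau>: "\<tau> t = \<sigma> + poly P t - poly P t0" for t by (simp add: \<tau>_def)
  \<comment> \<open>\<open>T\<close> agrees with the time change \<open>\<tau>\<close> where \<open>\<tau> \<ge> \<sigma> / 2\<close>, and is positive everywhere\<close>
  define q where "q = smult (2 / \<sigma>) (P + [:\<sigma> - poly P t0:])"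
  have q: "poly q t = 2 * \<tau> t / \<sigma>" for t by (simp add: q_def \<tau>_def field_simps)
  define T where "T = (\<lambda>t. \<tau> t * smooth_step 0 (poly q t) + (1 + (- 1) * smooth_step 0 (poly q t)))"
  have T_smooth: "smooth2 (\<lambda>z. T (fst z))"
    unfolding T_def \<tau>_def by (intro smooth2_add smooth2_mult smooth2_poly_fst smooth2_const smooth2_smooth_step_poly)
  have T_eq: "T t = \<tau> t" if "\<tau> t \<ge> \<sigma> / 2" for t
    using that \<sigma> by (simp add: T_def q field_simps)
  have T_pos: "T t > 0" for t
  proof (cases "\<tau> t \<le> 0")
    case True
    then have "poly q t \<le> 0" using \<sigma> by (simp add: q divide_nonpos_pos)
    then show ?thesis by (simp add: T_def)
  next
    case False
    define s where "s = smooth_step 0 (poly q t)"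
    have "0 \<le> s" "s \<le> 1" by (simp_all add: s_def smooth_step_bounds)
    then have "\<tau> t * s + (1 + - 1 * s) > 0"
      using False by (cases "s = 0") (auto intro!: add_pos_nonneg)
    then show ?thesis by (simp add: T_def s_def)
  qed
  have \<tau>_ge: "\<tau> t \<ge> \<sigma>" if "t \<in> {t0..1}" for t
    using A_le[of t0 t] that t0 by (auto simp: \<tau>)
  define \<Theta> where "\<Theta> = \<tau> 1"
  have \<tau>_le: "\<tau> t \<le> \<Theta>" if "t \<in> {t0..1}" for t
    using A_le[of t 1] that t0 by (auto simp: \<tau> \<Theta>_def)
  have \<Theta>_pos: "\<Theta> > 0" using \<tau>_ge[of 1] t0 \<sigma> by (simp add: \<Theta>_def)
  define G where "G = (\<lambda>z. heat (T (fst z)) (snd z - c))"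
  have G_smooth: "smooth2 G"
    unfolding G_def heat_def by (rule smooth2_gaussian[OF T_smooth T_pos])
  define Gx where "Gx = (\<lambda>z. - (snd z - c) / T (fst z) * G z)"
  define Gxx where "Gxx = (\<lambda>z. ((snd z - c)\<^sup>2 / (T (fst z))\<^sup>2 - 1 / T (fst z)) * G z)"
  have T_meas [measurable]: "T \<in> borel_measurable borel"
    unfolding T_def \<tau>_def by measurable
  have G_meas [measurable]: "G \<in> borel_measurable borel"
    unfolding G_def heat_def by measurable
  have Gx_meas [measurable]: "Gx \<in> borel_measurable borel" unfolding Gx_def by measurable
  have G_x: "((\<lambda>y. G (r, y)) has_real_derivative Gx (r, x)) (at x)" for r x
    unfolding G_def Gx_def fst_conv snd_conv by (rule heat_has_derivative_x[OF T_pos])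
  have G_xx: "((\<lambda>y. Gx (r, y)) has_real_derivative Gxx (r, x)) (at x)" for r x
    unfolding G_def Gx_def Gxx_def fst_conv snd_conv by (rule heat_has_derivative_xx[OF T_pos])
  have G_r: "partial_r G (r, x) = poly (pderiv P) r / 2 * Gxx (r, x)" if r: "r \<in> {t0..1}" for r x
  proof -
    have "isCont \<tau> r" unfolding \<tau>_def by (rule poly_isCont)
    then have "\<forall>\<^sub>F s in nhds r. \<tau> s > \<sigma> / 2"
      using \<tau>_ge[OF r] \<sigma> order_tendstoD(1)[of \<tau> "\<tau> r" "nhds r" "\<sigma> / 2"]
      by (auto simp: isCont_def tendsto_nhds_iff)
    then have ev: "\<forall>\<^sub>F s in nhds r. T s = \<tau> s" by (rule eventually_mono) (use T_eq in auto)
    have "(\<tau> has_real_derivative poly (pderiv P) r) (at r)"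
      using poly_DERIV[of "P + [:\<sigma> - poly P t0:]" r] unfolding \<tau>_def
      by (simp only: pderiv_add pderiv_pCons pderiv_0 pCons_0_0 add_0_right)
    then have T': "(T has_real_derivative poly (pderiv P) r) (at r)"
      by (subst DERIV_cong_ev[OF refl ev refl])
    have "((\<lambda>s. G (s, x)) has_real_derivative poly (pderiv P) r / 2 * Gxx (r, x)) (at r)"
      unfolding G_def Gxx_def fst_conv snd_conv by (rule heat_has_derivative_t[OF T' T_pos])
    then show ?thesis using smooth2_partial_r[OF G_smooth, where r=r and x=x] DERIV_unique by blast
  qed
  \<comment> \<open>All kernels on the time interval are dominated, up to the factor 1/sqrt
    \<sigma>, by the Gaussian of largest variance \<Theta>.\<close>
  define E where "E = (\<lambda>x. exp (- (x - c)\<^sup>2 / (2 * \<Theta>)))"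
  have G_nonneg: "G z \<ge> 0" for z unfolding G_def by (rule heat_nonneg[OF T_pos])
  have TT: "T t = \<tau> t" "T t \<ge> \<sigma>" if "t \<in> {t0..1}" for t
    using T_eq[of t] \<tau>_ge[OF that] \<sigma> by auto
  have G_le: "G (t, x) \<le> 1 / sqrt \<sigma> * E x" if t: "t \<in> {t0..1}" for t x
  proof -
    have "(x - c)\<^sup>2 / (2 * \<Theta>) \<le> (x - c)\<^sup>2 / (2 * T t)"
      using TT[OF t] \<tau>_le[OF t] \<sigma> by (intro divide_left_mono) (auto simp: zero_less_mult_iff)
    then show ?thesis
      unfolding G_def heat_def E_def fst_conv snd_conv using TT[OF t] \<sigma>
      by (intro mult_mono divide_left_mono) auto
  qed
  have Gx_le: "\<bar>Gx (t, x)\<bar> \<le> \<bar>x - c\<bar> / \<sigma> * (1 / sqrt \<sigma> * E x)" if t: "t \<in> {t0..1}" for t x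
  proof -
    have "\<bar>Gx (t, x)\<bar> = \<bar>x - c\<bar> / T t * G (t, x)"
      using T_pos[of t] G_nonneg[of "(t, x)"] by (simp add: Gx_def abs_mult abs_minus_commute)
    also have "\<dots> \<le> \<bar>x - c\<bar> / \<sigma> * (1 / sqrt \<sigma> * E x)"
      using TT[OF t] \<sigma> G_nonneg by (intro mult_mono divide_left_mono G_le t) auto
    finally show ?thesis .
  qed
  obtain K where K: "K \<ge> 0" "\<And>t x. t \<in> {t0..1} \<Longrightarrow> \<bar>w (t, x)\<bar> \<le> K * (1 + \<bar>x\<bar>)"
    using w_linear_growth[of t0] t0 by auto
  define D where "D = (\<lambda>x. (1 + \<bar>x\<bar>) * (1 + \<bar>x - c\<bar>) * E x)"
  have D_int: "integrable lborel D"
    unfolding D_def E_def by (rule integrable_gaussian_weight[OF \<Theta>_pos])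
  have E_nonneg: "E x \<ge> 0" for x by (simp add: E_def)
  have E_D: "E x \<le> D x" "(1 + \<bar>x\<bar>) * E x \<le> D x" "(1 + \<bar>x\<bar>) * (\<bar>x - c\<bar> * E x) \<le> D x" for x
  proof -
    have "1 * E x \<le> ((1 + \<bar>x\<bar>) * (1 + \<bar>x - c\<bar>)) * E x"
      by (intro mult_right_mono E_nonneg) (auto simp: algebra_simps)
    then show "E x \<le> D x" by (simp add: D_def)
    show "(1 + \<bar>x\<bar>) * E x \<le> D x" "(1 + \<bar>x\<bar>) * (\<bar>x - c\<bar> * E x) \<le> D x"
      using E_nonneg[of x] unfolding D_def by (auto simp: algebra_simps intro!: mult_nonneg_nonneg add_nonneg_nonneg)
  qed
  have D_nonneg: "D x \<ge> 0" for x using E_nonneg[of x] E_D(1)[of x] by linarith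
  have wG: "\<bar>w (t, x) * G (t, x)\<bar> \<le> K / sqrt \<sigma> * D x" if t: "t \<in> {t0..1}" for t x
  proof -
    have "\<bar>w (t, x) * G (t, x)\<bar> \<le> (K * (1 + \<bar>x\<bar>)) * (1 / sqrt \<sigma> * E x)"
      unfolding abs_mult using G_nonneg[of "(t, x)"] by (intro mult_mono K t order_trans[OF _ G_le[OF t]]) (auto simp: K)
    also have "\<dots> = K / sqrt \<sigma> * ((1 + \<bar>x\<bar>) * E x)" by simp
    also have "\<dots> \<le> K / sqrt \<sigma> * D x" using K(1) \<sigma> by (intro mult_left_mono E_D) auto
    finally show ?thesis .
  qed
  have wGx: "\<bar>w (t, x) * Gx (t, x)\<bar> \<le> K / (\<sigma> * sqrt \<sigma>) * D x" if t: "t \<in> {t0..1}" for t x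
  proof -
    have "\<bar>w (t, x) * Gx (t, x)\<bar> \<le> (K * (1 + \<bar>x\<bar>)) * (\<bar>x - c\<bar> / \<sigma> * (1 / sqrt \<sigma> * E x))"
      unfolding abs_mult by (intro mult_mono K t Gx_le) (auto simp: K)
    also have "\<dots> = K / (\<sigma> * sqrt \<sigma>) * ((1 + \<bar>x\<bar>) * (\<bar>x - c\<bar> * E x))" by simp
    also have "\<dots> \<le> K / (\<sigma> * sqrt \<sigma>) * D x" using K(1) \<sigma> by (intro mult_left_mono E_D) auto
    finally show ?thesis .
  qed
  have fC: "\<bar>f z\<bar> \<le> C * C" for z
    using f_bound[of z] mult_left_mono[OF d_bound[of z] C_nonneg] by linarith
  have fG: "\<bar>f (t, x) * G (t, x)\<bar> \<le> C * C / sqrt \<sigma> * D x" if t: "t \<in> {t0..1}" for t x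
  proof -
    have "\<bar>f (t, x) * G (t, x)\<bar> \<le> (C * C) * (1 / sqrt \<sigma> * E x)"
      unfolding abs_mult using G_nonneg[of "(t, x)"] by (intro mult_mono fC order_trans[OF _ G_le[OF t]]) auto
    also have "\<dots> = C * C / sqrt \<sigma> * E x" by simp
    also have "\<dots> \<le> C * C / sqrt \<sigma> * D x" using \<sigma> by (intro mult_left_mono E_D) auto
    finally show ?thesis .
  qed
  have t01: "{t0..T0} \<subseteq> {t0..1}" "{t0..T0} \<subseteq> {0..1}" using t0 by auto
  have ab: "0 \<le> poly (pderiv P) t" "poly (pderiv P) t \<le> a_bound" if "t \<in> {t0..1}" for t
    using A_mono[of t] a_le_bound[of t] that t0 by auto
  have ab0: "a_bound \<ge> 0" using ab[of 1] t0 by auto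
  have aw: "\<bar>poly (pderiv P) t / 2 * y\<bar> \<le> a_bound * B" if "t \<in> {t0..1}" "\<bar>y\<bar> \<le> B" for t y B
    unfolding abs_mult using ab[OF that(1)] that(2) by (intro mult_mono) auto
  have poly_meas [measurable]: "(\<lambda>z :: real \<times> real. poly p (fst z)) \<in> borel_measurable borel" for p
    by (intro borel_measurable_continuous_onI continuous_intros)
  have dom_int: "integrable lborel (\<lambda>z. indicator {t0..T0} (fst z) * (B * D (snd z)))" for B
    by (rule integrable_time_times_space) (use D_int t0 in auto)
  have H_eq: "H z = indicator {t0..T0} (fst z) * (poly (pderiv P) (fst z) / 2 * (f z * G z))" for z
    using TT(1)[of "fst z"] t01 by (auto simp: H_def G_def indicator_def \<tau> mult.assoc)
  have H_meas [measurable]: "H \<in> borel_measurable borel"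
    unfolding H_eq[abs_def] by measurable
  show H_int: "integrable lborel H"
  proof (rule Bochner_Integration.integrable_bound[OF dom_int[of "a_bound * (C * C / sqrt \<sigma>)"]])
    show "AE z in lborel. norm (H z) \<le> norm (indicator {t0..T0} (fst z) * (a_bound * (C * C / sqrt \<sigma>) * D (snd z)))"
    proof (rule AE_I2)
      fix z
      show "norm (H z) \<le> norm (indicator {t0..T0} (fst z) * (a_bound * (C * C / sqrt \<sigma>) * D (snd z)))"
      proof (cases "fst z \<in> {t0..T0}")
        case True
        then have "fst z \<in> {t0..1}" using t01 by auto
        then have "\<bar>poly (pderiv P) (fst z) / 2 * (f (fst z, snd z) * G (fst z, snd z))\<bar> \<le> a_bound * (C * C / sqrt \<sigma> * D (snd z))"
          by (intro aw fG)
        then have "\<bar>H z\<bar> \<le> a_bound * (C * C / sqrt \<sigma> * D (snd z))" using True by (simp add: H_eq)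
        also have "\<dots> \<le> \<bar>a_bound * (C * C / sqrt \<sigma> * D (snd z))\<bar>" by (rule abs_ge_self)
        finally show ?thesis using True by (simp add: mult.assoc)
      qed (simp add: H_eq)
    qed
  qed simp
  have wG_meas: "(\<lambda>x. w (t, x) * G (t, x)) \<in> borel_measurable borel" for t by measurable
  have wG_int: "integrable lborel (\<lambda>x. w (t, x) * G (t, x))" if "t \<in> {t0..1}" for t
  proof (rule Bochner_Integration.integrable_bound[OF integrable_mult_right[OF D_int, of "K / sqrt \<sigma>"]])
    show "AE x in lborel. norm (w (t, x) * G (t, x)) \<le> norm (K / sqrt \<sigma> * D x)"
    proof (rule AE_I2)
      fix x show "norm (w (t, x) * G (t, x)) \<le> norm (K / sqrt \<sigma> * D x)"
        using wG[OF that, of x] abs_ge_self[of "K / sqrt \<sigma> * D x"] unfolding real_norm_def by linarith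
    qed
  qed (use wG_meas in simp)
  have G_t0: "G (t0, x) = heat \<sigma> (x - c)" for x using TT(1)[of t0] t0 by (simp add: G_def \<tau>)
  show "integrable lborel (\<lambda>x. w (t0, x) * heat \<sigma> (x - c))"
    using wG_int[of t0] t0 by (simp add: G_t0)
  \<comment> \<open>The formula is an integrated statement about \<Phi>: its derivative is minus
    \<open>h\<close> in the weak sense, and it vanishes at \<open>T0\<close> because
    \<open>w\<close> does.\<close>
  define \<Phi> where "\<Phi> = (\<lambda>t. indicator {t0..T0} t * (LINT x|lborel. w (t, x) * G (t, x)))"
  define h where "h = (\<lambda>t. LINT x|lborel. H (t, x))"
  have h_int: "integrable lborel h" unfolding h_def by (rule integral_lborel_prod(2)[OF H_int])
  define F where "F = (\<lambda>z. indicator {t0..T0} (fst z) * (w z * G z))"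
  have F_meas [measurable]: "F \<in> borel_measurable borel" unfolding F_def by measurable
  have F_int: "integrable lborel F"
  proof (rule Bochner_Integration.integrable_bound[OF dom_int[of "K / sqrt \<sigma>"]])
    show "AE z in lborel. norm (F z) \<le> norm (indicator {t0..T0} (fst z) * (K / sqrt \<sigma> * D (snd z)))"
    proof (rule AE_I2)
      fix z
      show "norm (F z) \<le> norm (indicator {t0..T0} (fst z) * (K / sqrt \<sigma> * D (snd z)))"
      proof (cases "fst z \<in> {t0..T0}")
        case True
        then have "\<bar>w (fst z, snd z) * G (fst z, snd z)\<bar> \<le> K / sqrt \<sigma> * D (snd z)" using t01 by (intro wG) auto
        then show ?thesis using True abs_ge_self[of "K / sqrt \<sigma> * D (snd z)"] by (simp add: F_def)
      qed (simp add: F_def)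
    qed
  qed simp
  have F_x: "(LINT x|lborel. F (t, x)) = \<Phi> t" for t by (simp add: F_def \<Phi>_def)
  have \<Phi>_meas [measurable]: "\<Phi> \<in> borel_measurable borel"
    using borel_measurable_integrable[OF integral_lborel_prod(2)[OF F_int]] unfolding F_x by simp
  have bdd_mult: "integrable lborel (\<lambda>z. g (fst z) * F z)" "integrable lborel (\<lambda>z. g (fst z) * H z)"
    if [measurable]: "g \<in> borel_measurable borel" and X: "\<And>t. \<bar>g t\<bar> \<le> X" for g :: "real \<Rightarrow> real" and X
  proof -
    have "integrable lborel (\<lambda>z. X * F z)" "integrable lborel (\<lambda>z. X * H z)" using F_int H_int by auto
    note XF = this
    have le: "\<bar>g t * y\<bar> \<le> \<bar>X * y\<bar>" for t y
      unfolding abs_mult by (intro mult_right_mono order_trans[OF X abs_ge_self]) simp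
    show "integrable lborel (\<lambda>z. g (fst z) * F z)"
      by (rule Bochner_Integration.integrable_bound[OF XF(1)]) (use le in auto)
    show "integrable lborel (\<lambda>z. g (fst z) * H z)"
      by (rule Bochner_Integration.integrable_bound[OF XF(2)]) (use le in auto)
  qed
  \<comment> \<open>The space cutoff is removed here, with the time cutoff fixed; the limit in
    \<open>n\<close> is taken afterwards.\<close>
  have key: "(LINT t|lborel. cutoff n t0 T0 (Suc 0) t * \<Phi> t) = (LINT t|lborel. cutoff n t0 T0 0 t * h t)"
    if n: "2 \<le> real n * (T0 - t0)" for n
  proof -
    let ?\<chi> = "cutoff n t0 T0"
    \<comment> \<open>Equal to 1 on [-m, m], with ramps of fixed width, so that its derivatives are
      bounded independently of \<open>m\<close>. The right endpoint is one unit further out because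
      the cutoff stops one unit before it.\<close>
    let ?\<kappa> = "\<lambda>m::nat. cutoff 1 (- real m - 1) (real m + 2)"
    let ?\<phi> = "\<lambda>m z. ?\<chi> 0 (fst z) * ?\<kappa> m 0 (snd z) * G z"
    obtain X where X: "\<And>t. \<bar>?\<chi> (Suc 0) t\<bar> \<le> X" using cutoff_bounded by blast
    obtain Y1 where Y1: "\<And>m x. \<bar>?\<kappa> m (Suc 0) x\<bar> \<le> Y1" using cutoff_bounded[of 1 "Suc 0"] by blast
    obtain Y2 where Y2: "\<And>m x. \<bar>?\<kappa> m (Suc (Suc 0)) x\<bar> \<le> Y2" using cutoff_bounded[of 1 "Suc (Suc 0)"] by blast
    have XY0: "X \<ge> 0" "Y1 \<ge> 0" "Y2 \<ge> 0" using order_trans[OF abs_ge_zero X] order_trans[OF abs_ge_zero Y1] order_trans[OF abs_ge_zero Y2] by auto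
    have cm [measurable]: "(\<lambda>z :: real \<times> real. cutoff n a b k (fst z)) \<in> borel_measurable borel"
      "(\<lambda>z :: real \<times> real. cutoff n a b k (snd z)) \<in> borel_measurable borel" for n a b k
      by measurable
    \<comment> \<open>The integrand after cancellation: the time derivative of the kernel removes
      its second space derivative, leaving derivatives of the cutoffs and the source term.\<close>
    define J where "J = (\<lambda>m z. indicator {t0..T0} (fst z) * (- (?\<chi> (Suc 0) (fst z) * ?\<kappa> m 0 (snd z) * (w z * G z))
       + poly (pderiv P) (fst z) / 2 * (?\<chi> 0 (fst z) * (?\<kappa> m (Suc (Suc 0)) (snd z) * (w z * G z) + 2 * ?\<kappa> m (Suc 0) (snd z) * (w z * Gx z)
          + ?\<kappa> m 0 (snd z) * (f z * G z)))))"
    have J_0: "(LINT z|lborel. J m z) = 0" for m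
    proof -
      have tf: "test_function (?\<phi> m)"
        by (rule test_function_cutoff_product[OF t0 _ n _ G_smooth]) auto
      have pr: "partial_r (?\<phi> m) z = ?\<chi> (Suc 0) (fst z) * ?\<kappa> m 0 (snd z) * G z + ?\<chi> 0 (fst z) * ?\<kappa> m 0 (snd z) * partial_r G z" for z
      proof -
        have "partial_r (?\<phi> m) = (\<lambda>z. ?\<chi> (Suc 0) (fst z) * ?\<kappa> m 0 (snd z) * G z + ?\<chi> 0 (fst z) * ?\<kappa> m 0 (snd z) * partial_r G z)"
        proof (rule partial_r_eqI)
          fix r x
          have "((\<lambda>s. ?\<chi> 0 s * ?\<kappa> m 0 x * G (s, x)) has_real_derivative ?\<chi> (Suc 0) r * ?\<kappa> m 0 x * G (r, x) + partial_r G (r, x) * (?\<chi> 0 r * ?\<kappa> m 0 x)) (at r)"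
            by (intro DERIV_mult DERIV_cmult_right cutoff_has_derivative smooth2_partial_r[OF G_smooth])
          then show "((\<lambda>s. ?\<phi> m (s, x)) has_real_derivative ?\<chi> (Suc 0) (fst (r, x)) * ?\<kappa> m 0 (snd (r, x)) * G (r, x) + ?\<chi> 0 (fst (r, x)) * ?\<kappa> m 0 (snd (r, x)) * partial_r G (r, x)) (at r)"
            by (simp add: mult_ac)
        qed
        then show ?thesis by simp
      qed
      have px: "partial_x (?\<phi> m) = (\<lambda>z. ?\<chi> 0 (fst z) * (?\<kappa> m (Suc 0) (snd z) * G z + Gx z * ?\<kappa> m 0 (snd z)))"
      proof (rule partial_x_eqI)
        fix r x
        have "((\<lambda>y. ?\<chi> 0 r * (?\<kappa> m 0 y * G (r, y))) has_real_derivative ?\<chi> 0 r * (?\<kappa> m (Suc 0) x * G (r, x) + Gx (r, x) * ?\<kappa> m 0 x)) (at x)"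
          by (intro DERIV_cmult DERIV_mult cutoff_has_derivative G_x)
        then show "((\<lambda>y. ?\<phi> m (r, y)) has_real_derivative ?\<chi> 0 (fst (r, x)) * (?\<kappa> m (Suc 0) (snd (r, x)) * G (r, x) + Gx (r, x) * ?\<kappa> m 0 (snd (r, x)))) (at x)"
          by (simp add: mult_ac)
      qed
      have pxx: "partial_x (partial_x (?\<phi> m)) = (\<lambda>z. ?\<chi> 0 (fst z) * (?\<kappa> m (Suc (Suc 0)) (snd z) * G z + Gx z * ?\<kappa> m (Suc 0) (snd z) + (Gxx z * ?\<kappa> m 0 (snd z) + ?\<kappa> m (Suc 0) (snd z) * Gx z)))"
        unfolding px fst_conv snd_conv
        by (intro partial_x_eqI) (auto simp only: fst_conv snd_conv intro!: DERIV_cmult DERIV_add DERIV_mult cutoff_has_derivative G_x G_xx)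
      have "indicator open_strip z *\<^sub>R (- w z * partial_r (?\<phi> m) z
         + poly (pderiv P) (fst z) / 2 * (w z * partial_x (partial_x (?\<phi> m)) z + f z * ?\<phi> m z)) = J m z" for z
      proof (cases "fst z \<in> {t0..T0}")
        case True
        show ?thesis
        proof (cases "z \<in> open_strip")
          case True
          have Gr: "partial_r G z = poly (pderiv P) (fst z) / 2 * Gxx z"
            using G_r[of "fst z" "snd z"] \<open>fst z \<in> {t0..T0}\<close> t01 by auto
          show ?thesis
            using True \<open>fst z \<in> {t0..T0}\<close> unfolding pr pxx Gr J_def by (simp add: algebra_simps)
        next
          case False
          \<comment> \<open>Only time 1 lies in \<open>{t0..T0}\<close> but outside the open strip;
            there both the terminal value of \<open>w\<close> and the time cutoff vanish.\<close>
          then have "fst z = 1" using True t0 by (cases z) (auto simp: open_strip_def)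
          then have "w z = 0" using terminal[of "snd z"] by (cases z) auto
          have "0 \<le> 1 / real n" by simp
          then have "T0 - 1 / real n \<le> fst z" using t0(3) \<open>fst z = 1\<close> by linarith
          then have "?\<chi> 0 (fst z) = 0" using cutoff_eq_0[OF n] by blast
          then show ?thesis using False \<open>w z = 0\<close> by (simp add: J_def)
        qed
      next
        case False
        then have "?\<chi> 0 (fst z) = 0" "?\<chi> (Suc 0) (fst z) = 0" using cutoff_outside[OF n] by auto
        then show ?thesis using False unfolding pr pxx J_def by simp
      qed
      then show ?thesis using weak_eq[OF tf] unfolding set_lebesgue_integral_def by presburger
    qed
    have "(\<lambda>m. LINT z|lborel. J m z) \<longlonglongrightarrow> (LINT z|lborel. - (?\<chi> (Suc 0) (fst z) * F z) + ?\<chi> 0 (fst z) * H z)"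
    proof (rule integral_dominated_convergence)
      let ?B = "X * (K / sqrt \<sigma>) + a_bound * (Y2 * (K / sqrt \<sigma>) + 2 * (Y1 * (K / (\<sigma> * sqrt \<sigma>))) + C * C / sqrt \<sigma>)"
      show "integrable lborel (\<lambda>z. indicator {t0..T0} (fst z) * (?B * D (snd z)))" by (rule dom_int)
      show "AE z in lborel. (\<lambda>m. J m z) \<longlonglongrightarrow> - (?\<chi> (Suc 0) (fst z) * F z) + ?\<chi> 0 (fst z) * H z"
      proof (rule AE_I2, rule tendsto_eventually)
        fix z :: "real \<times> real"
        show "\<forall>\<^sub>F m in sequentially. J m z = - (?\<chi> (Suc 0) (fst z) * F z) + ?\<chi> 0 (fst z) * H z"
        proof (rule eventually_mono[OF eventually_ge_at_top[of "nat \<lceil>\<bar>snd z\<bar>\<rceil>"]])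
          fix m assume "nat \<lceil>\<bar>snd z\<bar>\<rceil> \<le> m"
          then have m: "\<bar>snd z\<bar> \<le> real m" by linarith
          have "?\<kappa> m 0 (snd z) = 1" using m by (intro cutoff_eq_1) auto
          moreover have "?\<kappa> m (Suc k) (snd z) = 0" for k
            using m smooth_step_Suc_ge_1[of "1 * (snd z - (- real m - 1))" k] smooth_step_Suc_ge_1[of "1 * (real m + 2 - snd z) - 1" k]
            by (simp add: cutoff_def)
          ultimately show "J m z = - (?\<chi> (Suc 0) (fst z) * F z) + ?\<chi> 0 (fst z) * H z"
            unfolding J_def F_def H_eq by (simp add: algebra_simps)
        qed
      qed
      show "AE z in lborel. norm (J m z) \<le> indicator {t0..T0} (fst z) * (?B * D (snd z))" for m
      proof (rule AE_I2)
        fix z :: "real \<times> real"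
        show "norm (J m z) \<le> indicator {t0..T0} (fst z) * (?B * D (snd z))"
        proof (cases "fst z \<in> {t0..T0}")
          case True
          then have z: "fst z \<in> {t0..1}" using t01 by auto
          have b1: "\<bar>w z * G z\<bar> \<le> K / sqrt \<sigma> * D (snd z)" "\<bar>w z * Gx z\<bar> \<le> K / (\<sigma> * sqrt \<sigma>) * D (snd z)" "\<bar>f z * G z\<bar> \<le> C * C / sqrt \<sigma> * D (snd z)"
            using wG[OF z, of "snd z"] wGx[OF z, of "snd z"] fG[OF z, of "snd z"] by auto
          have "\<bar>?\<chi> (Suc 0) (fst z) * ?\<kappa> m 0 (snd z) * (w z * G z)\<bar> \<le> X * 1 * (K / sqrt \<sigma> * D (snd z))"
            unfolding abs_mult[of "_ * _"] abs_mult[of "cutoff _ _ _ _ _"] using XY0 b1(1) by (intro mult_mono X cutoff_bounds) auto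
          moreover have "\<bar>?\<kappa> m (Suc (Suc 0)) (snd z) * (w z * G z)\<bar> \<le> Y2 * (K / sqrt \<sigma> * D (snd z))"
            unfolding abs_mult[of "cutoff _ _ _ _ _"] using XY0 b1(1) by (intro mult_mono Y2) auto
          moreover have "\<bar>2 * ?\<kappa> m (Suc 0) (snd z) * (w z * Gx z)\<bar> \<le> 2 * Y1 * (K / (\<sigma> * sqrt \<sigma>) * D (snd z))"
            unfolding abs_mult[of "_ * _"] abs_mult[of "2"] using XY0 b1(2) Y1[of m "snd z"] by (intro mult_mono) auto
          moreover have "\<bar>?\<kappa> m 0 (snd z) * (f z * G z)\<bar> \<le> 1 * (C * C / sqrt \<sigma> * D (snd z))"
            unfolding abs_mult[of "cutoff _ _ _ _ _"] using XY0 b1(3) by (intro mult_mono cutoff_bounds) auto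
          ultimately have A: "\<bar>- (?\<chi> (Suc 0) (fst z) * ?\<kappa> m 0 (snd z) * (w z * G z))\<bar> \<le> X * (K / sqrt \<sigma> * D (snd z))"
            and B: "\<bar>?\<kappa> m (Suc (Suc 0)) (snd z) * (w z * G z) + 2 * ?\<kappa> m (Suc 0) (snd z) * (w z * Gx z) + ?\<kappa> m 0 (snd z) * (f z * G z)\<bar>
              \<le> Y2 * (K / sqrt \<sigma> * D (snd z)) + 2 * Y1 * (K / (\<sigma> * sqrt \<sigma>) * D (snd z)) + C * C / sqrt \<sigma> * D (snd z)" (is "\<bar>?S\<bar> \<le> ?R")
            by linarith+
          have "\<bar>?\<chi> 0 (fst z) * ?S\<bar> \<le> 1 * ?R"
            unfolding abs_mult[of "cutoff _ _ _ _ _"] by (intro mult_mono cutoff_bounds B) auto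
          then have "\<bar>poly (pderiv P) (fst z) / 2 * (?\<chi> 0 (fst z) * ?S)\<bar> \<le> a_bound * ?R"
            by (intro aw z) simp
          then have "\<bar>J m z\<bar> \<le> X * (K / sqrt \<sigma> * D (snd z)) + a_bound * ?R"
            using A True unfolding J_def by (simp only: indicator_simps mult_1)
          also have "\<dots> = ?B * D (snd z)" by (simp only: distrib_right distrib_left mult.assoc)
          finally show ?thesis using True by simp
        qed (simp add: J_def)
      qed
      show "(\<lambda>z. - (?\<chi> (Suc 0) (fst z) * F z) + ?\<chi> 0 (fst z) * H z) \<in> borel_measurable lborel"
        using cm by measurable
      show "J m \<in> borel_measurable lborel" for m
        unfolding J_def using cm by measurable
    qed
    then have "(LINT z|lborel. - (?\<chi> (Suc 0) (fst z) * F z) + ?\<chi> 0 (fst z) * H z) = 0"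
      unfolding J_0 using LIMSEQ_unique by blast
    moreover have i1: "integrable lborel (\<lambda>z. ?\<chi> (Suc 0) (fst z) * F z)" and i2: "integrable lborel (\<lambda>z. ?\<chi> 0 (fst z) * H z)"
      by (rule bdd_mult[OF _ X] bdd_mult[OF _ cutoff_bounds], measurable)+
    ultimately have "(LINT z|lborel. ?\<chi> (Suc 0) (fst z) * F z) = (LINT z|lborel. ?\<chi> 0 (fst z) * H z)"
      by (simp add: Bochner_Integration.integral_add[OF Bochner_Integration.integrable_minus[OF i1] i2])
    then show ?thesis
      unfolding integral_lborel_prod(1)[OF i1] integral_lborel_prod(1)[OF i2] fst_conv integral_mult_right_zero F_x h_def .
  qed
  \<comment> \<open>Continuity up to the endpoints provides the one-sided limits of \<Phi> that the
    differentiated time cutoff picks out.\<close>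
  have \<Phi>_cont: "continuous_on {t0..T0} (\<lambda>t. LINT x|lborel. w (t, x) * G (t, x))"
  proof (rule continuous_on_sequentiallyI)
    fix u :: "nat \<Rightarrow> real" and a assume u: "\<forall>n. u n \<in> {t0..T0}" and a: "a \<in> {t0..T0}" and lim: "u \<longlonglongrightarrow> a"
    show "(\<lambda>n. LINT x|lborel. w (u n, x) * G (u n, x)) \<longlonglongrightarrow> (LINT x|lborel. w (a, x) * G (a, x))"
    proof (rule integral_dominated_convergence)
      show "integrable lborel (\<lambda>x. K / sqrt \<sigma> * D x)" using D_int by simp
      show "AE x in lborel. norm (w (u n, x) * G (u n, x)) \<le> K / sqrt \<sigma> * D x" for n
      proof -
        have "u n \<in> {t0..1}" using u t01 by blast
        then show ?thesis unfolding real_norm_def by (intro AE_I2 wG)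
      qed
      show "AE x in lborel. (\<lambda>n. w (u n, x) * G (u n, x)) \<longlonglongrightarrow> w (a, x) * G (a, x)"
      proof (intro AE_I2 tendsto_mult)
        fix x
        have "u n \<in> {0..1}" for n using u t01 by blast
        moreover have "a \<in> {0..1}" using a t01 by blast
        ultimately show "(\<lambda>n. w (u n, x)) \<longlonglongrightarrow> w (a, x)"
          using w_cont_t[of x] lim unfolding continuous_on_sequentially comp_def by blast
        show "(\<lambda>n. G (u n, x)) \<longlonglongrightarrow> G (a, x)"
          using smooth2_continuous[OF G_smooth] lim
          by (auto simp: continuous_on_eq_continuous_at isCont_def intro!: isCont_tendsto_compose[of _ G] tendsto_Pair)
      qed
    qed measurable
  qed
  have \<Phi>_bound: "\<bar>\<Phi> t\<bar> \<le> (LINT x|lborel. K / sqrt \<sigma> * D x)" for t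
  proof (cases "t \<in> {t0..T0}")
    case True
    then have "t \<in> {t0..1}" using t01 by auto
    then have "\<bar>LINT x|lborel. w (t, x) * G (t, x)\<bar> \<le> (LINT x|lborel. K / sqrt \<sigma> * D x)"
      by (intro integral_abs_bound_integral wG_int wG integrable_mult_right D_int)
    then show ?thesis using True by (simp add: \<Phi>_def)
  next
    case False
    have "0 \<le> (LINT x|lborel. K / sqrt \<sigma> * D x)"
      using K(1) \<sigma> D_nonneg by (intro Bochner_Integration.integral_nonneg mult_nonneg_nonneg) auto
    then show ?thesis using False by (simp add: \<Phi>_def)
  qed
  have "((\<lambda>t. LINT x|lborel. w (t, x) * G (t, x)) \<longlongrightarrow> (LINT x|lborel. w (t0, x) * G (t0, x))) (at_right t0)"
    by (rule continuous_on_Icc_at_rightD[OF \<Phi>_cont t0(2)])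
  moreover have "\<forall>\<^sub>F t in at_right t0. (LINT x|lborel. w (t, x) * G (t, x)) = \<Phi> t"
    by (rule eventually_at_rightI[OF _ t0(2)]) (auto simp: \<Phi>_def)
  ultimately have R: "(\<Phi> \<longlongrightarrow> (LINT x|lborel. w (t0, x) * G (t0, x))) (at_right t0)"
    by (rule Lim_transform_eventually)
  have "((\<lambda>t. LINT x|lborel. w (t, x) * G (t, x)) \<longlongrightarrow> (LINT x|lborel. w (T0, x) * G (T0, x))) (at_left T0)"
    by (rule continuous_on_Icc_at_leftD[OF \<Phi>_cont t0(2)])
  moreover have "\<forall>\<^sub>F t in at_left T0. (LINT x|lborel. w (t, x) * G (t, x)) = \<Phi> t"
    by (rule eventually_at_leftI[OF _ t0(2)]) (auto simp: \<Phi>_def)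
  ultimately have L: "(\<Phi> \<longlongrightarrow> (LINT x|lborel. w (T0, x) * G (T0, x))) (at_left T0)"
    by (rule Lim_transform_eventually)
  have "(\<lambda>n. LINT t|lborel. cutoff n t0 T0 (Suc 0) t * \<Phi> t) \<longlonglongrightarrow> (LINT x|lborel. w (t0, x) * G (t0, x)) - (LINT x|lborel. w (T0, x) * G (T0, x))"
    by (rule cutoff_Suc_0_tendsto[OF \<Phi>_meas \<Phi>_bound R L])
  moreover have "\<forall>\<^sub>F n in sequentially. 2 \<le> real n * (T0 - t0)"
    using t0(2) by real_asymp
  then have "\<forall>\<^sub>F n in sequentially. (LINT t|lborel. cutoff n t0 T0 (Suc 0) t * \<Phi> t) = (LINT t|lborel. cutoff n t0 T0 0 t * h t)"
    by (rule eventually_mono) (rule key)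
  ultimately have "(\<lambda>n. LINT t|lborel. cutoff n t0 T0 0 t * h t) \<longlonglongrightarrow> (LINT x|lborel. w (t0, x) * G (t0, x)) - (LINT x|lborel. w (T0, x) * G (T0, x))"
    by (rule Lim_transform_eventually)
  from LIMSEQ_unique[OF this cutoff_0_tendsto[OF h_int t0(2)]]
  have "(LINT x|lborel. w (t0, x) * G (t0, x)) - (LINT x|lborel. w (T0, x) * G (T0, x)) = (LINT t:{t0<..<T0}|lborel. h t)" .
  also have "\<dots> = (LINT t|lborel. h t)"
    unfolding set_lebesgue_integral_def real_scaleR_def
  proof (rule integral_cong_AE)
    have h0: "h t = 0" if "t \<notin> {t0..T0}" for t using that by (simp add: h_def H_eq)
    show "AE t in lborel. indicator {t0<..<T0} t * h t = h t"
      using AE_lborel_singleton[of t0] AE_lborel_singleton[of T0]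
    proof eventually_elim
      case (elim t)
      then show ?case by (cases "t \<in> {t0..T0}") (simp_all add: h0)
    qed
  qed (use h_int in auto)
  also have "\<dots> = (LINT z|lborel. H z)" unfolding h_def by (rule integral_lborel_prod(1)[OF H_int, symmetric])
  finally show "(LINT x|lborel. w (t0, x) * heat \<sigma> (x - c)) = (LINT z|lborel. H z)"
    by (simp add: wT G_t0)
qed

section \<open>Contraction on short time slabs and backward continuation\<close>

lemma heat_approximate_identity:
  assumes "0 < t0" "t0 < 1"
  shows "(\<lambda>n. LINT x|lborel. w (t0, x) * heat (1 / (real (Suc n))\<^sup>2) (x - c)) \<longlonglongrightarrow> sqrt (2 * pi) * w (t0, c)"
proof -
  obtain K where K: "K \<ge> 0" "\<And>t x. t \<in> {t0..1} \<Longrightarrow> \<bar>w (t, x)\<bar> \<le> K * (1 + \<bar>x\<bar>)"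
    using w_linear_growth assms by auto
  have eq: "(LINT x|lborel. w (t0, x) * heat (1 / (real (Suc n))\<^sup>2) (x - c)) = (LINT y|lborel. w (t0, c + (1 / real (Suc n)) * y) * heat 1 y)" for n
  proof -
    \<comment> \<open>The variance 1/(n+1)^2 has a rational square root, so the substitution x = c +
      y/(n+1) turns the kernel into the fixed kernel \<open>heat 1\<close>.\<close>
    have h: "(1 / real (Suc n)) * heat (1 / (real (Suc n))\<^sup>2) ((1 / real (Suc n)) * y) = heat 1 y" for y
      by (simp add: heat_def real_sqrt_divide power_divide power_mult_distrib del: of_nat_Suc)
    have "\<bar>1 / real (Suc n)\<bar> * (w (t0, c + (1 / real (Suc n)) * y) * heat (1 / (real (Suc n))\<^sup>2) (c + (1 / real (Suc n)) * y - c)) = w (t0, c + (1 / real (Suc n)) * y) * heat 1 y" for y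
      unfolding h[of y, symmetric] by (simp del: of_nat_Suc)
    then show ?thesis
      by (subst lborel_integral_real_affine[where c="1 / real (Suc n)" and t=c])
         (simp_all only: integral_mult_right_zero[symmetric] real_scaleR_def, auto)
  qed
  have "(\<lambda>n. LINT y|lborel. w (t0, c + (1 / real (Suc n)) * y) * heat 1 y) \<longlonglongrightarrow> (LINT y|lborel. w (t0, c) * heat 1 y)"
  proof (rule integral_dominated_convergence)
    show "integrable lborel (\<lambda>y. K * (1 + \<bar>c\<bar>) * ((1 + \<bar>y\<bar>) * (1 + \<bar>y - 0\<bar>) * exp (- (y - 0)\<^sup>2 / (2 * 1))))"
      by (intro integrable_mult_right integrable_gaussian_weight) simp
    show "AE y in lborel. (\<lambda>n. w (t0, c + (1 / real (Suc n)) * y) * heat 1 y) \<longlonglongrightarrow> w (t0, c) * heat 1 y"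
    proof (intro AE_I2 tendsto_mult tendsto_const)
      fix y :: real
      have "(\<lambda>n. c + (1 / real (Suc n)) * y) \<longlonglongrightarrow> c" by real_asymp
      moreover have "isCont (\<lambda>x. w (t0, x)) c"
        using w_cont_x[of t0 UNIV] assms by (simp add: continuous_on_eq_continuous_at)
      ultimately show "(\<lambda>n. w (t0, c + (1 / real (Suc n)) * y)) \<longlonglongrightarrow> w (t0, c)"
        by (rule isCont_tendsto_compose[rotated])
    qed
    show "AE y in lborel. norm (w (t0, c + (1 / real (Suc n)) * y) * heat 1 y) \<le> K * (1 + \<bar>c\<bar>) * ((1 + \<bar>y\<bar>) * (1 + \<bar>y - 0\<bar>) * exp (- (y - 0)\<^sup>2 / (2 * 1)))" for n
    proof (rule AE_I2)
      fix y
      have "\<bar>(1 / real (Suc n)) * y\<bar> \<le> 1 * \<bar>y\<bar>" unfolding abs_mult by (intro mult_right_mono) auto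
      then have "1 + \<bar>c + (1 / real (Suc n)) * y\<bar> \<le> 1 + \<bar>c\<bar> + \<bar>y\<bar>" by linarith
      also have "\<dots> \<le> (1 + \<bar>c\<bar>) * (1 + \<bar>y\<bar>)" by (simp add: algebra_simps)
      also have "\<dots> \<le> (1 + \<bar>c\<bar>) * ((1 + \<bar>y\<bar>) * (1 + \<bar>y\<bar>))" by (intro mult_left_mono) (auto simp: algebra_simps)
      finally have "\<bar>w (t0, c + (1 / real (Suc n)) * y)\<bar> \<le> K * ((1 + \<bar>c\<bar>) * ((1 + \<bar>y\<bar>) * (1 + \<bar>y\<bar>)))"
        using K(2)[of t0 "c + (1 / real (Suc n)) * y"] K(1) assms by (auto intro: order_trans mult_left_mono)
      then have "\<bar>w (t0, c + (1 / real (Suc n)) * y)\<bar> * heat 1 y \<le> K * ((1 + \<bar>c\<bar>) * ((1 + \<bar>y\<bar>) * (1 + \<bar>y\<bar>))) * heat 1 y"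
        by (intro mult_right_mono heat_nonneg) auto
      then show "norm (w (t0, c + (1 / real (Suc n)) * y) * heat 1 y) \<le> K * (1 + \<bar>c\<bar>) * ((1 + \<bar>y\<bar>) * (1 + \<bar>y - 0\<bar>) * exp (- (y - 0)\<^sup>2 / (2 * 1)))"
        by (simp add: abs_mult heat_def mult_ac)
    qed
  qed measurable
  also have "(LINT y|lborel. w (t0, c) * heat 1 y) = sqrt (2 * pi) * w (t0, c)"
    using heat_integral(2)[of 1 0] by simp
  finally show ?thesis unfolding eq .
qed

text \<open>Subtracting Duhamel's formula for the centres \<open>c\<close> and \<open>c'\<close>
  leaves a difference of kernels. With |f| \<le> C M and the L^1 estimate, the time integral is that
  of \<tau>' / sqrt \<tau>, namely twice an increment of sqrt \<tau>. Finally \<sigma> tends to 0,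
  and the kernels select the values of \<open>w\<close> at \<open>c\<close> and
  \<open>c'\<close>.\<close>

lemma lipschitz_improvement:
  assumes t0: "0 < t0" "t0 < T0" "T0 \<le> 1" and wT: "\<And>x. w (T0, x) = 0" and M: "M \<ge> 0"
    and d: "AE z in lborel. fst z \<in> {t0..T0} \<longrightarrow> \<bar>d z\<bar> \<le> M"
  shows "sqrt (2 * pi) * \<bar>w (t0, c) - w (t0, c')\<bar> \<le> 2 * C * M * \<bar>c - c'\<bar> * sqrt (poly P T0 - poly P t0)"
proof -
  have bound: "\<bar>(LINT x|lborel. w (t0, x) * heat \<sigma> (x - c)) - (LINT x|lborel. w (t0, x) * heat \<sigma> (x - c'))\<bar>
     \<le> 2 * C * M * \<bar>c - c'\<bar> * sqrt (poly P T0 - poly P t0)" if \<sigma>: "\<sigma> > 0" for \<sigma>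
  proof -
    define \<tau> where "\<tau> = (\<lambda>t. \<sigma> + poly P t - poly P t0)"
    define H where "H = (\<lambda>c z. indicator {t0..T0} (fst z) * (poly (pderiv P) (fst z) / 2 * f z * heat (\<tau> (fst z)) (snd z - c)))"
    have H_int: "integrable lborel (H c)" for c
      using duhamel(2)[OF t0 \<sigma> wT] unfolding H_def \<tau>_def .
    have \<tau>_pos: "\<tau> t \<ge> \<sigma>" if "t \<in> {t0..T0}" for t
      using A_le[of t0 t] that t0 by (auto simp: \<tau>_def)
    have \<tau>_deriv: "(\<tau> has_real_derivative poly (pderiv P) t) (at t)" for t
      unfolding \<tau>_def by (auto intro!: derivative_eq_intros poly_DERIV)
    let ?g = "\<lambda>t. C * M * (poly (pderiv P) t * (\<bar>c - c'\<bar> / sqrt (\<tau> t)))"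
    have g: "has_bochner_integral lborel (\<lambda>t. ?g t * indicator {t0..T0} t)
       (2 * C * M * \<bar>c - c'\<bar> * sqrt (\<tau> T0) - 2 * C * M * \<bar>c - c'\<bar> * sqrt (\<tau> t0))"
    proof (rule has_bochner_integral_FTC_Icc_real)
      fix t assume "t0 \<le> t" "t \<le> T0"
      then have pos: "\<tau> t > 0" using \<tau>_pos[of t] \<sigma> by auto
      show "((\<lambda>t. 2 * C * M * \<bar>c - c'\<bar> * sqrt (\<tau> t)) has_real_derivative ?g t) (at t)"
        using pos by (auto intro!: derivative_eq_intros \<tau>_deriv simp: field_simps)
      have "isCont \<tau> t" using \<tau>_deriv DERIV_isCont by blast
      then show "isCont ?g t" using pos by (intro continuous_intros) auto
    qed (use t0 in simp)
    have inner: "AE t in lborel. \<bar>LINT x|lborel. H c (t, x) - H c' (t, x)\<bar> \<le> ?g t * indicator {t0..T0} t"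
    proof -
      have "AE z in lborel \<Otimes>\<^sub>M lborel. fst z \<in> {t0..T0} \<longrightarrow> \<bar>d z\<bar> \<le> M" by (subst lborel_prod) (rule d)
      then have "AE t in lborel. AE x in lborel. fst (t, x) \<in> {t0..T0} \<longrightarrow> \<bar>d (t, x)\<bar> \<le> M"
        by (rule lborel_pair.AE_pair)
      then show ?thesis
      proof eventually_elim
        case (elim t)
        show ?case
        proof (cases "t \<in> {t0..T0}")
          case True
          then have pos: "\<tau> t > 0" using \<tau>_pos[of t] \<sigma> by auto
          have a: "poly (pderiv P) t \<ge> 0" using A_mono[of t] True t0 by auto
          have di: "integrable lborel (\<lambda>x. \<bar>heat (\<tau> t) (x - c) - heat (\<tau> t) (x - c')\<bar>)"
            by (intro integrable_abs Bochner_Integration.integrable_diff heat_integral pos)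
          have "\<bar>LINT x|lborel. H c (t, x) - H c' (t, x)\<bar> \<le> (LINT x|lborel. \<bar>H c (t, x) - H c' (t, x)\<bar>)"
            by (rule integral_abs_bound)
          also have "\<dots> \<le> (LINT x|lborel. poly (pderiv P) t / 2 * (C * M) * \<bar>heat (\<tau> t) (x - c) - heat (\<tau> t) (x - c')\<bar>)"
          proof (rule integral_mono_AE')
            show "integrable lborel (\<lambda>x. poly (pderiv P) t / 2 * (C * M) * \<bar>heat (\<tau> t) (x - c) - heat (\<tau> t) (x - c')\<bar>)"
              using di by simp
            show "AE x in lborel. \<bar>H c (t, x) - H c' (t, x)\<bar> \<le> poly (pderiv P) t / 2 * (C * M) * \<bar>heat (\<tau> t) (x - c) - heat (\<tau> t) (x - c')\<bar>"
              using elim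
            proof eventually_elim
              case (elim x)
              then have "\<bar>f (t, x)\<bar> \<le> C * M"
                using f_bound[of "(t, x)"] True C_nonneg mult_left_mono[of "\<bar>d (t, x)\<bar>" M C] by auto
              moreover have "H c (t, x) - H c' (t, x) = poly (pderiv P) t / 2 * (f (t, x) * (heat (\<tau> t) (x - c) - heat (\<tau> t) (x - c')))"
                using True by (simp add: H_def algebra_simps)
              ultimately show ?case
                using a unfolding \<open>H c (t, x) - _ = _\<close> abs_mult mult.assoc[of _ "C * M"]
                by (intro mult_mono mult_right_mono) auto
            qed
            show "AE x in lborel. 0 \<le> poly (pderiv P) t / 2 * (C * M) * \<bar>heat (\<tau> t) (x - c) - heat (\<tau> t) (x - c')\<bar>"
              using a C_nonneg M by simp
          qed
          also have "\<dots> = poly (pderiv P) t / 2 * (C * M) * (LINT x|lborel. \<bar>heat (\<tau> t) (x - c) - heat (\<tau> t) (x - c')\<bar>)"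
            by simp
          also have "\<dots> \<le> poly (pderiv P) t / 2 * (C * M) * (2 * \<bar>c - c'\<bar> / sqrt (\<tau> t))"
            using a C_nonneg M by (intro mult_left_mono heat_L1_diff pos) auto
          also have "\<dots> = ?g t * indicator {t0..T0} t" using True by simp
          finally show ?thesis .
        qed (simp add: H_def)
      qed
    qed
    have i12: "integrable lborel (\<lambda>z. H c z - H c' z)" by (intro Bochner_Integration.integrable_diff H_int)
    have "(LINT x|lborel. w (t0, x) * heat \<sigma> (x - c)) - (LINT x|lborel. w (t0, x) * heat \<sigma> (x - c')) = (LINT z|lborel. H c z - H c' z)"
    proof -
      have "(LINT x|lborel. w (t0, x) * heat \<sigma> (x - c)) = (LINT z|lborel. H c z)" for c
        using duhamel(3)[OF t0 \<sigma> wT] unfolding H_def \<tau>_def .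
      then show ?thesis by (simp add: Bochner_Integration.integral_diff[OF H_int H_int])
    qed
    also have "\<dots> = (LINT t|lborel. LINT x|lborel. H c (t, x) - H c' (t, x))"
      by (rule integral_lborel_prod(1)[OF i12])
    also have "\<bar>\<dots>\<bar> \<le> (LINT t|lborel. \<bar>LINT x|lborel. H c (t, x) - H c' (t, x)\<bar>)" by (rule integral_abs_bound)
    also have "\<dots> \<le> (LINT t|lborel. ?g t * indicator {t0..T0} t)"
      using g inner by (intro integral_mono_AE integrable_abs integral_lborel_prod(2)[OF i12]) (auto simp: has_bochner_integral_iff)
    also have "\<dots> = 2 * C * M * \<bar>c - c'\<bar> * (sqrt (\<tau> T0) - sqrt (\<tau> t0))"
      using g by (simp add: has_bochner_integral_iff right_diff_distrib)
    \<comment> \<open>Subadditivity of the square root removes \<sigma> from the bound, as the limit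
      requires.\<close>
    also have "\<dots> \<le> 2 * C * M * \<bar>c - c'\<bar> * sqrt (poly P T0 - poly P t0)"
    proof (rule mult_left_mono)
      have "sqrt (\<tau> T0) \<le> sqrt \<sigma> + sqrt (poly P T0 - poly P t0)"
        using sqrt_add_le_add_sqrt[of \<sigma> "poly P T0 - poly P t0"] A_le[of t0 T0] t0 \<sigma>
        by (simp add: \<tau>_def add_diff_eq)
      then show "sqrt (\<tau> T0) - sqrt (\<tau> t0) \<le> sqrt (poly P T0 - poly P t0)" by (simp add: \<tau>_def)
    qed (use C_nonneg M in auto)
    finally show ?thesis .
  qed
  have "t0 < 1" using t0 by auto
  from tendsto_rabs[OF tendsto_diff[OF heat_approximate_identity[OF t0(1) this, of c] heat_approximate_identity[OF t0(1) this, of c']]]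
  have "\<bar>sqrt (2 * pi) * w (t0, c) - sqrt (2 * pi) * w (t0, c')\<bar> \<le> 2 * C * M * \<bar>c - c'\<bar> * sqrt (poly P T0 - poly P t0)"
    by (rule tendsto_upperbound) (auto intro!: always_eventually bound)
  then show ?thesis by (simp add: abs_mult flip: right_diff_distrib)
qed

text \<open>The hypothesis \<open>short\<close> makes the gain in
  \<open>lipschitz_improvement\<close> at most 1/2, so the bound on \<open>d\<close> can be halved
  indefinitely. Then the source vanishes almost everywhere on the slab, and Duhamel's formula with
  shrinking kernels gives \<open>w = 0\<close>.\<close>

lemma zero_on_short_slab:
  assumes s: "0 < s" "s < T0" "T0 \<le> 1" and wT: "\<And>x. w (T0, x) = 0"
    and short: "4 * C * sqrt (poly P T0 - poly P s) \<le> sqrt (2 * pi)"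
    and t: "t \<in> {s<..<T0}"
  shows "w (t, x) = 0"
proof -
  have half: "AE z in lborel. fst z \<in> {s<..<T0} \<longrightarrow> \<bar>d z\<bar> \<le> C / 2 ^ n" for n
  proof (induction n)
    case 0
    show ?case using d_bound by simp
  next
    case (Suc n)
    show ?case
    proof (rule derivative_bound_of_lipschitz[OF s])
      fix t x1 x2 :: real assume t: "t \<in> {s<..<T0}" and x: "x1 < x2"
      have "AE z in lborel. fst z \<in> {t..T0} \<longrightarrow> \<bar>d z\<bar> \<le> C / 2 ^ n"
      proof -
        show ?thesis using AE_fst_neq[of T0] Suc by eventually_elim (use t in auto)
      qed
      then have "sqrt (2 * pi) * \<bar>w (t, x2) - w (t, x1)\<bar> \<le> 2 * C * (C / 2 ^ n) * \<bar>x2 - x1\<bar> * sqrt (poly P T0 - poly P t)"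
        using s t C_nonneg by (intro lipschitz_improvement wT) auto
      also have "\<dots> = (2 * C * sqrt (poly P T0 - poly P t)) * (C / 2 ^ n * (x2 - x1))" using x by simp
      also have "\<dots> \<le> (sqrt (2 * pi) / 2) * (C / 2 ^ n * (x2 - x1))"
      proof (rule mult_right_mono)
        have "sqrt (poly P T0 - poly P t) \<le> sqrt (poly P T0 - poly P s)" using A_le[of s t] s t by auto
        from mult_left_mono[OF this C_nonneg] show "2 * C * sqrt (poly P T0 - poly P t) \<le> sqrt (2 * pi) / 2"
          using short by linarith
      qed (use C_nonneg x in auto)
      also have "\<dots> = sqrt (2 * pi) * (C / 2 ^ Suc n * (x2 - x1))" by simp
      finally show "\<bar>w (t, x2) - w (t, x1)\<bar> \<le> C / 2 ^ Suc n * (x2 - x1)"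
        by (rule mult_left_le_imp_le) simp
    qed
  qed
  have "AE z in lborel. \<forall>n. fst z \<in> {s<..<T0} \<longrightarrow> \<bar>d z\<bar> \<le> C / 2 ^ n"
    unfolding AE_all_countable using half by blast
  then have f0: "AE z in lborel. fst z \<in> {s<..<T0} \<longrightarrow> f z = 0"
  proof eventually_elim
    case (elim z)
    show ?case
    proof
      assume z: "fst z \<in> {s<..<T0}"
      have "(\<lambda>n. C / 2 ^ n) \<longlonglongrightarrow> 0" by real_asymp
      then have "\<bar>d z\<bar> \<le> 0" by (rule tendsto_lowerbound) (use elim z in \<open>auto intro!: always_eventually\<close>)
      then show "f z = 0" using f_bound[of z] by simp
    qed
  qed
  have t': "0 < t" "t < T0" "t < 1" using s t by auto
  have "(LINT y|lborel. w (t, y) * heat (1 / (real (Suc n))\<^sup>2) (y - x)) = 0" for n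
  proof -
    have \<sigma>: "1 / (real (Suc n))\<^sup>2 > 0" by simp
    have "(LINT y|lborel. w (t, y) * heat (1 / (real (Suc n))\<^sup>2) (y - x)) = (LINT z|lborel. indicator {t..T0} (fst z) * (poly (pderiv P) (fst z) / 2 * f z * heat (1 / (real (Suc n))\<^sup>2 + poly P (fst z) - poly P t) (snd z - x)))"
      by (rule duhamel(3)[OF t'(1,2) s(3) \<sigma> wT])
    also have "\<dots> = 0"
    proof (rule integral_eq_zero_AE)
      show "AE z in lborel. indicator {t..T0} (fst z) * (poly (pderiv P) (fst z) / 2 * f z * heat (1 / (real (Suc n))\<^sup>2 + poly P (fst z) - poly P t) (snd z - x)) = 0"
        using AE_fst_neq[of T0] f0 by eventually_elim (use t in \<open>auto simp: indicator_def\<close>)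
    qed
    finally show ?thesis .
  qed
  with heat_approximate_identity[OF t'(1,3), of x] have "sqrt (2 * pi) * w (t, x) = 0"
    by (simp add: LIMSEQ_const_iff)
  then show ?thesis by simp
qed

text \<open>Continuation backwards from time 1: the set of times from which on \<open>w\<close>
  vanishes contains its infimum by continuity, and a positive infimum could be lowered by a short
  slab, since \<open>P\<close> is continuous. The same closure argument reaches time 0.\<close>

theorem w_eq_0: "w z = 0"
proof -
  define S where "S = {T\<in>{0..1}. \<forall>t\<in>{T..1}. \<forall>x. w (t, x) = 0}"
  define T where "T = Inf S"
  have S1: "1 \<in> S" using terminal by (auto simp: S_def)
  have bdd: "bdd_below S" by (rule bdd_belowI[of _ 0]) (auto simp: S_def)
  have T01: "0 \<le> T" "T \<le> 1"
  proof -
    have "S \<noteq> {}" using S1 by auto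
    then show "0 \<le> T" unfolding T_def by (rule cInf_greatest) (simp add: S_def)
    show "T \<le> 1" unfolding T_def by (rule cInf_lower[OF S1 bdd])
  qed
  have after: "w (t, x) = 0" if t: "T < t" "t \<le> 1" for t x
  proof -
    have "S \<noteq> {}" using S1 by auto
    from cInf_lessD[OF this t(1)[unfolded T_def]] obtain s where "s \<in> S" "s < t" by blast
    then show ?thesis using t by (auto simp: S_def)
  qed
  have at: "w (T, x) = 0" for x
  proof (cases "T = 1")
    case False
    then have "T < 1" using T01 by simp
    have "continuous_on {T..1} (\<lambda>t. w (t, x))"
      by (rule continuous_on_subset[OF w_cont_t]) (use T01 in auto)
    then have "((\<lambda>t. w (t, x)) \<longlongrightarrow> w (T, x)) (at_right T)" using \<open>T < 1\<close> by (rule continuous_on_Icc_at_rightD)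
    moreover have "\<forall>\<^sub>F t in at_right T. w (t, x) = 0"
      by (rule eventually_at_rightI[OF _ \<open>T < 1\<close>]) (use after in auto)
    ultimately show ?thesis using tendsto_eventually tendsto_unique trivial_limit_at_right_real by metis
  qed (simp add: terminal)
  have T_S: "T \<in> S"
  proof -
    have "\<forall>t\<in>{T..1}. \<forall>x. w (t, x) = 0" using after at by (metis atLeastAtMost_iff le_less)
    then show ?thesis using T01 unfolding S_def by simp
  qed
  have "T = 0"
  proof (rule ccontr)
    assume "T \<noteq> 0"
    then have "T > 0" using T01 by simp
    have "isCont (\<lambda>s. 4 * C * sqrt (poly P T - poly P s)) T" by (intro continuous_intros)
    then have "((\<lambda>s. 4 * C * sqrt (poly P T - poly P s)) \<longlongrightarrow> 0) (at_left T)"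
      by (auto simp: isCont_def intro: tendsto_within_subset)
    then have "\<forall>\<^sub>F s in at_left T. 4 * C * sqrt (poly P T - poly P s) < sqrt (2 * pi)"
      by (rule order_tendstoD) simp
    moreover have "\<forall>\<^sub>F s in at_left T. s \<in> {0<..<T}"
      using \<open>T > 0\<close> by (rule eventually_at_leftI[rotated]) auto
    ultimately have "\<forall>\<^sub>F s in at_left T. s \<in> {0<..<T} \<and> 4 * C * sqrt (poly P T - poly P s) < sqrt (2 * pi)"
      by eventually_elim auto
    then obtain s where s: "0 < s" "s < T" "4 * C * sqrt (poly P T - poly P s) < sqrt (2 * pi)"
      using eventually_happens'[OF trivial_limit_at_left_real] by auto
    have slab: "w (t, x) = 0" if "t \<in> {s<..<T}" for t x
      by (rule zero_on_short_slab[OF s(1,2) T01(2) at less_imp_le[OF s(3)] that])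
    \<comment> \<open>The slab is open at \<open>s\<close>, so the midpoint serves as a strictly
      smaller element of \<open>S\<close>.\<close>
    have "w (t, x) = 0" if "t \<in> {(s + T) / 2..1}" for t x
    proof (cases "t < T")
      case True
      then show ?thesis using that s(2) by (intro slab) (auto simp: field_simps)
    next
      case False
      then show ?thesis using T_S that by (auto simp: S_def)
    qed
    then have "(s + T) / 2 \<in> S" using s T01 unfolding S_def by auto
    then have "T \<le> (s + T) / 2" unfolding T_def using bdd by (rule cInf_lower)
    then show False using s by simp
  qed
  then show ?thesis
    using T_S w_outside[of z] by (cases "z \<in> closed_strip"; cases z) (auto simp: S_def closed_strip_def)
qed

end

section \<open>Uniqueness of weak solutions\<close>

lemma has_real_derivative_0_if_locally_0:
  assumes "(f has_real_derivative D) (at x)" "open S" "x \<in> S" "\<And>y. y \<in> S \<Longrightarrow> f y = (0 :: real)"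
  shows "D = 0"
proof -
  have "\<forall>\<^sub>F y in nhds x. f y = 0"
    using eventually_nhds_in_open[OF assms(2,3)] by (rule eventually_mono) (rule assms(4))
  then have "(f has_real_derivative 0) (at x)"
    by (subst DERIV_cong_ev[OF refl _ refl]) auto
  then show ?thesis using assms(1) DERIV_unique by blast
qed

lemma test_function_partials:
  assumes "test_function \<phi>"
  obtains a b R where "0 < a" "a < b" "b < 1" "0 < R"
    "\<And>\<psi>. \<psi> \<in> {\<phi>, partial_r \<phi>, partial_x \<phi>, partial_x (partial_x \<phi>)} \<Longrightarrow>
       continuous_on UNIV \<psi> \<and> (\<forall>t x. \<not> (t \<in> {a..b} \<and> x \<in> {-R..R}) \<longrightarrow> \<psi> (t, x) = 0)"
    "\<And>t x. t \<le> a \<or> t \<ge> b \<or> \<bar>x\<bar> \<ge> R \<Longrightarrow> \<phi> (t, x) = 0"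
    "\<And>t x. \<bar>x\<bar> > R \<Longrightarrow> partial_x \<phi> (t, x) = 0"
proof -
  have s: "smooth2 \<phi>" using assms by (simp add: test_function_def)
  obtain a b R where R: "0 < a" "a < b" "b < 1" "0 < R"
    and 0: "\<And>t x. t \<le> a \<or> t \<ge> b \<or> \<bar>x\<bar> \<ge> R \<Longrightarrow> \<phi> (t, x) = 0"
    using test_function_support[OF assms] by blast
  have sx: "smooth2 (partial_x \<phi>)" by (rule smooth2_smooth2_partial_x[OF s])
  have out: "t < a \<or> t > b \<or> \<bar>x\<bar> > R" if "\<not> (t \<in> {a..b} \<and> x \<in> {-R..R})" for t x
    using that by auto
  have op: "open {y. \<bar>y\<bar> > R}" "open ({..<a} \<union> {b<..})"
    by (intro open_Collect_less continuous_intros) auto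
  have r0: "partial_r \<phi> (t, x) = 0" if "t < a \<or> t > b \<or> \<bar>x\<bar> > R" for t x
  proof (cases "\<bar>x\<bar> > R")
    case True
    show ?thesis
      by (rule has_real_derivative_0_if_locally_0[OF smooth2_partial_r[OF s] open_UNIV]) (use True 0 in auto)
  next
    case False
    show ?thesis
      by (rule has_real_derivative_0_if_locally_0[OF smooth2_partial_r[OF s] op(2)]) (use that False 0 in auto)
  qed
  have x0: "partial_x \<psi> (t, x) = 0" if "smooth2 \<psi>" "t < a \<or> t > b \<or> \<bar>x\<bar> > R"
    "\<And>t x. t < a \<or> t > b \<or> \<bar>x\<bar> > R \<Longrightarrow> \<psi> (t, x) = 0" for \<psi> t x
  proof (cases "\<bar>x\<bar> > R")
    case True
    show ?thesis
      by (rule has_real_derivative_0_if_locally_0[OF smooth2_partial_x[OF that(1)] op(1)]) (use True that(3) in auto)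
  next
    case False
    show ?thesis
      by (rule has_real_derivative_0_if_locally_0[OF smooth2_partial_x[OF that(1)] open_UNIV]) (use that False in auto)
  qed
  have x1: "partial_x \<phi> (t, x) = 0" if "t < a \<or> t > b \<or> \<bar>x\<bar> > R" for t x
    by (rule x0[OF s that]) (use 0 in auto)
  have x2: "partial_x (partial_x \<phi>) (t, x) = 0" if "t < a \<or> t > b \<or> \<bar>x\<bar> > R" for t x
    by (rule x0[OF sx that x1])
  show ?thesis
  proof (rule that[OF R])
    fix \<psi> assume "\<psi> \<in> {\<phi>, partial_r \<phi>, partial_x \<phi>, partial_x (partial_x \<phi>)}"
    then have "continuous_on UNIV \<psi>"
      using smooth2_continuous[OF s] smooth2_continuous_partial_r[OF s] smooth2_continuous[OF sx]
        smooth2_continuous[OF smooth2_smooth2_partial_x[OF sx]] by auto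
    moreover have "\<psi> (t, x) = 0" if "\<not> (t \<in> {a..b} \<and> x \<in> {-R..R})" for t x
    proof -
      have o: "t < a \<or> t > b \<or> \<bar>x\<bar> > R" by (rule out[OF that])
      then have "\<phi> (t, x) = 0" by (intro 0) auto
      then show ?thesis using r0[OF o] x1[OF o] x2[OF o] \<open>\<psi> \<in> _\<close> by blast
    qed
    ultimately show "continuous_on UNIV \<psi> \<and> (\<forall>t x. \<not> (t \<in> {a..b} \<and> x \<in> {-R..R}) \<longrightarrow> \<psi> (t, x) = 0)"
      by blast
  qed (use 0 x1 in auto)
qed

lemma integrable_times_test:
  assumes g: "(\<lambda>z. indicator open_strip z * g z) \<in> borel_measurable borel"
    and \<psi>: "continuous_on UNIV \<psi>" "\<And>t x. \<not> (t \<in> {a..b} \<and> x \<in> {-R..R}) \<Longrightarrow> \<psi> (t, x) = 0"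
    and K: "\<And>t x. t \<in> {a..b} \<Longrightarrow> x \<in> {-R..R} \<Longrightarrow> (t, x) \<in> open_strip \<Longrightarrow> \<bar>g (t, x)\<bar> \<le> (K :: real)"
  shows "set_integrable lborel open_strip (\<lambda>z. g z * \<psi> z)"
proof -
  have [measurable]: "\<psi> \<in> borel_measurable borel" by (rule borel_measurable_continuous_onI[OF \<psi>(1)])
  have "compact (\<psi> ` ({a..b} \<times> {-R..R}))"
    by (intro compact_continuous_image compact_Times continuous_on_subset[OF \<psi>(1)]) auto
  then obtain L where L: "\<And>z. z \<in> {a..b} \<times> {-R..R} \<Longrightarrow> \<bar>\<psi> z\<bar> \<le> L"
    by (metis bounded_iff compact_imp_bounded image_eqI real_norm_def)
  have "integrable lborel (\<lambda>z. (indicator open_strip z * g z) * \<psi> z)"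
  proof (rule integrable_bounded_support_prod[where a=a and b=b and c="-R" and d=R and K="\<bar>K\<bar> * \<bar>L\<bar>"])
    show "(\<lambda>z. (indicator open_strip z * g z) * \<psi> z) \<in> borel_measurable borel" using g by measurable
    fix t x assume tx: "t \<in> {a..b}" "x \<in> {-R..R}"
    have "\<bar>indicator open_strip (t, x) * g (t, x)\<bar> \<le> \<bar>K\<bar>"
      using K[OF tx] by (auto simp: indicator_def)
    moreover have "\<bar>\<psi> (t, x)\<bar> \<le> \<bar>L\<bar>" using L[of "(t, x)"] tx by auto
    ultimately show "\<bar>(indicator open_strip (t, x) * g (t, x)) * \<psi> (t, x)\<bar> \<le> \<bar>K\<bar> * \<bar>L\<bar>"
      unfolding abs_mult[of "_ * _"] by (intro mult_mono) auto
  qed (use \<psi>(2) in auto)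
  then show ?thesis by (simp add: set_integrable_def mult.assoc)
qed

lemma poly_nonneg:
  fixes p :: "real poly"
  assumes "\<And>i. coeff p i \<ge> 0" "x \<ge> 0"
  shows "poly p x \<ge> 0"
  unfolding poly_altdef by (intro sum_nonneg mult_nonneg_nonneg assms zero_le_power)

lemma coeff_pderiv_nonneg:
  fixes p :: "real poly"
  assumes "\<And>i. coeff p i \<ge> 0"
  shows "coeff (pderiv p) i \<ge> 0"
  by (simp add: coeff_pderiv assms)

lemma xi''_nonneg:
  assumes "mixed_pspin_model \<xi>0" "t \<ge> 0"
  shows "xi'' \<xi>0 \<beta> t \<ge> 0"
  by (intro poly_nonneg coeff_pderiv_nonneg) (use assms in \<open>auto simp: xi_def mixed_pspin_model_def\<close>)

lemma continuous_strip_measurable: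
  assumes "continuous_on closed_strip u"
  shows "(\<lambda>z. indicator open_strip z * u z :: real) \<in> borel_measurable borel"
proof -
  have "continuous_on open_strip u"
    by (rule continuous_on_subset[OF assms]) (auto simp: open_strip_def closed_strip_def)
  then have "(\<lambda>z. indicator open_strip z *\<^sub>R u z) \<in> borel_measurable borel"
    by (intro borel_measurable_continuous_on_indicator) auto
  then show ?thesis by simp
qed

lemma continuous_strip_locally_bounded:
  fixes u :: "real \<times> real \<Rightarrow> real"
  assumes "continuous_on closed_strip u"
  obtains K where "\<And>t x. x \<in> {-R..R} \<Longrightarrow> (t, x) \<in> open_strip \<Longrightarrow> \<bar>u (t, x)\<bar> \<le> K"
proof -
  have "compact (u ` ({0..1} \<times> {-R..R}))"
    by (intro compact_continuous_image continuous_on_subset[OF assms] compact_Times) (auto simp: closed_strip_def)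
  then obtain K where K: "\<And>z. z \<in> {0..1} \<times> {-R..R} \<Longrightarrow> \<bar>u z\<bar> \<le> K"
    by (metis bounded_iff compact_imp_bounded image_eqI real_norm_def)
  show ?thesis
    by (rule that[of K]) (use K in \<open>auto simp: open_strip_def\<close>)
qed

text \<open>The nonlinear terms differ by m (v1^2 - v2^2) = m (v1 + v2)(v1 - v2), hence by at most
  (C1 + C2) |d|; this puts the difference of the solutions into \<open>linear_weak\<close> with P =
  \<xi>'. The function \<open>m\<close> is a Borel representative of the distribution function of
  \<mu> on (0,1).\<close>

theorem parisi_weak_solution_unique:
  assumes model: "mixed_pspin_model \<xi>0"
    and m [measurable]: "m \<in> borel_measurable borel" and m01: "\<And>t. 0 \<le> m t \<and> m t \<le> 1"
    and \<mu>: "\<And>t. 0 < t \<Longrightarrow> t < 1 \<Longrightarrow> measure \<mu> {0..t} = m t"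
    and u1: "parisi_weak_solution \<xi>0 \<beta> \<mu> u1" and u2: "parisi_weak_solution \<xi>0 \<beta> \<mu> u2"
  shows "u1 = u2"
proof -
  let ?Q = "xi'' \<xi>0 \<beta>"
  have *: "\<exists>v C. C \<ge> 0 \<and> v \<in> borel_measurable borel \<and> (\<forall>z. \<bar>v z\<bar> \<le> C) \<and>
      (\<forall>\<phi>. test_function \<phi> \<longrightarrow> (LINT z:open_strip|lborel. u z * partial_x \<phi> z) = - (LINT z:open_strip|lborel. v z * \<phi> z)) \<and>
      (\<forall>\<phi>. test_function \<phi> \<longrightarrow> (LINT z:open_strip|lborel.
              - u z * partial_r \<phi> z + ?Q (fst z) / 2 * (u z * partial_x (partial_x \<phi>) z + m (fst z) * (v z)\<^sup>2 * \<phi> z)) = 0)"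
    if "parisi_weak_solution \<xi>0 \<beta> \<mu> u" for u
  proof -
    from that obtain v C where vC: "v \<in> borel_measurable lborel" "AE z in lborel. z \<in> open_strip \<longrightarrow> \<bar>v z\<bar> \<le> C"
      and wd: "weak_partial_x u v"
      and eq: "\<And>\<phi>. test_function \<phi> \<Longrightarrow> (LINT z:open_strip|lborel.
              - u z * partial_r \<phi> z + ?Q (fst z) / 2 * (u z * partial_x (partial_x \<phi>) z + measure \<mu> {0..fst z} * (v z)\<^sup>2 * \<phi> z)) = 0"
      and uc: "continuous_on closed_strip u"
      unfolding parisi_weak_solution_def by auto
    have [measurable]: "v \<in> borel_measurable borel" using vC(1) by simp
    \<comment> \<open>Truncation changes the weak derivative only on a null set of the strip and
      turns its essential bound into a pointwise one.\<close>
    define v' where "v' = (\<lambda>z. if \<bar>v z\<bar> \<le> \<bar>C\<bar> then v z else 0)"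
    have v'_meas [measurable]: "v' \<in> borel_measurable borel" unfolding v'_def by measurable
    have ae: "AE z in lborel. z \<in> open_strip \<longrightarrow> v z = v' z"
      using vC(2) by eventually_elim (auto simp: v'_def)
    have b: "\<bar>v' z\<bar> \<le> \<bar>C\<bar>" for z by (simp add: v'_def)
    note u_meas [measurable] = continuous_strip_measurable[OF uc]
    have Q_meas [measurable]: "(\<lambda>z :: real \<times> real. ?Q (fst z)) \<in> borel_measurable borel"
      by (intro borel_measurable_continuous_onI continuous_intros)
    have "(LINT z:open_strip|lborel. u z * partial_x \<phi> z) = - (LINT z:open_strip|lborel. v' z * \<phi> z)" if t: "test_function \<phi>" for \<phi>
    proof -
      have [measurable]: "\<phi> \<in> borel_measurable borel"
        using t smooth2_continuous by (auto simp: test_function_def intro: borel_measurable_continuous_onI)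
      have "(LINT z:open_strip|lborel. v z * \<phi> z) = (LINT z:open_strip|lborel. v' z * \<phi> z)"
        unfolding set_lebesgue_integral_def
        by (rule integral_cong_AE) (measurable, use ae in \<open>eventually_elim, auto simp: indicator_def\<close>)
      then show ?thesis using wd t unfolding weak_partial_x_def by simp
    qed
    moreover have "(LINT z:open_strip|lborel.
              - u z * partial_r \<phi> z + ?Q (fst z) / 2 * (u z * partial_x (partial_x \<phi>) z + m (fst z) * (v' z)\<^sup>2 * \<phi> z)) = 0" if t: "test_function \<phi>" for \<phi>
    proof -
      have s: "smooth2 \<phi>" using t by (simp add: test_function_def)
      have [measurable]: "\<phi> \<in> borel_measurable borel" "partial_r \<phi> \<in> borel_measurable borel" "partial_x (partial_x \<phi>) \<in> borel_measurable borel"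
        by (intro borel_measurable_continuous_onI smooth2_continuous[OF s] smooth2_continuous_partial_r[OF s]
            smooth2_continuous[OF smooth2_smooth2_partial_x[OF smooth2_smooth2_partial_x[OF s]]])+
      have mm: "(\<lambda>z. (- (indicator open_strip z * u z) * partial_r \<phi> z + ?Q (fst z) / 2 * ((indicator open_strip z * u z) * partial_x (partial_x \<phi>) z + indicator open_strip z * (m (fst z) * (w z)\<^sup>2 * \<phi> z)))) \<in> borel_measurable borel"
        if [measurable]: "w \<in> borel_measurable borel" for w
        by measurable
      \<comment> \<open>Attaching the indicator to \<open>u\<close> makes the integrand visibly
        measurable, because \<open>u\<close> is controlled only on the strip; on the strip the
        measure may be replaced by \<open>m\<close>.\<close>
      have rw: "indicator open_strip z *\<^sub>R (- u z * partial_r \<phi> z + ?Q (fst z) / 2 * (u z * partial_x (partial_x \<phi>) z + measure \<mu> {0..fst z} * (w z)\<^sup>2 * \<phi> z))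
        = (- (indicator open_strip z * u z) * partial_r \<phi> z + ?Q (fst z) / 2 * ((indicator open_strip z * u z) * partial_x (partial_x \<phi>) z + indicator open_strip z * (m (fst z) * (w z)\<^sup>2 * \<phi> z)))" for z w
        using \<mu>[of "fst z"] by (cases z) (auto simp: indicator_def open_strip_def)
      have rw': "indicator open_strip z *\<^sub>R (- u z * partial_r \<phi> z + ?Q (fst z) / 2 * (u z * partial_x (partial_x \<phi>) z + m (fst z) * (w z)\<^sup>2 * \<phi> z))
        = (- (indicator open_strip z * u z) * partial_r \<phi> z + ?Q (fst z) / 2 * ((indicator open_strip z * u z) * partial_x (partial_x \<phi>) z + indicator open_strip z * (m (fst z) * (w z)\<^sup>2 * \<phi> z)))" for z w
        by (cases z) (auto simp: indicator_def)
      have "(LINT z|lborel. (- (indicator open_strip z * u z) * partial_r \<phi> z + ?Q (fst z) / 2 * ((indicator open_strip z * u z) * partial_x (partial_x \<phi>) z + indicator open_strip z * (m (fst z) * (v' z)\<^sup>2 * \<phi> z))))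
        = (LINT z|lborel. (- (indicator open_strip z * u z) * partial_r \<phi> z + ?Q (fst z) / 2 * ((indicator open_strip z * u z) * partial_x (partial_x \<phi>) z + indicator open_strip z * (m (fst z) * (v z)\<^sup>2 * \<phi> z))))"
      proof (rule integral_cong_AE)
        show "AE z in lborel. (- (indicator open_strip z * u z) * partial_r \<phi> z + ?Q (fst z) / 2 * ((indicator open_strip z * u z) * partial_x (partial_x \<phi>) z + indicator open_strip z * (m (fst z) * (v' z)\<^sup>2 * \<phi> z)))
          = (- (indicator open_strip z * u z) * partial_r \<phi> z + ?Q (fst z) / 2 * ((indicator open_strip z * u z) * partial_x (partial_x \<phi>) z + indicator open_strip z * (m (fst z) * (v z)\<^sup>2 * \<phi> z)))"
          using ae by eventually_elim (auto simp: indicator_def)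
      qed (use mm[of v] mm[of v'] in auto)
      also have "\<dots> = 0" using eq[OF t] unfolding set_lebesgue_integral_def rw .
      finally show ?thesis unfolding set_lebesgue_integral_def rw' .
    qed
    ultimately show ?thesis using b v'_meas by (intro exI[of _ v'] exI[of _ "\<bar>C\<bar>"]) auto
  qed
  obtain v1 C1 where v1: "C1 \<ge> 0" "v1 \<in> borel_measurable borel" "\<And>z. \<bar>v1 z\<bar> \<le> C1"
    and wd1: "\<And>\<phi>. test_function \<phi> \<Longrightarrow> (LINT z:open_strip|lborel. u1 z * partial_x \<phi> z) = - (LINT z:open_strip|lborel. v1 z * \<phi> z)"
    and eq1: "\<And>\<phi>. test_function \<phi> \<Longrightarrow> (LINT z:open_strip|lborel.
              - u1 z * partial_r \<phi> z + ?Q (fst z) / 2 * (u1 z * partial_x (partial_x \<phi>) z + m (fst z) * (v1 z)\<^sup>2 * \<phi> z)) = 0"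
    using *[OF u1] by blast
  obtain v2 C2 where v2: "C2 \<ge> 0" "v2 \<in> borel_measurable borel" "\<And>z. \<bar>v2 z\<bar> \<le> C2"
    and wd2: "\<And>\<phi>. test_function \<phi> \<Longrightarrow> (LINT z:open_strip|lborel. u2 z * partial_x \<phi> z) = - (LINT z:open_strip|lborel. v2 z * \<phi> z)"
    and eq2: "\<And>\<phi>. test_function \<phi> \<Longrightarrow> (LINT z:open_strip|lborel.
              - u2 z * partial_r \<phi> z + ?Q (fst z) / 2 * (u2 z * partial_x (partial_x \<phi>) z + m (fst z) * (v2 z)\<^sup>2 * \<phi> z)) = 0"
    using *[OF u2] by blast
  note [measurable] = v1(2) v2(2)
  have c1: "continuous_on closed_strip u1" and c2: "continuous_on closed_strip u2"
    and e1: "u1 \<in> extensional closed_strip" and e2: "u2 \<in> extensional closed_strip"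
    and t1: "\<And>x. u1 (1, x) = ln (cosh x)" and t2: "\<And>x. u2 (1, x) = ln (cosh x)"
    using u1 u2 unfolding parisi_weak_solution_def by auto
  have int_u: "set_integrable lborel open_strip (\<lambda>z. u z * \<psi> z)"
    and int_qu: "set_integrable lborel open_strip (\<lambda>z. ?Q (fst z) / 2 * u z * \<psi> z)"
    if uc: "continuous_on closed_strip u" and t: "test_function \<phi>"
      and \<psi>: "\<psi> \<in> {\<phi>, partial_r \<phi>, partial_x \<phi>, partial_x (partial_x \<phi>)}" for u \<phi> \<psi>
  proof -
    obtain a b R where R: "continuous_on UNIV \<psi>" "\<And>t x. \<not> (t \<in> {a..b} \<and> x \<in> {-R..R}) \<Longrightarrow> \<psi> (t, x) = 0"
      using test_function_partials[OF t] \<psi> by metis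
    have int: "set_integrable lborel open_strip (\<lambda>z. g z * \<psi> z)" if gc: "continuous_on closed_strip g" for g
    proof -
      obtain K where "\<And>t x. x \<in> {-R..R} \<Longrightarrow> (t, x) \<in> open_strip \<Longrightarrow> \<bar>g (t, x)\<bar> \<le> K"
        using continuous_strip_locally_bounded[OF gc] by blast
      then show ?thesis by (intro integrable_times_test[OF continuous_strip_measurable[OF gc] R]) auto
    qed
    show "set_integrable lborel open_strip (\<lambda>z. u z * \<psi> z)" by (rule int[OF uc])
    show "set_integrable lborel open_strip (\<lambda>z. ?Q (fst z) / 2 * u z * \<psi> z)"
      by (rule int) (intro continuous_intros uc, auto)
  qed
  have int_v: "set_integrable lborel open_strip (\<lambda>z. v z * \<phi> z)"
    and int_qv: "set_integrable lborel open_strip (\<lambda>z. ?Q (fst z) / 2 * (m (fst z) * (v z)\<^sup>2) * \<phi> z)"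
    if [measurable]: "v \<in> borel_measurable borel" and b: "\<And>z. \<bar>v z\<bar> \<le> C" and t: "test_function \<phi>" for v C \<phi>
  proof -
    obtain a b R where R: "continuous_on UNIV \<phi>" "\<And>t x. \<not> (t \<in> {a..b} \<and> x \<in> {-R..R}) \<Longrightarrow> \<phi> (t, x) = 0"
      using test_function_partials[OF t] by (metis insertI1)
    show "set_integrable lborel open_strip (\<lambda>z. v z * \<phi> z)"
      by (rule integrable_times_test[OF _ R]) (measurable, use b in auto)
    have "continuous_on closed_strip (\<lambda>z. ?Q (fst z))" by (intro continuous_intros)
    then obtain K where K: "\<And>t x. x \<in> {-R..R} \<Longrightarrow> (t, x) \<in> open_strip \<Longrightarrow> \<bar>?Q (fst (t, x))\<bar> \<le> K"
      using continuous_strip_locally_bounded by blast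
    have Q_meas [measurable]: "(\<lambda>z :: real \<times> real. ?Q (fst z)) \<in> borel_measurable borel"
      by (intro borel_measurable_continuous_onI continuous_intros)
    show "set_integrable lborel open_strip (\<lambda>z. ?Q (fst z) / 2 * (m (fst z) * (v z)\<^sup>2) * \<phi> z)"
    proof (rule integrable_times_test[OF _ R])
      fix t x assume tx: "x \<in> {-R..R}" "(t, x) \<in> open_strip"
      have "(v (t, x))\<^sup>2 \<le> C\<^sup>2" using b[of "(t, x)"] by (simp add: abs_le_square_iff[symmetric])
      then have "m t * (v (t, x))\<^sup>2 \<le> 1 * C\<^sup>2" using m01[of t] by (intro mult_mono) auto
      then show "\<bar>?Q (fst (t, x)) / 2 * (m (fst (t, x)) * (v (t, x))\<^sup>2)\<bar> \<le> K * C\<^sup>2"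
        unfolding abs_mult using K[OF tx] m01[of t] by (intro mult_mono) (auto simp: abs_mult)
    qed measurable
  qed
  define C where "C = C1 + C2"
  define w where "w = (\<lambda>z. u1 z - u2 z)"
  define d where "d = (\<lambda>z. v1 z - v2 z)"
  define f where "f = (\<lambda>z. m (fst z) * ((v1 z)\<^sup>2 - (v2 z)\<^sup>2))"
  interpret linear_weak "pderiv (xi \<xi>0 \<beta>)" w d f C
  proof
    show "continuous_on closed_strip w" unfolding w_def by (intro continuous_intros c1 c2)
    show "w z = 0" if "z \<notin> closed_strip" for z
      using e1 e2 that by (cases z) (auto simp: w_def extensional_def)
    show "d \<in> borel_measurable borel" "f \<in> borel_measurable borel" unfolding d_def f_def by measurable
    show "\<bar>d z\<bar> \<le> C" for z using v1(3)[of z] v2(3)[of z] unfolding d_def C_def by linarith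
    show "\<bar>f z\<bar> \<le> C * \<bar>d z\<bar>" for z
    proof -
      have "f z = (m (fst z) * (v1 z + v2 z)) * d z"
        by (simp add: f_def d_def power2_eq_square algebra_simps)
      then have "\<bar>f z\<bar> = (m (fst z) * \<bar>v1 z + v2 z\<bar>) * \<bar>d z\<bar>"
        using m01[of "fst z"] by (simp add: abs_mult)
      also have "\<dots> \<le> (1 * C) * \<bar>d z\<bar>"
        using m01[of "fst z"] v1(3)[of z] v2(3)[of z] unfolding C_def
        by (intro mult_right_mono mult_mono) linarith+
      finally show ?thesis by simp
    qed
    show "?Q t \<ge> 0" if "t \<in> {0..1}" for t using xi''_nonneg[OF model] that by auto
    show "w (1, x) = 0" for x by (simp add: w_def t1 t2)
    fix \<phi> assume t: "test_function \<phi>"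
    have "(LINT z:open_strip|lborel. w z * partial_x \<phi> z) = (LINT z:open_strip|lborel. u1 z * partial_x \<phi> z) - (LINT z:open_strip|lborel. u2 z * partial_x \<phi> z)"
      unfolding w_def left_diff_distrib by (rule set_integral_diff) (rule int_u[OF c1 t] int_u[OF c2 t], simp)+
    also have "\<dots> = - ((LINT z:open_strip|lborel. v1 z * \<phi> z) - (LINT z:open_strip|lborel. v2 z * \<phi> z))"
      by (simp add: wd1[OF t] wd2[OF t])
    also have "(LINT z:open_strip|lborel. v1 z * \<phi> z) - (LINT z:open_strip|lborel. v2 z * \<phi> z) = (LINT z:open_strip|lborel. d z * \<phi> z)"
      unfolding d_def left_diff_distrib
      by (rule set_integral_diff(2)[symmetric]) (rule int_v[OF v1(2,3) t] int_v[OF v2(2,3) t])+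
    finally show "(LINT z:open_strip|lborel. w z * partial_x \<phi> z) = - (LINT z:open_strip|lborel. d z * \<phi> z)" .
    let ?E = "\<lambda>u v z. - u z * partial_r \<phi> z + ?Q (fst z) / 2 * (u z * partial_x (partial_x \<phi>) z + m (fst z) * (v z)\<^sup>2 * \<phi> z)"
    have intE: "set_integrable lborel open_strip (?E u v)"
      if "continuous_on closed_strip u" and v: "v \<in> borel_measurable borel" "\<And>z. \<bar>v z\<bar> \<le> C" for u v C
    proof -
      have "set_integrable lborel open_strip (\<lambda>z. - (u z * partial_r \<phi> z) + (?Q (fst z) / 2 * u z * partial_x (partial_x \<phi>) z + ?Q (fst z) / 2 * (m (fst z) * (v z)\<^sup>2) * \<phi> z))"
        using int_u[OF that(1) t, of "partial_r \<phi>"]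
        by (intro set_integral_add int_qu[OF that(1) t] int_qv[OF v t]) (simp_all add: set_integrable_def)
      then show ?thesis by (simp add: algebra_simps)
    qed
    have "(LINT z:open_strip|lborel. - w z * partial_r \<phi> z + ?Q (fst z) / 2 * (w z * partial_x (partial_x \<phi>) z + f z * \<phi> z))
      = (LINT z:open_strip|lborel. ?E u1 v1 z - ?E u2 v2 z)"
      by (rule arg_cong[where f="\<lambda>g. LINT z:open_strip|lborel. g z"]) (auto simp: fun_eq_iff w_def f_def algebra_simps diff_divide_distrib)
    also have "\<dots> = 0"
      using eq1[OF t] eq2[OF t] by (subst set_integral_diff(2)[OF intE[OF c1 v1(2,3)] intE[OF c2 v2(2,3)]]) simp
    finally show "(LINT z:open_strip|lborel. - w z * partial_r \<phi> z + ?Q (fst z) / 2 * (w z * partial_x (partial_x \<phi>) z + f z * \<phi> z)) = 0" .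
  qed
  show ?thesis using w_eq_0 by (simp add: w_def fun_eq_iff)
qed

section \<open>Classical solutions are weak solutions\<close>

lemma integral_lborel_prod_swap:
  fixes F :: "real \<times> real \<Rightarrow> real"
  assumes "integrable lborel F"
  shows "(LINT z|lborel. F z) = (LINT x|lborel. LINT t|lborel. F (t, x))"
    and "AE x in lborel. integrable lborel (\<lambda>t. F (t, x))"
  using assms lborel_pair.integral_snd[of "\<lambda>t x. F (t, x)"] lborel_pair.AE_integrable_snd[of "\<lambda>t x. F (t, x)"]
  by (auto simp: lborel_prod)

lemma integral_derivative_eq_0:
  fixes f :: "real \<Rightarrow> real"
  assumes deriv: "\<And>x. (f has_real_derivative g x) (at x)" and cont: "continuous_on UNIV g"
    and R: "R > 0" and supp: "\<And>x. \<bar>x\<bar> \<ge> R \<Longrightarrow> f x = 0" "\<And>x. \<bar>x\<bar> > R \<Longrightarrow> g x = 0"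
  shows "(LINT x|lborel. g x) = 0"
proof -
  have "(LINT x|lborel. g x * indicator {-R..R} x) = f R - f (-R)"
    by (rule integral_FTC_Icc_real) (use assms in \<open>auto simp: continuous_on_eq_continuous_at\<close>)
  moreover have "g x * indicator {-R..R} x = g x" for x
    using supp(2)[of x] by (cases "\<bar>x\<bar> > R") (auto simp: indicator_def abs_le_iff not_less)
  ultimately show ?thesis using supp(1)[of R] supp(1)[of "-R"] R by simp
qed

text \<open>Integration by parts, in space for each fixed time and in time for each fixed position.
  The finite set \<open>S\<close> admits jumps of the distribution function: the time derivative may
  fail there, but \<open>U\<close> is continuous, so the fundamental theorem still applies.\<close>

theorem classical_imp_weak_solution:
  fixes U V W :: "real \<times> real \<Rightarrow> real" and S :: "real set"
  assumes m [measurable]: "m \<in> borel_measurable borel" and m01: "\<And>t. 0 \<le> m t \<and> m t \<le> 1"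
    and \<mu>: "\<And>t. 0 < t \<Longrightarrow> t < 1 \<Longrightarrow> measure \<mu> {0..t} = m t"
    and U: "continuous_on closed_strip U" and V: "continuous_on closed_strip V" and W: "continuous_on closed_strip W"
    and U1: "\<And>x. U (1, x) = ln (cosh x)" and Vb: "\<And>t x. 0 < t \<Longrightarrow> t < 1 \<Longrightarrow> \<bar>V (t, x)\<bar> \<le> B"
    and S: "finite S"
    and Ut: "\<And>t x. 0 < t \<Longrightarrow> t < 1 \<Longrightarrow> t \<notin> S \<Longrightarrow>
      ((\<lambda>s. U (s, x)) has_real_derivative - (xi'' \<xi>0 \<beta> t / 2 * (W (t, x) + m t * (V (t, x))\<^sup>2))) (at t)"
    and Ux: "\<And>t x. 0 < t \<Longrightarrow> t < 1 \<Longrightarrow> ((\<lambda>y. U (t, y)) has_real_derivative V (t, x)) (at x)"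
    and Vx: "\<And>t x. 0 < t \<Longrightarrow> t < 1 \<Longrightarrow> ((\<lambda>y. V (t, y)) has_real_derivative W (t, x)) (at x)"
  shows "parisi_weak_solution \<xi>0 \<beta> \<mu> (restrict U closed_strip)"
proof -
  let ?Q = "xi'' \<xi>0 \<beta>"
  define v where "v = (\<lambda>z. indicator open_strip z * V z)"
  have v_meas [measurable]: "v \<in> borel_measurable borel"
    unfolding v_def by (rule continuous_strip_measurable[OF V])
  have Q_meas [measurable]: "(\<lambda>z :: real \<times> real. ?Q (fst z)) \<in> borel_measurable borel"
    by (intro borel_measurable_continuous_onI continuous_intros)
  have slice: "continuous_on UNIV (\<lambda>x. g (t, x))" if "continuous_on closed_strip g" "0 < t" "t < 1" for g :: "real \<times> real \<Rightarrow> real" and t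
    by (rule continuous_on_compose2[OF that(1)]) (use that in \<open>auto intro!: continuous_intros simp: closed_strip_def\<close>)
  have sub: "open_strip \<subseteq> closed_strip" by (auto simp: open_strip_def closed_strip_def)
  have main: "(LINT z:open_strip|lborel. U z * partial_x \<phi> z) = - (LINT z:open_strip|lborel. v z * \<phi> z) \<and>
    (LINT z:open_strip|lborel. - U z * partial_r \<phi> z + ?Q (fst z) / 2 * (U z * partial_x (partial_x \<phi>) z + measure \<mu> {0..fst z} * (v z)\<^sup>2 * \<phi> z)) = 0"
    if t: "test_function \<phi>" for \<phi>
  proof -
    have s: "smooth2 \<phi>" using t by (simp add: test_function_def)
    have sx: "smooth2 (partial_x \<phi>)" by (rule smooth2_smooth2_partial_x[OF s])
    obtain a b R where abR: "0 < a" "a < b" "b < 1" "0 < R"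
      and \<psi>: "\<And>\<psi>. \<psi> \<in> {\<phi>, partial_r \<phi>, partial_x \<phi>, partial_x (partial_x \<phi>)} \<Longrightarrow>
       continuous_on UNIV \<psi> \<and> (\<forall>t x. \<not> (t \<in> {a..b} \<and> x \<in> {-R..R}) \<longrightarrow> \<psi> (t, x) = 0)"
      and \<phi>0: "\<And>t x. t \<le> a \<or> t \<ge> b \<or> \<bar>x\<bar> \<ge> R \<Longrightarrow> \<phi> (t, x) = 0"
      and \<phi>x0: "\<And>t x. \<bar>x\<bar> > R \<Longrightarrow> partial_x \<phi> (t, x) = 0"
      by (rule test_function_partials[OF t], rule that, assumption+)
    \<comment> \<open>At the edge |x| = R the derivative vanishes by approximation from outside; the
      boundary terms of the second integration by parts need this.\<close>
    have \<phi>x0': "partial_x \<phi> (t, x) = 0" if "\<bar>x\<bar> \<ge> R" for t x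
    proof -
      have c: "continuous_on UNIV (\<lambda>y. partial_x \<phi> (t, y))"
        by (rule continuous_on_compose2[OF smooth2_continuous[OF sx]]) (auto intro!: continuous_intros)
      have "closed {y. partial_x \<phi> (t, y) = 0}"
        by (intro closed_Collect_eq c continuous_intros)
      then have "closure {y. \<bar>y\<bar> > R} \<subseteq> {y. partial_x \<phi> (t, y) = 0}"
        by (rule closure_minimal[rotated]) (use \<phi>x0 in auto)
      moreover have "x \<in> closure {y. \<bar>y\<bar> > R}"
        unfolding closure_sequential
      proof (intro exI[of _ "\<lambda>n. x + sgn x / real (Suc n)"] conjI allI)
        have "x \<noteq> 0" using that abR(4) by auto
        show "x + sgn x / real (Suc n) \<in> {y. \<bar>y\<bar> > R}" for n
        proof -
          define e where "e = 1 / real (Suc n)"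
          have "e > 0" by (simp add: e_def)
          moreover have "sgn x / real (Suc n) = (if x > 0 then e else - e)"
            using \<open>x \<noteq> 0\<close> by (simp add: e_def sgn_real_def)
          ultimately show ?thesis using that \<open>x \<noteq> 0\<close> by auto
        qed
        show "(\<lambda>n. x + sgn x / real (Suc n)) \<longlonglongrightarrow> x" by real_asymp
      qed
      ultimately show ?thesis by auto
    qed
    have int: "integrable lborel (\<lambda>z. indicator open_strip z * (g z * \<psi> z))"
      if "(\<lambda>z. indicator open_strip z * g z) \<in> borel_measurable borel" "\<psi> \<in> {\<phi>, partial_r \<phi>, partial_x \<phi>, partial_x (partial_x \<phi>)}"
      "\<And>t x. t \<in> {a..b} \<Longrightarrow> x \<in> {-R..R} \<Longrightarrow> (t, x) \<in> open_strip \<Longrightarrow> \<bar>g (t, x)\<bar> \<le> K" for g \<psi> and K :: real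
    proof -
      have "set_integrable lborel open_strip (\<lambda>z. g z * \<psi> z)"
        by (rule integrable_times_test[OF that(1), of \<psi> a b R K]) (use \<psi>[OF that(2)] that(3) in auto)
      then show ?thesis by (simp add: set_integrable_def)
    qed
    have intc: "integrable lborel (\<lambda>z. indicator open_strip z * (g z * \<psi> z))"
      if g: "continuous_on closed_strip g" and "\<psi> \<in> {\<phi>, partial_r \<phi>, partial_x \<phi>, partial_x (partial_x \<phi>)}" for g \<psi>
    proof -
      obtain K where "\<And>t x. x \<in> {-R..R} \<Longrightarrow> (t, x) \<in> open_strip \<Longrightarrow> \<bar>g (t, x)\<bar> \<le> K"
        using continuous_strip_locally_bounded[OF g] by blast
      then show ?thesis by (intro int[OF continuous_strip_measurable[OF g] that(2)]) auto
    qed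
    have cQ: "continuous_on A (\<lambda>z. ?Q (fst z))" for A by (intro continuous_intros)
    have ind: "indicator open_strip (t, x) = (indicator {0<..<1} t :: real)" for t x :: real
      by (auto simp: open_strip_def indicator_def)
    have dphi: "((\<lambda>y. \<phi> (t, y)) has_real_derivative partial_x \<phi> (t, x)) (at x)"
      "((\<lambda>y. partial_x \<phi> (t, y)) has_real_derivative partial_x (partial_x \<phi>) (t, x)) (at x)" for t x
      using smooth2_partial_x[OF s] smooth2_partial_x[OF sx] by auto
    have cphi: "continuous_on UNIV (\<lambda>x. \<psi> (t, x))" if "\<psi> \<in> {\<phi>, partial_r \<phi>, partial_x \<phi>, partial_x (partial_x \<phi>)}" for \<psi> t
      by (rule continuous_on_compose2[of UNIV \<psi>]) (use \<psi>[OF that] in \<open>auto intro!: continuous_intros\<close>)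
    have cphis: "continuous_on UNIV (\<lambda>x. \<phi> (t, x))" "continuous_on UNIV (\<lambda>x. partial_x \<phi> (t, x))" "continuous_on UNIV (\<lambda>x. partial_x (partial_x \<phi>) (t, x))" for t
      by (rule cphi[of \<phi>] cphi[of "partial_x \<phi>"] cphi[of "partial_x (partial_x \<phi>)"], simp)+
    note cU = slice[OF U] and cV = slice[OF V] and cW = slice[OF W]
    have iUx: "integrable lborel (\<lambda>z. indicator open_strip z * (U z * partial_x \<phi> z))" and iV: "integrable lborel (\<lambda>z. indicator open_strip z * (V z * \<phi> z))"
      by (intro intc U V; simp)+
    have "0 = (LINT t|lborel. LINT x|lborel. indicator open_strip (t, x) * (U (t, x) * partial_x \<phi> (t, x)) + indicator open_strip (t, x) * (V (t, x) * \<phi> (t, x)))"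
    proof -
      have "(LINT x|lborel. indicator open_strip (t, x) * (U (t, x) * partial_x \<phi> (t, x)) + indicator open_strip (t, x) * (V (t, x) * \<phi> (t, x))) = 0" for t
      proof (cases "0 < t \<and> t < 1")
        case True
        have "(LINT x|lborel. V (t, x) * \<phi> (t, x) + partial_x \<phi> (t, x) * U (t, x)) = 0"
          by (rule integral_derivative_eq_0[of "\<lambda>x. U (t, x) * \<phi> (t, x)" _ R])
             (use True abR \<phi>0 \<phi>x0 in \<open>auto intro!: DERIV_mult Ux dphi continuous_on_add continuous_on_mult cU cV cphis\<close>)
        then show ?thesis using True by (simp add: ind mult_ac add_ac)
      qed (simp add: ind)
      then show ?thesis by simp
    qed
    also have "\<dots> = (LINT z|lborel. indicator open_strip z * (U z * partial_x \<phi> z) + indicator open_strip z * (V z * \<phi> z))"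
      by (rule integral_lborel_prod(1)[symmetric]) (intro Bochner_Integration.integrable_add iUx iV)
    also have "\<dots> = (LINT z:open_strip|lborel. U z * partial_x \<phi> z) + (LINT z:open_strip|lborel. v z * \<phi> z)"
      using iUx iV by (simp add: set_lebesgue_integral_def v_def mult.assoc[symmetric] indicator_inter_arith[symmetric])
    finally have first: "(LINT z:open_strip|lborel. U z * partial_x \<phi> z) = - (LINT z:open_strip|lborel. v z * \<phi> z)" by simp
    \<comment> \<open>Adding and subtracting \<open>W \<phi>\<close> splits the weak integrand: by
      the equation \<open>J1\<close> is minus the time derivative of \<open>U \<phi>\<close>, while
      \<open>J2\<close> is a multiple of the space derivative of
      \<open>U \<phi>_x - V \<phi>\<close>.\<close>
    define J1 where "J1 = (\<lambda>z. indicator open_strip z * (- (U z * partial_r \<phi> z) + (?Q (fst z) / 2 * (W z + m (fst z) * (V z)\<^sup>2)) * \<phi> z))"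
    define J2 where "J2 = (\<lambda>z. indicator open_strip z * (?Q (fst z) / 2 * (U z * partial_x (partial_x \<phi>) z - W z * \<phi> z)))"
    have iJ2: "integrable lborel J2"
    proof -
      have "integrable lborel (\<lambda>z. indicator open_strip z * ((?Q (fst z) / 2 * U z) * partial_x (partial_x \<phi>) z) - indicator open_strip z * ((?Q (fst z) / 2 * W z) * \<phi> z))"
        by (intro Bochner_Integration.integrable_diff intc continuous_intros U W cQ) auto
      then show ?thesis by (simp add: J2_def algebra_simps)
    qed
    have iJ1: "integrable lborel J1"
    proof -
      have "continuous_on closed_strip (\<lambda>z. ?Q (fst z) / 2 * (V z)\<^sup>2)" "continuous_on closed_strip (\<lambda>z. ?Q (fst z) / 2 * W z)"
        by (intro continuous_intros V W cQ; simp)+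
      note c = this
      obtain K where K: "\<And>t x. x \<in> {-R..R} \<Longrightarrow> (t, x) \<in> open_strip \<Longrightarrow> \<bar>?Q (fst (t, x)) / 2 * (V (t, x))\<^sup>2\<bar> \<le> K"
        using continuous_strip_locally_bounded[OF c(1)] by blast
      have mm: "(\<lambda>z. m (fst z) * (indicator open_strip z * (?Q (fst z) / 2 * (V z)\<^sup>2))) \<in> borel_measurable borel"
        using continuous_strip_measurable[OF c(1)] by measurable
      have "integrable lborel (\<lambda>z. indicator open_strip z * ((m (fst z) * (?Q (fst z) / 2 * (V z)\<^sup>2)) * \<phi> z))"
      proof (rule int[where K=K])
        show "(\<lambda>z. indicator open_strip z * (m (fst z) * (?Q (fst z) / 2 * (V z)\<^sup>2))) \<in> borel_measurable borel"
          using mm by (simp add: mult.left_commute)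
        fix t x assume "x \<in> {-R..R}" "(t, x) \<in> open_strip"
        then have "\<bar>m t\<bar> * \<bar>?Q (fst (t, x)) / 2 * (V (t, x))\<^sup>2\<bar> \<le> 1 * K"
          using m01[of t] by (intro mult_mono K) auto
        then show "\<bar>m (fst (t, x)) * (?Q (fst (t, x)) / 2 * (V (t, x))\<^sup>2)\<bar> \<le> K" by (simp add: abs_mult)
      qed simp
      moreover have "integrable lborel (\<lambda>z. indicator open_strip z * (U z * partial_r \<phi> z))" "integrable lborel (\<lambda>z. indicator open_strip z * ((?Q (fst z) / 2 * W z) * \<phi> z))"
        by (intro intc U c; simp)+
      ultimately have "integrable lborel (\<lambda>z. - (indicator open_strip z * (U z * partial_r \<phi> z)) + (indicator open_strip z * ((?Q (fst z) / 2 * W z) * \<phi> z)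
         + indicator open_strip z * ((m (fst z) * (?Q (fst z) / 2 * (V z)\<^sup>2)) * \<phi> z)))"
        by (intro Bochner_Integration.integrable_add Bochner_Integration.integrable_minus)
      then show ?thesis by (simp add: J1_def algebra_simps)
    qed
    have "(LINT x|lborel. J2 (t, x)) = 0" for t
    proof (cases "0 < t \<and> t < 1")
      case True
      have "(LINT x|lborel. (V (t, x) * partial_x \<phi> (t, x) + partial_x (partial_x \<phi>) (t, x) * U (t, x)) - (W (t, x) * \<phi> (t, x) + partial_x \<phi> (t, x) * V (t, x))) = 0"
      proof (rule integral_derivative_eq_0[of "\<lambda>x. U (t, x) * partial_x \<phi> (t, x) - V (t, x) * \<phi> (t, x)" _ R])
        fix x assume "\<bar>x\<bar> > R"
        then show "V (t, x) * partial_x \<phi> (t, x) + partial_x (partial_x \<phi>) (t, x) * U (t, x) - (W (t, x) * \<phi> (t, x) + partial_x \<phi> (t, x) * V (t, x)) = 0"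
        proof -
          have "\<not> (t \<in> {a..b} \<and> x \<in> {-R..R})" using \<open>\<bar>x\<bar> > R\<close> by auto
          then have "partial_x (partial_x \<phi>) (t, x) = 0" using \<psi>[of "partial_x (partial_x \<phi>)"] by blast
          then show ?thesis using \<phi>0[of t x] \<phi>x0[of x t] \<open>\<bar>x\<bar> > R\<close> by simp
        qed
      next
        show "((\<lambda>x. U (t, x) * partial_x \<phi> (t, x) - V (t, x) * \<phi> (t, x)) has_real_derivative
          (V (t, x) * partial_x \<phi> (t, x) + partial_x (partial_x \<phi>) (t, x) * U (t, x)) - (W (t, x) * \<phi> (t, x) + partial_x \<phi> (t, x) * V (t, x))) (at x)" for x
          by (intro DERIV_diff DERIV_mult Ux Vx dphi) (use True in auto)
        show "continuous_on UNIV (\<lambda>x. (V (t, x) * partial_x \<phi> (t, x) + partial_x (partial_x \<phi>) (t, x) * U (t, x)) - (W (t, x) * \<phi> (t, x) + partial_x \<phi> (t, x) * V (t, x)))"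
          by (intro continuous_on_add continuous_on_diff continuous_on_mult cU cV cW cphis) (use True in auto)
      qed (use abR \<phi>0 \<phi>x0' in auto)
      then have "(LINT x|lborel. U (t, x) * partial_x (partial_x \<phi>) (t, x) - W (t, x) * \<phi> (t, x)) = 0"
        by (simp add: algebra_simps)
      then show ?thesis using True by (simp add: J2_def ind)
    qed (simp add: J2_def ind)
    then have J2: "(LINT z|lborel. J2 z) = 0" by (simp add: integral_lborel_prod(1)[OF iJ2])
    have "AE x in lborel. (LINT t|lborel. J1 (t, x)) = 0"
      using integral_lborel_prod_swap(2)[OF iJ1]
    proof eventually_elim
      case (elim x)
      \<comment> \<open>This version of the fundamental theorem tolerates the finite exceptional
        set; the boundary values vanish with \<phi>.\<close>
      have "((\<lambda>t. - J1 (t, x)) has_integral (U (b, x) * \<phi> (b, x) - U (a, x) * \<phi> (a, x))) {a..b}"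
      proof (rule fundamental_theorem_of_calculus_interior_strong[OF S])
        fix t assume t: "t \<in> {a<..<b} - S"
        then have t': "0 < t" "t < 1" "t \<notin> S" using abR by auto
        have "((\<lambda>t. U (t, x) * \<phi> (t, x)) has_real_derivative - (?Q t / 2 * (W (t, x) + m t * (V (t, x))\<^sup>2)) * \<phi> (t, x) + partial_r \<phi> (t, x) * U (t, x)) (at t)"
          by (intro DERIV_mult Ut t' smooth2_partial_r[OF s])
        then show "((\<lambda>t. U (t, x) * \<phi> (t, x)) has_vector_derivative - J1 (t, x)) (at t)"
          using t' by (simp add: has_real_derivative_iff_has_vector_derivative[symmetric] J1_def ind algebra_simps)
      next
        have "continuous_on {a..b} (\<lambda>t. \<phi> (t, x))"
          by (rule continuous_on_compose2[OF smooth2_continuous[OF s]]) (auto intro!: continuous_intros)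
        moreover have "continuous_on {a..b} (\<lambda>t. U (t, x))"
          by (rule continuous_on_compose2[OF U]) (use abR in \<open>auto intro!: continuous_intros simp: closed_strip_def\<close>)
        ultimately show "continuous_on {a..b} (\<lambda>t. U (t, x) * \<phi> (t, x))" by (intro continuous_intros)
      qed (use abR in simp)
      then have h0: "((\<lambda>t. - J1 (t, x)) has_integral 0) {a..b}" using \<phi>0[of a x] \<phi>0[of b x] by simp
      have z: "- J1 (t, x) = 0" if "t \<notin> {a..b}" for t
        using that \<phi>0[of t x] \<psi>[of "partial_r \<phi>"] by (auto simp: J1_def)
      have h1: "((\<lambda>t. - J1 (t, x)) has_integral 0) UNIV"
        by (rule has_integral_on_superset[OF h0 z subset_UNIV])
      have h2: "((\<lambda>t. - J1 (t, x)) has_integral (LINT t|lborel. - J1 (t, x))) UNIV"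
        using elim by (intro has_integral_integral_lborel) auto
      show ?case using has_integral_unique[OF h1 h2] by simp
    qed
    then have J1: "(LINT z|lborel. J1 z) = 0"
      unfolding integral_lborel_prod_swap(1)[OF iJ1] by (rule integral_eq_zero_AE)
    have "(LINT z:open_strip|lborel. - U z * partial_r \<phi> z + ?Q (fst z) / 2 * (U z * partial_x (partial_x \<phi>) z + measure \<mu> {0..fst z} * (v z)\<^sup>2 * \<phi> z))
      = (LINT z|lborel. J1 z + J2 z)"
      unfolding set_lebesgue_integral_def
    proof (rule Bochner_Integration.integral_cong[OF refl])
      fix z :: "real \<times> real"
      show "indicator open_strip z *\<^sub>R (- U z * partial_r \<phi> z + ?Q (fst z) / 2 * (U z * partial_x (partial_x \<phi>) z + measure \<mu> {0..fst z} * (v z)\<^sup>2 * \<phi> z)) = J1 z + J2 z"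
      proof (cases "z \<in> open_strip")
        case True
        then have "measure \<mu> {0..fst z} = m (fst z)" using \<mu>[of "fst z"] by (cases z) (auto simp: open_strip_def)
        then show ?thesis using True by (simp add: J1_def J2_def v_def algebra_simps)
      qed (simp add: J1_def J2_def)
    qed
    then show ?thesis using first J1 J2 iJ1 iJ2 by simp
  qed
  have r: "(LINT z:open_strip|lborel. F z (restrict U closed_strip z)) = (LINT z:open_strip|lborel. F z (U z))" for F :: "real \<times> real \<Rightarrow> real \<Rightarrow> real"
    using sub by (intro set_lebesgue_integral_cong) (auto simp: subset_iff)
  show ?thesis
    unfolding parisi_weak_solution_def weak_partial_x_def
  proof (intro conjI allI exI[of _ v] exI[of _ B] impI)
    show "restrict U closed_strip \<in> extensional closed_strip" by simp
    show "continuous_on closed_strip (restrict U closed_strip)"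
      using U by (simp cong: continuous_on_cong)
    show "restrict U closed_strip (1, x) = ln (cosh x)" for x using U1 by (simp add: closed_strip_def)
    show "v \<in> borel_measurable lborel" by simp
    show "AE z in lborel. z \<in> open_strip \<longrightarrow> \<bar>v z\<bar> \<le> B"
      using Vb by (intro AE_I2) (auto simp: v_def open_strip_def)
    fix \<phi> assume t: "test_function \<phi>"
    show "(LINT z:open_strip|lborel. restrict U closed_strip z * partial_x \<phi> z) = - (LINT z:open_strip|lborel. v z * \<phi> z)"
      using main[OF t] r[of "\<lambda>z u. u * partial_x \<phi> z"] by simp
    show "(LINT z:open_strip|lborel. - restrict U closed_strip z * partial_r \<phi> z + ?Q (fst z) / 2 * (restrict U closed_strip z * partial_x (partial_x \<phi>) z + measure \<mu> {0..fst z} * (v z)\<^sup>2 * \<phi> z)) = 0"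
      using main[OF t] r[of "\<lambda>z u. - u * partial_r \<phi> z + ?Q (fst z) / 2 * (u * partial_x (partial_x \<phi>) z + measure \<mu> {0..fst z} * (v z)\<^sup>2 * \<phi> z)"] by simp
  qed
qed

lemma parisi_u_eqI:
  assumes "mixed_pspin_model \<xi>0"
    and "m \<in> borel_measurable borel" "\<And>t. 0 \<le> m t \<and> m t \<le> 1"
    and "\<And>t. 0 < t \<Longrightarrow> t < 1 \<Longrightarrow> measure \<mu> {0..t} = m t"
    and "parisi_weak_solution \<xi>0 \<beta> \<mu> u"
  shows "parisi_u \<xi>0 \<beta> \<mu> = u"
  unfolding parisi_u_def using assms parisi_weak_solution_unique[OF assms(1-4)] by (intro the_equality) auto

section \<open>Gaussian smoothing\<close>

abbreviation gauss :: "real measure" where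
  "gauss \<equiv> density lborel std_normal_density"

interpretation gauss: prob_space gauss
  by (rule prob_space_normal_density) simp

lemma gauss_integral:
  assumes [measurable]: "f \<in> borel_measurable borel"
  shows "(LINT z|gauss. f z) = (LINT z|lborel. std_normal_density z * f z :: real)"
    and "integrable gauss f \<longleftrightarrow> integrable lborel (\<lambda>z. std_normal_density z * f z)"
  by (simp_all add: integral_density integrable_density)

lemma gauss_exp:
  "integrable gauss (\<lambda>z. exp (c * z))" "(LINT z|gauss. exp (c * z)) = exp (c\<^sup>2 / 2)"
proof -
  have "std_normal_density z * exp (c * z) = exp (c\<^sup>2 / 2) * normal_density c 1 z" for z
    by (simp add: normal_density_def exp_add[symmetric] exp_diff[symmetric] field_simps power2_eq_square)
  then show "integrable gauss (\<lambda>z. exp (c * z))" "(LINT z|gauss. exp (c * z)) = exp (c\<^sup>2 / 2)"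
    by (simp_all add: gauss_integral)
qed

lemma gauss_exp_abs: "integrable gauss (\<lambda>z. exp (c * \<bar>z\<bar>))"
proof (rule Bochner_Integration.integrable_bound)
  show "integrable gauss (\<lambda>z. exp (c * z) + exp (- c * z))"
    by (intro Bochner_Integration.integrable_add gauss_exp)
  show "AE z in gauss. norm (exp (c * \<bar>z\<bar>)) \<le> norm (exp (c * z) + exp (- c * z))"
  proof (intro always_eventually allI)
    fix z
    have "exp (c * \<bar>z\<bar>) \<le> exp (c * z) + exp (- c * z)" by (cases "z \<ge> 0") auto
    then show "norm (exp (c * \<bar>z\<bar>)) \<le> norm (exp (c * z) + exp (- c * z))" by simp
  qed
qed simp

definition exp_bounded :: "(real \<Rightarrow> real) \<Rightarrow> bool" where
  "exp_bounded G \<longleftrightarrow> (\<exists>K\<ge>0. \<forall>y. \<bar>G y\<bar> \<le> K * exp \<bar>y\<bar>)"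

text \<open>The heat semigroup at time \<open>s\<close>, normalised so that its generator is half
  the second derivative.\<close>

definition smoothing :: "real \<Rightarrow> (real \<Rightarrow> real) \<Rightarrow> real \<Rightarrow> real" where
  "smoothing s G x = (LINT z|gauss. G (x + sqrt s * z))"

text \<open>A majorant uniform over bounded shifts and scales and integrable under the Gaussian law;
  it dominates every limit and derivative taken under the integral.\<close>

lemma exp_bounded_shift:
  assumes "exp_bounded G"
  obtains K where "K \<ge> 0" "\<And>x r z. \<bar>x\<bar> \<le> B \<Longrightarrow> \<bar>r\<bar> \<le> B \<Longrightarrow> \<bar>G (x + r * z)\<bar> \<le> K * exp (B * \<bar>z\<bar>)"
proof -
  obtain K where K: "K \<ge> 0" "\<And>y. \<bar>G y\<bar> \<le> K * exp \<bar>y\<bar>" using assms by (auto simp: exp_bounded_def)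
  show ?thesis
  proof (rule that[of "K * exp B"])
    fix x r z :: real assume *: "\<bar>x\<bar> \<le> B" "\<bar>r\<bar> \<le> B"
    have "\<bar>r * z\<bar> \<le> B * \<bar>z\<bar>" unfolding abs_mult by (intro mult_right_mono *) simp
    then have "\<bar>x + r * z\<bar> \<le> B + B * \<bar>z\<bar>" using *(1) by linarith
    then have "K * exp \<bar>x + r * z\<bar> \<le> K * exp (B + B * \<bar>z\<bar>)" using K(1) by (intro mult_left_mono) auto
    then show "\<bar>G (x + r * z)\<bar> \<le> K * exp B * exp (B * \<bar>z\<bar>)"
      using K(2)[of "x + r * z"] by (simp add: exp_add mult.assoc)
  qed (use K in simp)
qed

lemma smoothing_integrable:
  assumes "continuous_on UNIV G" "exp_bounded G"
  shows "integrable gauss (\<lambda>z. G (x + r * z))"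
proof -
  have [measurable]: "G \<in> borel_measurable borel" by (rule borel_measurable_continuous_onI[OF assms(1)])
  obtain K where K: "K \<ge> 0" "\<And>x' r' z. \<bar>x'\<bar> \<le> max \<bar>x\<bar> \<bar>r\<bar> \<Longrightarrow> \<bar>r'\<bar> \<le> max \<bar>x\<bar> \<bar>r\<bar> \<Longrightarrow> \<bar>G (x' + r' * z)\<bar> \<le> K * exp (max \<bar>x\<bar> \<bar>r\<bar> * \<bar>z\<bar>)"
    using exp_bounded_shift[OF assms(2), of "max \<bar>x\<bar> \<bar>r\<bar>"] by blast
  show ?thesis
  proof (rule Bochner_Integration.integrable_bound)
    show "integrable gauss (\<lambda>z. K * exp (max \<bar>x\<bar> \<bar>r\<bar> * \<bar>z\<bar>))"
      by (intro integrable_mult_right gauss_exp_abs)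
    show "AE z in gauss. norm (G (x + r * z)) \<le> norm (K * exp (max \<bar>x\<bar> \<bar>r\<bar> * \<bar>z\<bar>))"
      using K by (intro always_eventually allI) simp
  qed simp
qed

lemma smoothing_0: "smoothing 0 G x = G x"
  using gauss.prob_space by (simp add: smoothing_def)

lemma smoothing_continuous:
  assumes G: "continuous_on UNIV G" "exp_bounded G"
    and s: "continuous_on A s" and x: "continuous_on A x" and pos: "\<And>z. z \<in> A \<Longrightarrow> s z \<ge> 0"
  shows "continuous_on A (\<lambda>z :: 'a :: {first_countable_topology, t2_space}. smoothing (s z) G (x z))"
proof (rule continuous_on_sequentiallyI)
  fix u a assume u: "\<forall>n. u n \<in> A" "a \<in> A" "u \<longlonglongrightarrow> a"
  have [measurable]: "G \<in> borel_measurable borel" by (rule borel_measurable_continuous_onI[OF G(1)])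
  have lim: "(\<lambda>n. s (u n)) \<longlonglongrightarrow> s a" "(\<lambda>n. x (u n)) \<longlonglongrightarrow> x a"
    using s x u unfolding continuous_on_sequentially comp_def by blast+
  have lim': "(\<lambda>n. sqrt (s (u n))) \<longlonglongrightarrow> sqrt (s a)" by (intro tendsto_real_sqrt lim)
  obtain B1 where B1: "\<And>n. \<bar>x (u n)\<bar> \<le> B1"
    using lim(2) Bseq_def convergent_imp_Bseq convergentI real_norm_def by metis
  obtain B2 where B2: "\<And>n. \<bar>sqrt (s (u n))\<bar> \<le> B2"
    using lim' Bseq_def convergent_imp_Bseq convergentI real_norm_def by metis
  define B where "B = max B1 B2"
  obtain K where K: "K \<ge> 0" "\<And>x r z. \<bar>x\<bar> \<le> B \<Longrightarrow> \<bar>r\<bar> \<le> B \<Longrightarrow> \<bar>G (x + r * z)\<bar> \<le> K * exp (B * \<bar>z\<bar>)"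
    using exp_bounded_shift[OF G(2), of B] by blast
  show "(\<lambda>n. smoothing (s (u n)) G (x (u n))) \<longlonglongrightarrow> smoothing (s a) G (x a)"
    unfolding smoothing_def
  proof (rule integral_dominated_convergence)
    show "integrable gauss (\<lambda>z. K * exp (B * \<bar>z\<bar>))" by (intro integrable_mult_right gauss_exp_abs)
    show "AE z in gauss. (\<lambda>n. G (x (u n) + sqrt (s (u n)) * z)) \<longlonglongrightarrow> G (x a + sqrt (s a) * z)"
    proof (intro always_eventually allI)
      fix z
      have "(\<lambda>n. x (u n) + sqrt (s (u n)) * z) \<longlonglongrightarrow> x a + sqrt (s a) * z" by (intro tendsto_intros lim lim')
      then show "(\<lambda>n. G (x (u n) + sqrt (s (u n)) * z)) \<longlonglongrightarrow> G (x a + sqrt (s a) * z)"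
        using G(1) by (auto simp: continuous_on_eq_continuous_at intro: isCont_tendsto_compose)
    qed
    show "AE z in gauss. norm (G (x (u n) + sqrt (s (u n)) * z)) \<le> K * exp (B * \<bar>z\<bar>)" for n
      using K(2)[of "x (u n)" "sqrt (s (u n))"] B1[of n] B2[of n] by (intro always_eventually allI) (auto simp: B_def)
  qed simp_all
qed

section \<open>Gaussian integration by parts and the heat equation for the smoothing\<close>

lemma has_derivative_under_integral:
  fixes F F' :: "real \<Rightarrow> 'a \<Rightarrow> real"
  assumes U: "y0 \<in> {a<..<b}"
    and deriv: "\<And>y z. y \<in> {a<..<b} \<Longrightarrow> ((\<lambda>y. F y z) has_real_derivative F' y z) (at y)"
    and bound: "\<And>y z. y \<in> {a<..<b} \<Longrightarrow> \<bar>F' y z\<bar> \<le> B z" and B: "integrable M B"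
    and F: "\<And>y. y \<in> {a<..<b} \<Longrightarrow> integrable M (F y)" and F'm: "F' y0 \<in> borel_measurable M"
  shows "((\<lambda>y. LINT z|M. F y z) has_real_derivative (LINT z|M. F' y0 z)) (at y0)"
proof -
  have "((\<lambda>y. ((LINT z|M. F y z) - (LINT z|M. F y0 z)) / (y - y0)) \<longlongrightarrow> (LINT z|M. F' y0 z)) (at y0 within {a<..<b})"
    unfolding tendsto_at_iff_sequentially comp_def
  proof (intro allI impI)
    fix X :: "nat \<Rightarrow> real" assume X: "\<forall>i. X i \<in> {a<..<b} - {y0}" and lim: "X \<longlonglongrightarrow> y0"
    have eq: "((LINT z|M. F (X n) z) - (LINT z|M. F y0 z)) / (X n - y0) = (LINT z|M. (F (X n) z - F y0 z) / (X n - y0))" for n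
      using F[of "X n"] F[OF U] X by (simp add: Bochner_Integration.integral_diff)
    show "(\<lambda>n. ((LINT z|M. F (X n) z) - (LINT z|M. F y0 z)) / (X n - y0)) \<longlonglongrightarrow> (LINT z|M. F' y0 z)"
      unfolding eq
    proof (rule integral_dominated_convergence[OF _ _ B])
      show "AE z in M. (\<lambda>n. (F (X n) z - F y0 z) / (X n - y0)) \<longlonglongrightarrow> F' y0 z"
      proof (intro always_eventually allI)
        fix z
        have "((\<lambda>y. (F y z - F y0 z) / (y - y0)) \<longlongrightarrow> F' y0 z) (at y0)"
          using deriv[OF U, of z] by (simp add: has_field_derivative_iff)
        then show "(\<lambda>n. (F (X n) z - F y0 z) / (X n - y0)) \<longlonglongrightarrow> F' y0 z"
          using X lim unfolding tendsto_at_iff_sequentially comp_def by blast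
      qed
      show "AE z in M. norm ((F (X n) z - F y0 z) / (X n - y0)) \<le> B z" for n
      proof (intro always_eventually allI)
        fix z
        have "norm (F (X n) z - F y0 z) \<le> B z * norm (X n - y0)"
        proof (rule field_differentiable_bound[where S="{a<..<b}"])
          show "((\<lambda>y. F y z) has_field_derivative F' y z) (at y within {a<..<b})" if "y \<in> {a<..<b}" for y
            using deriv[OF that] by (rule has_field_derivative_at_within)
        qed (use X U bound in auto)
        then show "norm ((F (X n) z - F y0 z) / (X n - y0)) \<le> B z"
          using X by (simp add: divide_le_eq)
      qed
      show "F' y0 \<in> borel_measurable M" by (rule F'm)
      show "(\<lambda>z. (F (X n) z - F y0 z) / (X n - y0)) \<in> borel_measurable M" for n
        using F[of "X n"] F[OF U] X by auto
    qed
  qed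
  then show ?thesis
    using U by (simp add: has_field_derivative_iff at_within_open[of y0 "{a<..<b}"])
qed

lemma smoothing_has_derivative_x:
  assumes d: "\<And>y. (G has_real_derivative G' y) (at y)" and G: "exp_bounded G" "exp_bounded G'"
    and c: "continuous_on UNIV G'"
  shows "((\<lambda>x. smoothing s G x) has_real_derivative smoothing s G' x) (at x)"
proof -
  have cG: "continuous_on UNIV G"
    using d by (intro continuous_at_imp_continuous_on ballI DERIV_isCont) blast
  have [measurable]: "G' \<in> borel_measurable borel" by (rule borel_measurable_continuous_onI[OF c])
  define B where "B = max (\<bar>x\<bar> + 1) \<bar>sqrt s\<bar>"
  obtain K where K: "K \<ge> 0" "\<And>x r z. \<bar>x\<bar> \<le> B \<Longrightarrow> \<bar>r\<bar> \<le> B \<Longrightarrow> \<bar>G' (x + r * z)\<bar> \<le> K * exp (B * \<bar>z\<bar>)"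
    using exp_bounded_shift[OF G(2), of B] by blast
  show ?thesis
    unfolding smoothing_def
  proof (rule has_derivative_under_integral[where a="x - 1" and b="x + 1"])
    show "((\<lambda>y. G (y + sqrt s * z)) has_real_derivative G' (y + sqrt s * z)) (at y)" for y z
      using d[of "y + sqrt s * z"] unfolding DERIV_shift .
    show "\<bar>G' (y + sqrt s * z)\<bar> \<le> K * exp (B * \<bar>z\<bar>)" if "y \<in> {x - 1<..<x + 1}" for y z
      using that by (intro K) (auto simp: B_def)
    show "integrable gauss (\<lambda>z. K * exp (B * \<bar>z\<bar>))" by (intro integrable_mult_right gauss_exp_abs)
    show "integrable gauss (\<lambda>z. G (y + sqrt s * z))" for y by (rule smoothing_integrable[OF cG G(1)])
  qed simp_all
qed

text \<open>The Gaussian density times \<open>H\<close> has derivative density times (H' - z H), and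
  the growth bound makes it vanish at infinity, so the integral of this derivative is 0.\<close>

lemma stein:
  assumes d: "\<And>y. (H has_real_derivative H' y) (at y)" and c: "continuous_on UNIV H'"
    and b: "\<And>z. \<bar>H z\<bar> \<le> K * exp (B * \<bar>z\<bar>)" "\<And>z. \<bar>H' z\<bar> \<le> K * exp (B * \<bar>z\<bar>)" and B: "B \<ge> 0"
  shows "(LINT z|gauss. H z * z) = (LINT z|gauss. H' z)"
proof -
  have cH: "continuous_on UNIV H"
    using d by (intro continuous_at_imp_continuous_on ballI DERIV_isCont) blast
  have [measurable]: "H \<in> borel_measurable borel" "H' \<in> borel_measurable borel"
    by (rule borel_measurable_continuous_onI[OF cH], rule borel_measurable_continuous_onI[OF c])
  have K: "K \<ge> 0" using b(1)[of 0] abs_ge_zero[of "H 0"] by (simp del: abs_ge_zero)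
  have i1: "integrable gauss H'"
    by (rule Bochner_Integration.integrable_bound[OF integrable_mult_right[OF gauss_exp_abs[of B], of K]])
       (use b K in \<open>auto intro!: always_eventually\<close>)
  have i2: "integrable gauss (\<lambda>z. H z * z)"
  proof (rule Bochner_Integration.integrable_bound[OF integrable_mult_right[OF gauss_exp_abs[of "B + 1"], of K]])
    have "\<bar>H z * z\<bar> \<le> K * exp (B * \<bar>z\<bar>) * exp \<bar>z\<bar>" for z
    proof -
      have "\<bar>z\<bar> \<le> exp \<bar>z\<bar>" using exp_ge_add_one_self[of "\<bar>z\<bar>"] by linarith
      then show ?thesis unfolding abs_mult using K by (intro mult_mono b) auto
    qed
    then show "AE z in gauss. norm (H z * z) \<le> norm (K * exp ((B + 1) * \<bar>z\<bar>))"
      using K by (intro always_eventually allI) (simp add: distrib_right exp_add mult.assoc)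
  qed simp
  define D where "D = (\<lambda>z. std_normal_density z * (H' z - H z * z))"
  have D_int: "integrable lborel D"
    unfolding D_def using Bochner_Integration.integrable_diff[OF i1 i2] by (subst (asm) gauss_integral(2)) simp_all
  have dD: "((\<lambda>z. std_normal_density z * H z) has_real_derivative D z) (at z)" for z
  proof -
    have "((\<lambda>z. exp (- z\<^sup>2 / 2)) has_real_derivative - z * exp (- z\<^sup>2 / 2)) (at z)"
      by (auto intro!: derivative_eq_intros)
    from DERIV_cmult[OF this, of "1 / sqrt (2 * pi)"]
    have "(std_normal_density has_real_derivative - z * std_normal_density z) (at z)"
      by (simp add: std_normal_density_def[abs_def])
    from DERIV_mult[OF this d[of z]] show ?thesis unfolding D_def by (simp add: algebra_simps)
  qed
  have nd: "continuous_on UNIV std_normal_density"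
    unfolding normal_density_def by (intro continuous_intros) auto
  have "(\<lambda>n. LINT z|lborel. D z * indicator {- real n..real n} z) \<longlonglongrightarrow> (LINT z|lborel. D z)"
  proof (rule integral_dominated_convergence[where w="\<lambda>z. \<bar>D z\<bar>"])
    show "AE z in lborel. (\<lambda>n. D z * indicator {- real n..real n} z) \<longlonglongrightarrow> D z"
    proof (rule AE_I2, rule tendsto_eventually)
      fix z
      show "\<forall>\<^sub>F n in sequentially. D z * indicator {- real n..real n} z = D z"
      proof (rule eventually_mono[OF eventually_ge_at_top[of "nat \<lceil>\<bar>z\<bar>\<rceil>"]])
        fix n assume "nat \<lceil>\<bar>z\<bar>\<rceil> \<le> n"
        then have "\<bar>z\<bar> \<le> real n" by linarith
        then show "D z * indicator {- real n..real n} z = D z" by (simp add: abs_le_iff)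
      qed
    qed
  qed (use D_int in \<open>auto simp: indicator_def\<close>)
  moreover have "(LINT z|lborel. D z * indicator {- real n..real n} z) = std_normal_density (real n) * H (real n) - std_normal_density (- real n) * H (- real n)" for n
  proof (rule integral_FTC_Icc_real)
    have "continuous_on UNIV D" unfolding D_def by (intro continuous_intros nd cH c)
    then show "isCont D x" for x by (simp add: continuous_on_eq_continuous_at)
  qed (use dD in auto)
  moreover have lim0: "(\<lambda>n. std_normal_density (\<sigma> * real n) * H (\<sigma> * real n)) \<longlonglongrightarrow> 0" if \<sigma>: "\<bar>\<sigma>\<bar> = 1" for \<sigma>
  proof (rule Lim_null_comparison)
    have "\<sigma>\<^sup>2 = 1" using \<sigma> by (metis power2_abs power_one)
    have "\<bar>std_normal_density (\<sigma> * real n) * H (\<sigma> * real n)\<bar> \<le> (1 / sqrt (2 * pi) * exp (- (real n)\<^sup>2 / 2)) * (K * exp (B * real n))" for n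
      unfolding abs_mult using b(1)[of "\<sigma> * real n"] \<sigma> \<open>\<sigma>\<^sup>2 = 1\<close>
      by (intro mult_mono) (auto simp: abs_mult normal_density_def power_mult_distrib)
    then show "\<forall>\<^sub>F n in sequentially. norm (std_normal_density (\<sigma> * real n) * H (\<sigma> * real n)) \<le> (1 / sqrt (2 * pi) * exp (- (real n)\<^sup>2 / 2)) * (K * exp (B * real n))"
      by (intro always_eventually allI) simp
    have "(\<lambda>n. exp (- (real n)\<^sup>2 / 2) * exp (B * real n)) \<longlonglongrightarrow> 0"
    proof (rule Lim_null_comparison)
      \<comment> \<open>Expanding (n - (B + 1))^2 \<ge> 0 leaves the decaying factor exp(-n) after
        the Gaussian has absorbed exp(B n).\<close>
      have "- (real n)\<^sup>2 / 2 + B * real n \<le> (B + 1)\<^sup>2 / 2 - real n" for n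
        using zero_le_power2[of "real n - (B + 1)"] by (simp add: power2_eq_square field_simps)
      then show "\<forall>\<^sub>F n in sequentially. norm (exp (- (real n)\<^sup>2 / 2) * exp (B * real n)) \<le> exp ((B + 1)\<^sup>2 / 2) * exp (- real n)"
        by (intro always_eventually allI) (simp flip: exp_add)
      have "(\<lambda>n. exp (- real n)) \<longlonglongrightarrow> 0" by real_asymp
      from tendsto_mult_right_zero[OF this] show "(\<lambda>n. exp ((B + 1)\<^sup>2 / 2) * exp (- real n)) \<longlonglongrightarrow> 0" .
    qed
    from tendsto_mult_right[OF this, of "1 / sqrt (2 * pi) * K"]
    show "(\<lambda>n. (1 / sqrt (2 * pi) * exp (- (real n)\<^sup>2 / 2)) * (K * exp (B * real n))) \<longlonglongrightarrow> 0"
      by (simp add: mult_ac)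
  qed
  then have "(\<lambda>n. std_normal_density (real n) * H (real n) - std_normal_density (- real n) * H (- real n)) \<longlonglongrightarrow> 0 - 0"
    using lim0[of 1] lim0[of "-1"] by (intro tendsto_diff) simp_all
  ultimately have "(LINT z|lborel. D z) = 0" using LIMSEQ_unique by fastforce
  moreover have "(LINT z|lborel. D z) = (LINT z|gauss. H' z - H z * z)"
    unfolding D_def by (subst gauss_integral(1)) simp_all
  ultimately show ?thesis using i1 i2 by simp
qed

text \<open>Differentiating sqrt s produces a factor z / (2 sqrt s). Stein's identity exchanges z
  for sqrt s and one more derivative of G, which leaves half the smoothing of
  \<open>G''\<close>.\<close>

lemma smoothing_has_derivative_s:
  assumes d: "\<And>y. (G has_real_derivative G' y) (at y)" "\<And>y. (G' has_real_derivative G'' y) (at y)"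
    and G: "exp_bounded G" "exp_bounded G'" "exp_bounded G''"
    and c: "continuous_on UNIV G''" and s: "s > 0"
  shows "((\<lambda>s. smoothing s G x) has_real_derivative smoothing s G'' x / 2) (at s)"
proof -
  have cG: "continuous_on UNIV G" and cG': "continuous_on UNIV G'"
    using d by (intro continuous_at_imp_continuous_on ballI DERIV_isCont; blast)+
  have [measurable]: "G \<in> borel_measurable borel" "G' \<in> borel_measurable borel" "G'' \<in> borel_measurable borel"
    by (rule borel_measurable_continuous_onI[OF cG], rule borel_measurable_continuous_onI[OF cG'], rule borel_measurable_continuous_onI[OF c])
  \<comment> \<open>sqrt (2 s) bounds every scale sqrt y for y in the neighbourhood (s/2, 2s) used
    for differentiation.\<close>
  define B where "B = max \<bar>x\<bar> (sqrt (2 * s))"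
  have B0: "B \<ge> 0" by (simp add: B_def)
  obtain K where K: "K \<ge> 0" "\<And>x r z. \<bar>x\<bar> \<le> B \<Longrightarrow> \<bar>r\<bar> \<le> B \<Longrightarrow> \<bar>G' (x + r * z)\<bar> \<le> K * exp (B * \<bar>z\<bar>)"
    using exp_bounded_shift[OF G(2), of B] by blast
  obtain K2 where K2: "K2 \<ge> 0" "\<And>x r z. \<bar>x\<bar> \<le> B \<Longrightarrow> \<bar>r\<bar> \<le> B \<Longrightarrow> \<bar>G'' (x + r * z)\<bar> \<le> K2 * exp (B * \<bar>z\<bar>)"
    using exp_bounded_shift[OF G(3), of B] by blast
  have "((\<lambda>s. LINT z|gauss. G (x + sqrt s * z)) has_real_derivative (LINT z|gauss. G' (x + sqrt s * z) * (z * (inverse (sqrt s) / 2)))) (at s)"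
  proof (rule has_derivative_under_integral[where a="s / 2" and b="2 * s" and F'="\<lambda>s z. G' (x + sqrt s * z) * (z * (inverse (sqrt s) / 2))"
        and B="\<lambda>z. K * (inverse (sqrt (s / 2)) / 2) * exp ((B + 1) * \<bar>z\<bar>)"])
    show "s \<in> {s / 2<..<2 * s}" using s by simp
    fix y z assume y: "y \<in> {s / 2<..<2 * s}"
    then have y0: "y > 0" using s by auto
    have "((\<lambda>y. x + sqrt y * z) has_real_derivative z * (inverse (sqrt y) / 2)) (at y)"
      using y0 by (auto intro!: derivative_eq_intros)
    from DERIV_chain2[OF d(1) this]
    show "((\<lambda>y. G (x + sqrt y * z)) has_real_derivative G' (x + sqrt y * z) * (z * (inverse (sqrt y) / 2))) (at y)" .
    have "\<bar>G' (x + sqrt y * z)\<bar> \<le> K * exp (B * \<bar>z\<bar>)"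
      using y y0 by (intro K) (auto simp: B_def le_max_iff_disj)
    moreover have "\<bar>z\<bar> \<le> exp \<bar>z\<bar>" using exp_ge_add_one_self[of "\<bar>z\<bar>"] by linarith
    moreover have "inverse (sqrt y) \<le> inverse (sqrt (s / 2))"
      using y s by (intro le_imp_inverse_le) auto
    ultimately have "\<bar>G' (x + sqrt y * z)\<bar> * (\<bar>z\<bar> * (inverse (sqrt y) / 2)) \<le> (K * exp (B * \<bar>z\<bar>)) * (exp \<bar>z\<bar> * (inverse (sqrt (s / 2)) / 2))"
      using y0 K(1) by (intro mult_mono) auto
    note le = this
    show "\<bar>G' (x + sqrt y * z) * (z * (inverse (sqrt y) / 2))\<bar> \<le> K * (inverse (sqrt (s / 2)) / 2) * exp ((B + 1) * \<bar>z\<bar>)"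
    proof -
      have e: "exp ((B + 1) * \<bar>z\<bar>) = exp (B * \<bar>z\<bar>) * exp \<bar>z\<bar>" by (simp add: distrib_right exp_add)
      show ?thesis using y0 le unfolding e by (simp add: abs_mult mult_ac)
    qed
  next
    show "integrable gauss (\<lambda>z. K * (inverse (sqrt (s / 2)) / 2) * exp ((B + 1) * \<bar>z\<bar>))"
      by (intro integrable_mult_right gauss_exp_abs)
    show "integrable gauss (\<lambda>z. G (x + sqrt y * z))" for y by (rule smoothing_integrable[OF cG G(1)])
  qed simp
  moreover have "(LINT z|gauss. G' (x + sqrt s * z) * (z * (inverse (sqrt s) / 2))) = smoothing s G'' x / 2"
  proof -
    have sB: "\<bar>sqrt s\<bar> \<le> B" using s by (auto simp: B_def le_max_iff_disj)
    have xB: "\<bar>x\<bar> \<le> B" by (simp add: B_def)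
    have "(LINT z|gauss. G' (x + sqrt s * z) * z) = (LINT z|gauss. G'' (x + sqrt s * z) * sqrt s)"
    proof (rule stein[where K="max K (K2 * sqrt s)" and B=B])
      fix z
      have "((\<lambda>z. x + sqrt s * z) has_real_derivative sqrt s) (at z)" by (auto intro!: derivative_eq_intros)
      from DERIV_chain2[OF d(2) this]
      show "((\<lambda>z. G' (x + sqrt s * z)) has_real_derivative G'' (x + sqrt s * z) * sqrt s) (at z)" .
      show "\<bar>G' (x + sqrt s * z)\<bar> \<le> max K (K2 * sqrt s) * exp (B * \<bar>z\<bar>)"
        by (rule order_trans[OF K(2)[OF xB sB]]) (intro mult_right_mono, auto)
      have "\<bar>G'' (x + sqrt s * z) * sqrt s\<bar> \<le> (K2 * exp (B * \<bar>z\<bar>)) * sqrt s"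
        unfolding abs_mult using s K2(2)[OF xB sB, of z] by (simp add: mult_right_mono)
      also have "\<dots> = (K2 * sqrt s) * exp (B * \<bar>z\<bar>)" by simp
      also have "\<dots> \<le> max K (K2 * sqrt s) * exp (B * \<bar>z\<bar>)" by (intro mult_right_mono) auto
      finally show "\<bar>G'' (x + sqrt s * z) * sqrt s\<bar> \<le> max K (K2 * sqrt s) * exp (B * \<bar>z\<bar>)" .
    next
      show "continuous_on UNIV (\<lambda>z. G'' (x + sqrt s * z) * sqrt s)"
        by (intro continuous_intros continuous_on_compose2[OF c]) auto
    qed (rule B0)
    then have "(LINT z|gauss. G' (x + sqrt s * z) * z) = sqrt s * (LINT z|gauss. G'' (x + sqrt s * z))" by (simp add: mult.commute)
    moreover have "(LINT z|gauss. G' (x + sqrt s * z) * (z * (inverse (sqrt s) / 2))) = (LINT z|gauss. G' (x + sqrt s * z) * z) * (inverse (sqrt s) / 2)"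
      by (simp add: mult.assoc[symmetric])
    ultimately show ?thesis using s by (simp add: smoothing_def field_simps)
  qed
  ultimately show ?thesis unfolding smoothing_def by simp
qed

section \<open>The Parisi functional at Dirac masses and at a two-point measure\<close>

definition lncosh :: "real \<Rightarrow> real" where "lncosh x = ln (cosh x)"

definition sech2 :: "real \<Rightarrow> real" where "sech2 x = 1 - (tanh x)\<^sup>2"

text \<open>Terminal value of exp(u/2): Cole-Hopf data for a distribution function equal to
  1/2.\<close>

definition sqrtcosh :: "real \<Rightarrow> real" where "sqrtcosh x = sqrt (cosh x)"

lemma cosh_le_exp_abs: "cosh x \<le> exp \<bar>x\<bar>" for x :: real
proof -
  have "cosh x = cosh \<bar>x\<bar>" by (simp add: abs_if cosh_minus)
  also have "\<dots> \<le> exp \<bar>x\<bar>" unfolding cosh_def by simp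
  finally show ?thesis .
qed

lemma abs_tanh_le_1: "\<bar>tanh x\<bar> \<le> 1" for x :: real
  using tanh_real_bounds[of x] by auto

lemma sech2_bounds: "0 \<le> sech2 x" "sech2 x \<le> 1"
  using abs_tanh_le_1[of x] by (auto simp: sech2_def abs_square_le_1)

lemma lncosh_bounds: "0 \<le> lncosh x" "lncosh x \<le> \<bar>x\<bar>"
proof -
  show "0 \<le> lncosh x" using cosh_real_ge_1[of x] by (simp add: lncosh_def)
  have "ln (cosh x) \<le> ln (exp \<bar>x\<bar>)"
    using cosh_le_exp_abs[of x] cosh_real_pos[of x] by (subst ln_le_cancel_iff) auto
  then show "lncosh x \<le> \<bar>x\<bar>" by (simp add: lncosh_def)
qed

lemma lncosh_has_derivative: "(lncosh has_real_derivative tanh x) (at x)"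
  unfolding lncosh_def[abs_def] using cosh_real_pos[of x]
  by (auto intro!: derivative_eq_intros simp: tanh_def)

lemma tanh_has_derivative: "(tanh has_real_derivative sech2 x) (at x)"
  using cosh_real_pos[of x] by (auto intro!: derivative_eq_intros simp: sech2_def)

lemma sqrtcosh_has_derivative: "(sqrtcosh has_real_derivative sqrtcosh x * tanh x / 2) (at x)"
proof -
  have p: "cosh x > 0" by (rule cosh_real_pos)
  have "(sqrtcosh has_real_derivative sinh x * (inverse (sqrt (cosh x)) / 2)) (at x)"
  proof -
    have "(cosh has_real_derivative sinh x) (at x)" by (auto intro!: derivative_eq_intros)
    from DERIV_chain2[OF DERIV_real_sqrt[OF p] this] show ?thesis
      by (simp add: sqrtcosh_def[abs_def] mult.commute)
  qed
  moreover have "sinh x * (inverse (sqrt (cosh x)) / 2) = sqrtcosh x * tanh x / 2"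
  proof -
    have "sqrt (cosh x) * sqrt (cosh x) = cosh x" using p by (metis abs_of_pos real_sqrt_mult_self)
    moreover have "sqrt (cosh x) \<noteq> 0" using p by (metis less_irrefl real_sqrt_eq_zero_cancel_iff)
    ultimately have "inverse (sqrt (cosh x)) = sqrt (cosh x) / cosh x" by (metis inverse_eq_divide mult.right_neutral nonzero_mult_divide_mult_cancel_left)
    then show ?thesis by (simp add: sqrtcosh_def tanh_def)
  qed
  ultimately show ?thesis by simp
qed

lemma sqrtcosh_has_derivative2:
  "((\<lambda>x. sqrtcosh x * tanh x / 2) has_real_derivative sqrtcosh x * (1 / 2 - (tanh x)\<^sup>2 / 4)) (at x)"
proof -
  have "((\<lambda>x. sqrtcosh x * tanh x / 2) has_real_derivative ((sqrtcosh x * tanh x / 2) * tanh x + sech2 x * sqrtcosh x) / 2) (at x)"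
    by (intro DERIV_cdivide DERIV_mult sqrtcosh_has_derivative tanh_has_derivative)
  moreover have "((sqrtcosh x * tanh x / 2) * tanh x + sech2 x * sqrtcosh x) / 2 = sqrtcosh x * (1 / 2 - (tanh x)\<^sup>2 / 4)"
    by (simp add: sech2_def power2_eq_square field_simps)
  ultimately show ?thesis by simp
qed

lemma sqrtcosh_bounds: "1 \<le> sqrtcosh x" "sqrtcosh x \<le> exp \<bar>x\<bar>" "sqrtcosh x \<le> exp (x / 2) + exp (- x / 2)"
proof -
  show "1 \<le> sqrtcosh x" using cosh_real_ge_1[of x] by (simp add: sqrtcosh_def)
  have "sqrt (cosh x) \<le> sqrt (exp \<bar>x\<bar>)" by (intro real_sqrt_le_mono cosh_le_exp_abs)
  also have "exp \<bar>x\<bar> = (exp (\<bar>x\<bar> / 2))\<^sup>2" by (simp add: power2_eq_square flip: exp_add)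
  finally have le: "sqrtcosh x \<le> exp (\<bar>x\<bar> / 2)" by (simp add: sqrtcosh_def)
  also have "exp (\<bar>x\<bar> / 2) \<le> exp \<bar>x\<bar>" by simp
  finally show "sqrtcosh x \<le> exp \<bar>x\<bar>" .
  show "sqrtcosh x \<le> exp (x / 2) + exp (- x / 2)"
    by (rule order_trans[OF le]) (cases "x \<ge> 0", auto)
qed

lemma exp_boundedI: "(\<And>y. \<bar>G y\<bar> \<le> exp \<bar>y\<bar>) \<Longrightarrow> exp_bounded G"
  unfolding exp_bounded_def by (intro exI[of _ 1]) auto

lemma exp_bounded_functions:
  "exp_bounded lncosh" "exp_bounded tanh" "exp_bounded sech2" "exp_bounded sqrtcosh"
  "exp_bounded (\<lambda>x. sqrtcosh x * tanh x / 2)" "exp_bounded (\<lambda>x. sqrtcosh x * (1 / 2 - (tanh x)\<^sup>2 / 4))"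
proof -
  have e: "1 \<le> exp \<bar>y\<bar>" "\<bar>y\<bar> \<le> exp \<bar>y\<bar>" for y :: real
    using exp_ge_add_one_self[of "\<bar>y\<bar>"] by (auto, linarith)
  show "exp_bounded lncosh"
    by (rule exp_boundedI) (use lncosh_bounds e order_trans in \<open>metis abs_of_nonneg\<close>)
  show "exp_bounded tanh"
    by (rule exp_boundedI) (use abs_tanh_le_1 e order_trans in blast)
  show "exp_bounded sech2"
    by (rule exp_boundedI) (use sech2_bounds e order_trans in \<open>metis abs_of_nonneg\<close>)
  show "exp_bounded sqrtcosh"
  proof (rule exp_boundedI)
    show "\<bar>sqrtcosh y\<bar> \<le> exp \<bar>y\<bar>" for y using sqrtcosh_bounds[of y] by simp
  qed
  have aux: "\<bar>sqrtcosh y * k\<bar> \<le> exp \<bar>y\<bar>" if "\<bar>k\<bar> \<le> 1" for y k :: real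
  proof -
    have "\<bar>sqrtcosh y\<bar> * \<bar>k\<bar> \<le> exp \<bar>y\<bar> * 1" using sqrtcosh_bounds[of y] that by (intro mult_mono) auto
    then show ?thesis by (simp add: abs_mult)
  qed
  show "exp_bounded (\<lambda>x. sqrtcosh x * tanh x / 2)"
  proof (rule exp_boundedI)
    fix y :: real show "\<bar>sqrtcosh y * tanh y / 2\<bar> \<le> exp \<bar>y\<bar>" using aux[of "tanh y / 2" y] abs_tanh_le_1[of y] by simp
  qed
  show "exp_bounded (\<lambda>x. sqrtcosh x * (1 / 2 - (tanh x)\<^sup>2 / 4))"
  proof (rule exp_boundedI)
    fix y :: real
    have "0 \<le> (tanh y)\<^sup>2" "(tanh y)\<^sup>2 \<le> 1" using abs_tanh_le_1[of y] by (auto simp: abs_square_le_1)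
    then have "\<bar>1 / 2 - (tanh y)\<^sup>2 / 4\<bar> \<le> 1" unfolding abs_le_iff by linarith
    then show "\<bar>sqrtcosh y * (1 / 2 - (tanh y)\<^sup>2 / 4)\<bar> \<le> exp \<bar>y\<bar>" by (rule aux)
  qed
qed

lemma continuous_functions:
  "continuous_on UNIV lncosh" "continuous_on UNIV (tanh :: real \<Rightarrow> real)" "continuous_on UNIV sech2" "continuous_on UNIV sqrtcosh"
  "continuous_on UNIV (\<lambda>x. sqrtcosh x * tanh x / 2)" "continuous_on UNIV (\<lambda>x. sqrtcosh x * (1 / 2 - (tanh x)\<^sup>2 / 4))"
proof -
  show l: "continuous_on UNIV lncosh" and t: "continuous_on UNIV (tanh :: real \<Rightarrow> real)" and s: "continuous_on UNIV sqrtcosh"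
    using lncosh_has_derivative tanh_has_derivative sqrtcosh_has_derivative
    by (intro continuous_at_imp_continuous_on ballI DERIV_isCont; blast)+
  show "continuous_on UNIV sech2" unfolding sech2_def[abs_def] by (intro continuous_intros t)
  show "continuous_on UNIV (\<lambda>x. sqrtcosh x * tanh x / 2)" "continuous_on UNIV (\<lambda>x. sqrtcosh x * (1 / 2 - (tanh x)\<^sup>2 / 4))"
    by (intro continuous_intros t s; simp)+
qed

lemma smoothing_mono:
  assumes "continuous_on UNIV F" "exp_bounded F" "continuous_on UNIV G" "exp_bounded G" "\<And>y. F y \<le> G y"
  shows "smoothing s F x \<le> smoothing s G x"
  unfolding smoothing_def by (rule integral_mono) (use assms in \<open>auto intro: smoothing_integrable\<close>)

lemma exp_bounded_cmult: "exp_bounded G \<Longrightarrow> exp_bounded (\<lambda>y. c * G y)"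
  unfolding exp_bounded_def
proof (elim exE conjE)
  fix K assume K: "K \<ge> 0" "\<forall>y. \<bar>G y\<bar> \<le> K * exp \<bar>y\<bar>"
  have "\<bar>c * G y\<bar> \<le> \<bar>c\<bar> * K * exp \<bar>y\<bar>" for y
    using mult_left_mono[OF K(2)[rule_format, of y] abs_ge_zero[of c]] by (simp add: abs_mult mult.assoc)
  then show "\<exists>K\<ge>0. \<forall>y. \<bar>c * G y\<bar> \<le> K * exp \<bar>y\<bar>" using K(1) by (intro exI[of _ "\<bar>c\<bar> * K"]) auto
qed

lemma smoothing_const: "smoothing s (\<lambda>_. c) x = c"
  using gauss.prob_space by (simp add: smoothing_def)

lemma smoothing_cmult: "smoothing s (\<lambda>y. c * G y) x = c * smoothing s G x"
  by (simp add: smoothing_def)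

lemma exp_bounded_const: "exp_bounded (\<lambda>_. c)"
  unfolding exp_bounded_def by (intro exI[of _ "\<bar>c\<bar>"]) (auto simp: mult_le_cancel_left1)

lemma abs_smoothing_le:
  assumes "continuous_on UNIV F" "exp_bounded F" "continuous_on UNIV G" "exp_bounded G" "\<And>y. \<bar>F y\<bar> \<le> G y"
  shows "\<bar>smoothing s F x\<bar> \<le> smoothing s G x"
proof -
  have "smoothing s F x \<le> smoothing s G x" using assms(5) by (intro smoothing_mono assms) (auto simp: abs_le_iff)
  moreover have "smoothing s (\<lambda>y. (-1) * F y) x \<le> smoothing s G x"
    using assms(1,5) by (intro smoothing_mono assms exp_bounded_cmult) (auto simp: abs_le_iff intro!: continuous_intros)
  ultimately show ?thesis unfolding smoothing_cmult by simp
qed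

lemma smoothing_sqrtcosh_ge_1: "1 \<le> smoothing s sqrtcosh x"
  using smoothing_mono[of "\<lambda>_. 1" sqrtcosh s x]
  by (simp add: smoothing_const exp_bounded_const exp_bounded_functions continuous_functions sqrtcosh_bounds)

section \<open>Explicit solutions when \<xi>''(0) > 0\<close>

locale spin_glass =
  fixes \<xi>0 :: "real poly" and \<beta> :: real
  assumes model: "mixed_pspin_model \<xi>0" and pos0: "poly (pderiv (pderiv \<xi>0)) 0 > 0" and \<beta>: "\<beta> > 0"
begin

abbreviation "\<xi> \<equiv> poly (xi \<xi>0 \<beta>)"
abbreviation "A \<equiv> xi' \<xi>0 \<beta>"
abbreviation "Q \<equiv> xi'' \<xi>0 \<beta>"

text \<open>Non-negative coefficients make \<xi>'' nondecreasing on the half-line, so positivity at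
  0 suffices. It makes \<xi>' strictly increasing, hence the remaining smoothing time positive, as
  differentiation in that time requires.\<close>

lemma Q_pos:
  assumes "t \<ge> 0" shows "Q t > 0"
proof -
  have nn: "coeff (xi \<xi>0 \<beta>) i \<ge> 0" for i using model by (simp add: xi_def mixed_pspin_model_def)
  have "mono_on {0..} Q"
  proof (rule mono_onI)
    fix r s :: real assume "r \<in> {0..}" "s \<in> {0..}" "r \<le> s"
    then show "Q r \<le> Q s" unfolding poly_altdef
      by (intro sum_mono mult_left_mono power_mono coeff_pderiv_nonneg nn) auto
  qed
  then have "Q 0 \<le> Q t" using assms by (auto dest: mono_onD)
  moreover have "Q 0 > 0" using pos0 \<beta> by (simp add: xi_def pderiv_smult)
  ultimately show ?thesis by linarith
qed

lemma A_deriv: "(A has_real_derivative Q t) (at t)"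
  by (rule poly_DERIV)

lemma A_0: "A 0 = 0"
  using model by (simp add: poly_0_coeff_0 coeff_pderiv xi_def mixed_pspin_model_def)

lemma \<xi>_0: "\<xi> 0 = 0"
  using model by (simp add: poly_0_coeff_0 xi_def mixed_pspin_model_def)

lemma A_strict: "0 \<le> s \<Longrightarrow> s < t \<Longrightarrow> A s < A t"
proof (rule DERIV_pos_imp_increasing[of s t A])
  fix x assume "0 \<le> s" "s \<le> x"
  then show "\<exists>y. (A has_real_derivative y) (at x) \<and> 0 < y"
    using Q_pos[of x] by (intro exI[of _ "Q x"] conjI A_deriv) auto
qed

lemma A_mono': "0 \<le> s \<Longrightarrow> s \<le> t \<Longrightarrow> A s \<le> A t"
  using A_strict[of s t] by (cases "s = t") auto

lemma integral_Q_id: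
  assumes "a \<le> b"
  shows "(LINT s|lborel. (Q s * s) * indicator {a..b} s) = (b * A b - \<xi> b) - (a * A a - \<xi> a)"
proof (rule integral_FTC_Icc_real[OF assms])
  fix s
  show "((\<lambda>s. s * A s - \<xi> s) has_real_derivative Q s * s) (at s)"
    by (auto intro!: derivative_eq_intros poly_DERIV)
  show "isCont (\<lambda>s. Q s * s) s" by (intro continuous_intros)
qed

end

lemma space_unit_borel: "space unit_borel = {0..1}"
  by (simp add: unit_borel_def space_restrict_space)

lemma sets_unit_borel: "{0..t} \<in> sets unit_borel" if "t \<le> 1"
  using that by (auto simp: unit_borel_def sets_restrict_space image_iff intro!: bexI[of _ "{0..t}"])

lemma measure_dirac: "t \<le> 1 \<Longrightarrow> q \<ge> 0 \<Longrightarrow> measure (dirac q) {0..t} = indicator {q..} t"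
  by (simp add: measure_def emeasure_return sets_unit_borel indicator_def)

context spin_glass begin

text \<open>After \<open>q\<close> the distribution function is 1 and the solution is log-cosh plus
  (\<xi>'(1) - \<xi>'(t))/2, because sech^2 + tanh^2 = 1. Before \<open>q\<close> it is 0, the
  equation is the plain heat equation, and the profile at \<open>q\<close> is smoothed for time
  \<xi>'(q) - \<xi>'(t).\<close>

lemma parisi_u_dirac:
  assumes q: "q \<in> {0..1}"
  shows "parisi_u \<xi>0 \<beta> (dirac q) (0, h) = smoothing (A q) lncosh h + (A 1 - A q) / 2"
proof -
  \<comment> \<open>\<open>min\<close> here and \<open>max\<close> in \<open>U\<close> glue the two
    regimes into one formula, leaving \<open>q\<close> as the only exceptional time.\<close>
  define s where "s = (\<lambda>t. A q - A (min t q))"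
  define U where "U = (\<lambda>z. smoothing (s (fst z)) lncosh (snd z) + (A 1 - A (max (fst z) q)) / 2)"
  have s_nonneg: "s t \<ge> 0" if "t \<ge> 0" for t
    using A_mono'[of "min t q" q] that q by (simp add: s_def)
  have s_cont: "continuous_on S (\<lambda>z :: real \<times> real. s (fst z))" for S
    unfolding s_def by (intro continuous_intros)
  have cont: "continuous_on closed_strip (\<lambda>z. smoothing (s (fst z)) G (snd z))" if "continuous_on UNIV G" "exp_bounded G" for G
    by (intro smoothing_continuous that s_cont continuous_intros s_nonneg) (auto simp: closed_strip_def)
  have "parisi_weak_solution \<xi>0 \<beta> (dirac q) (restrict U closed_strip)"
  proof (rule classical_imp_weak_solution[where m="indicator {q..}" and V="\<lambda>z. smoothing (s (fst z)) tanh (snd z)"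
        and W="\<lambda>z. smoothing (s (fst z)) sech2 (snd z)" and S="{q}" and B=1])
    show "continuous_on closed_strip U"
      unfolding U_def by (intro continuous_intros cont exp_bounded_functions continuous_functions) simp
    show "continuous_on closed_strip (\<lambda>z. smoothing (s (fst z)) tanh (snd z))"
      "continuous_on closed_strip (\<lambda>z. smoothing (s (fst z)) sech2 (snd z))"
      by (intro cont exp_bounded_functions continuous_functions)+
    show "measure (dirac q) {0..t} = indicator {q..} t" if "0 < t" "t < 1" for t using measure_dirac[of t q] that q by simp
    show "U (1, x) = ln (cosh x)" for x using q by (simp add: U_def s_def smoothing_0 lncosh_def min_absorb2 max_absorb1)
    show "\<bar>smoothing (s (fst (t, x))) tanh (snd (t, x))\<bar> \<le> 1" for t x
      using abs_smoothing_le[of tanh "\<lambda>_. 1"]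
      by (simp add: smoothing_const exp_bounded_const exp_bounded_functions continuous_functions abs_tanh_le_1)
    fix t x :: real assume t: "0 < t" "t < 1"
    show "((\<lambda>y. U (t, y)) has_real_derivative smoothing (s (fst (t, x))) tanh (snd (t, x))) (at x)"
    proof -
      have "((\<lambda>y. smoothing (s t) lncosh y + (A 1 - A (max t q)) / 2) has_real_derivative smoothing (s t) tanh x + 0) (at x)"
        by (intro DERIV_add DERIV_const smoothing_has_derivative_x lncosh_has_derivative exp_bounded_functions continuous_functions)
      then show ?thesis by (simp add: U_def)
    qed
    show "((\<lambda>y. smoothing (s (fst (t, y))) tanh (snd (t, y))) has_real_derivative smoothing (s (fst (t, x))) sech2 (snd (t, x))) (at x)"
      unfolding fst_conv snd_conv
      by (intro smoothing_has_derivative_x tanh_has_derivative exp_bounded_functions continuous_functions)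
    assume "t \<notin> {q}"
    then consider "t < q" | "t > q" by fastforce
    then show "((\<lambda>r. U (r, x)) has_real_derivative - (Q t / 2 * (smoothing (s (fst (t, x))) sech2 (snd (t, x)) + indicator {q..} t * (smoothing (s (fst (t, x))) tanh (snd (t, x)))\<^sup>2))) (at t)"
    proof cases
      case 1
      have pos: "A q - A t > 0" using A_strict[of t q] 1 t by simp
      have "((\<lambda>r. A q - A r) has_real_derivative - Q t) (at t)"
        by (auto intro!: derivative_eq_intros A_deriv)
      from DERIV_chain2[OF smoothing_has_derivative_s[OF lncosh_has_derivative tanh_has_derivative exp_bounded_functions(1-3) continuous_functions(3) pos] this]
      have "((\<lambda>r. smoothing (A q - A r) lncosh x + (A 1 - A q) / 2) has_real_derivative smoothing (A q - A t) sech2 x / 2 * - Q t + 0) (at t)"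
        by (intro DERIV_add DERIV_const)
      moreover have "\<forall>\<^sub>F r in nhds t. U (r, x) = smoothing (A q - A r) lncosh x + (A 1 - A q) / 2"
        using eventually_nhds_in_open[of "{..<q}" t] 1
        by (auto elim!: eventually_mono simp: U_def s_def min_def max_def)
      ultimately show ?thesis using 1
        by (subst DERIV_cong_ev[OF refl _ refl]) (auto simp: s_def min_def mult.commute)
    next
      case 2
      have "((\<lambda>r. lncosh x + (A 1 - A r) / 2) has_real_derivative - (Q t / 2)) (at t)"
        by (auto intro!: derivative_eq_intros A_deriv)
      moreover have "\<forall>\<^sub>F r in nhds t. U (r, x) = lncosh x + (A 1 - A r) / 2"
        using eventually_nhds_in_open[of "{q<..}" t] 2
        by (auto elim!: eventually_mono simp: U_def s_def min_def max_def smoothing_0)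
      ultimately show ?thesis using 2
        by (subst DERIV_cong_ev[OF refl _ refl]) (auto simp: s_def min_def smoothing_0 sech2_def)
    qed
  qed auto
  then have "parisi_u \<xi>0 \<beta> (dirac q) = restrict U closed_strip"
    by (rule parisi_u_eqI[OF model, of "indicator {q..}", rotated 3]) (use measure_dirac q in \<open>auto simp: indicator_def\<close>)
  then show ?thesis using q by (simp add: closed_strip_def U_def s_def A_0 min_def max_def)
qed

theorem parisi_functional_dirac:
  assumes q: "q \<in> {0..1}"
  shows "parisi_functional (dirac q) \<xi>0 \<beta> h = smoothing (A q) lncosh h + (\<xi> 1 - \<xi> q - (1 - q) * A q) / 2"
proof -
  have "(LINT s:{0..1}|lborel. Q s * measure (dirac q) {0..s} * s) = (LINT s|lborel. (Q s * s) * indicator {q..1} s)"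
    unfolding set_lebesgue_integral_def
    by (rule Bochner_Integration.integral_cong) (use q in \<open>auto simp: indicator_def measure_dirac\<close>)
  also have "\<dots> = (1 * A 1 - \<xi> 1) - (q * A q - \<xi> q)" using q by (intro integral_Q_id) auto
  finally show ?thesis
    unfolding parisi_functional_def parisi_u_dirac[OF q] by (simp add: algebra_simps diff_divide_distrib add_divide_distrib)
qed

end

text \<open>The image of a fair coin; measurability is automatic because the source space is
  discrete.\<close>

definition two_point :: "real measure" where
  "two_point = distr (measure_pmf (bernoulli_pmf (1 / 2))) unit_borel of_bool"

lemma two_point_measurable: "of_bool \<in> measure_pmf (bernoulli_pmf (1 / 2)) \<rightarrow>\<^sub>M unit_borel"
  by (auto simp: space_unit_borel)

lemma two_point_in: "two_point \<in> unit_prob_measures"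
  unfolding two_point_def unit_prob_measures_def space_prob_algebra
  using measure_pmf.prob_space_distr[OF two_point_measurable] by simp

lemma measure_two_point:
  assumes "0 \<le> t" "t < 1"
  shows "measure two_point {0..t} = 1 / 2"
proof -
  have "of_bool -` {0..t} \<inter> space (measure_pmf (bernoulli_pmf (1 / 2))) = {False}"
    using assms by (auto simp: of_bool_def split: if_splits)
  then show ?thesis
    unfolding two_point_def using assms
    by (subst measure_distr[OF two_point_measurable]) (auto simp: sets_unit_borel measure_pmf_single)
qed

context spin_glass begin

text \<open>For U = 2 ln G the term (1/2) U_x^2 cancels the square in U_xx, so the Parisi equation
  for U becomes the heat equation for G. Since G \<ge> 1, the logarithm is harmless up to the
  boundary of the strip.\<close>

lemma parisi_u_two_point:
  "parisi_u \<xi>0 \<beta> two_point (0, h) = 2 * ln (smoothing (A 1) sqrtcosh h)"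
proof -
  let ?g1 = "\<lambda>x. sqrtcosh x * tanh x / 2"
  let ?g2 = "\<lambda>x. sqrtcosh x * (1 / 2 - (tanh x)\<^sup>2 / 4)"
  define s where "s = (\<lambda>t. A 1 - A t)"
  define G where "G = (\<lambda>z. smoothing (s (fst z)) sqrtcosh (snd z))"
  define G1 where "G1 = (\<lambda>z. smoothing (s (fst z)) ?g1 (snd z))"
  define G2 where "G2 = (\<lambda>z. smoothing (s (fst z)) ?g2 (snd z))"
  define U where "U = (\<lambda>z. 2 * ln (G z))"
  have G_ge: "G z \<ge> 1" for z unfolding G_def by (rule smoothing_sqrtcosh_ge_1)
  then have G0: "G z > 0" "G z \<noteq> 0" for z by (smt (verit))+
  have s_nonneg: "s t \<ge> 0" if "0 \<le> t" "t \<le> 1" for t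
    using A_mono'[of t 1] that by (simp add: s_def)
  have s_cont: "continuous_on S (\<lambda>z :: real \<times> real. s (fst z))" for S
    unfolding s_def by (intro continuous_intros)
  have cont: "continuous_on closed_strip (\<lambda>z. smoothing (s (fst z)) G (snd z))" if "continuous_on UNIV G" "exp_bounded G" for G
    by (intro smoothing_continuous that s_cont continuous_intros s_nonneg) (auto simp: closed_strip_def)
  have conts: "continuous_on closed_strip G" "continuous_on closed_strip G1" "continuous_on closed_strip G2"
    unfolding G_def G1_def G2_def by (intro cont exp_bounded_functions continuous_functions)+
  have Gx: "((\<lambda>y. G (t, y)) has_real_derivative G1 (t, x)) (at x)" for t x
    unfolding G_def G1_def fst_conv snd_conv
    by (intro smoothing_has_derivative_x sqrtcosh_has_derivative exp_bounded_functions continuous_functions)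
  have G1x: "((\<lambda>y. G1 (t, y)) has_real_derivative G2 (t, x)) (at x)" for t x
    unfolding G1_def G2_def fst_conv snd_conv
    by (intro smoothing_has_derivative_x sqrtcosh_has_derivative2 exp_bounded_functions continuous_functions)
  have "parisi_weak_solution \<xi>0 \<beta> two_point (restrict U closed_strip)"
  proof (rule classical_imp_weak_solution[where m="\<lambda>_. 1 / 2" and V="\<lambda>z. 2 * (G1 z / G z)"
        and W="\<lambda>z. 2 * (G2 z / G z - (G1 z / G z)\<^sup>2)" and S="{}" and B=1])
    show "continuous_on closed_strip U" "continuous_on closed_strip (\<lambda>z. 2 * (G1 z / G z))"
      "continuous_on closed_strip (\<lambda>z. 2 * (G2 z / G z - (G1 z / G z)\<^sup>2))"
      unfolding U_def using G0 by (intro continuous_intros conts; simp)+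
    show "measure two_point {0..t} = 1 / 2" if "0 < t" "t < 1" for t using measure_two_point that by simp
    show "U (1, x) = ln (cosh x)" for x
      using cosh_real_pos[of x] by (simp add: U_def G_def s_def smoothing_0 sqrtcosh_def ln_sqrt)
    show "\<bar>2 * (G1 (t, x) / G (t, x))\<bar> \<le> 1" for t x
    proof -
      \<comment> \<open>The derivative of \<open>sqrtcosh\<close> is at most half the function in
        absolute value; smoothing preserves this, so the space derivative of \<open>U\<close> is at
        most 1 in absolute value.\<close>
      have "\<bar>G1 (t, x)\<bar> \<le> smoothing (s t) (\<lambda>y. 1 / 2 * sqrtcosh y) x"
        unfolding G1_def fst_conv snd_conv
      proof (rule abs_smoothing_le)
        fix y
        have "\<bar>sqrtcosh y\<bar> * \<bar>tanh y\<bar> \<le> sqrtcosh y * 1"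
          using sqrtcosh_bounds(1)[of y] abs_tanh_le_1[of y] by (intro mult_mono) auto
        then show "\<bar>sqrtcosh y * tanh y / 2\<bar> \<le> 1 / 2 * sqrtcosh y" by (simp add: abs_mult)
      qed (intro exp_bounded_functions exp_bounded_cmult continuous_functions continuous_intros)+
      then have "2 * \<bar>G1 (t, x)\<bar> \<le> G (t, x)" unfolding smoothing_cmult by (simp add: G_def)
      then show ?thesis using G0(1)[of "(t, x)"] by (simp add: abs_mult)
    qed
    fix t x :: real assume t: "0 < t" "t < 1"
    show "((\<lambda>y. U (t, y)) has_real_derivative 2 * (G1 (t, x) / G (t, x))) (at x)"
      unfolding U_def using G0(1)[of "(t, x)"] by (auto intro!: derivative_eq_intros Gx)
    show "((\<lambda>y. 2 * (G1 (t, y) / G (t, y))) has_real_derivative 2 * (G2 (t, x) / G (t, x) - (G1 (t, x) / G (t, x))\<^sup>2)) (at x)"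
      using G0[of "(t, x)"] by (auto intro!: derivative_eq_intros Gx G1x simp: field_simps power2_eq_square)
    have pos: "A 1 - A t > 0" using A_strict[of t 1] t by simp
    have "((\<lambda>r. A 1 - A r) has_real_derivative - Q t) (at t)"
      by (auto intro!: derivative_eq_intros A_deriv)
    from DERIV_chain2[OF smoothing_has_derivative_s[OF sqrtcosh_has_derivative sqrtcosh_has_derivative2 exp_bounded_functions(4-6) continuous_functions(6) pos] this]
    have "((\<lambda>r. G (r, x)) has_real_derivative G2 (t, x) / 2 * - Q t) (at t)"
      by (simp add: G_def G2_def s_def)
    then have "((\<lambda>r. U (r, x)) has_real_derivative 2 * ((G2 (t, x) / 2 * - Q t) / G (t, x))) (at t)"
      unfolding U_def using G0(1)[of "(t, x)"] by (auto intro!: derivative_eq_intros)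
    then show "((\<lambda>r. U (r, x)) has_real_derivative - (Q t / 2 * (2 * (G2 (t, x) / G (t, x) - (G1 (t, x) / G (t, x))\<^sup>2) + 1 / 2 * (2 * (G1 (t, x) / G (t, x)))\<^sup>2))) (at t)"
      by (simp add: field_simps power2_eq_square)
  qed auto
  then have "parisi_u \<xi>0 \<beta> two_point = restrict U closed_strip"
    by (rule parisi_u_eqI[OF model, of "\<lambda>_. 1 / 2", rotated 3]) (use measure_two_point in auto)
  then show ?thesis by (simp add: closed_strip_def U_def G_def s_def A_0)
qed

theorem parisi_functional_two_point:
  "parisi_functional two_point \<xi>0 \<beta> h = 2 * ln (smoothing (A 1) sqrtcosh h) - (A 1 - \<xi> 1) / 4"
proof -
  have "(LINT s:{0..1}|lborel. Q s * measure two_point {0..s} * s) = (LINT s|lborel. 1 / 2 * ((Q s * s) * indicator {0..1} s))"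
    unfolding set_lebesgue_integral_def
  proof (rule integral_cong_AE)
    \<comment> \<open>Only at s = 1 does the atom at 1 count; a single point does not affect the
      integral.\<close>
    have eq: "s \<noteq> 1 \<Longrightarrow> indicator {0..1} s *\<^sub>R (Q s * measure two_point {0..s} * s) = 1 / 2 * ((Q s * s) * indicator {0..1} s)" for s
      using measure_two_point[of s] by (auto simp: indicator_def)
    show "AE s in lborel. indicator {0..1} s *\<^sub>R (Q s * measure two_point {0..s} * s) = 1 / 2 * ((Q s * s) * indicator {0..1} s)"
      using AE_lborel_singleton[of 1] by eventually_elim (rule eq)
    have "indicator {0..1} s *\<^sub>R (Q s * measure two_point {0..s} * s) = (if s = 1 then Q 1 * measure two_point {0..1} else 1 / 2 * ((Q s * s) * indicator {0..1} s))" for s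
      using eq[of s] by simp
    then show "(\<lambda>s. indicator {0..1} s *\<^sub>R (Q s * measure two_point {0..s} * s)) \<in> borel_measurable lborel"
      by (simp only:) measurable
  qed measurable
  also have "\<dots> = 1 / 2 * ((1 * A 1 - \<xi> 1) - (0 * A 0 - \<xi> 0))" by (simp only: integral_mult_right_zero integral_Q_id[of 0 1])
  finally show ?thesis unfolding parisi_functional_def parisi_u_two_point by (simp add: \<xi>_0)
qed

end

section \<open>The example\<close>

text \<open>Successive integration from 0 of sech^2 \<le> 1, then tanh x \<le> x, then tanh x \<ge>
  x - x^3/3; evenness covers negative arguments.\<close>

lemma lncosh_ge: "lncosh y \<ge> y\<^sup>2 / 2 - y ^ 4 / 12"
proof -
  have nonneg: "lncosh y \<ge> y\<^sup>2 / 2 - y ^ 4 / 12" if y: "y \<ge> 0" for y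
  proof -
    have tanh_le: "tanh x \<le> x" if "x \<ge> 0" for x :: real
    proof -
      have "(\<lambda>x. x - tanh x) 0 \<le> (\<lambda>x. x - tanh x) x"
      proof (rule DERIV_nonneg_imp_nondecreasing[OF that])
        fix x :: real
        have "((\<lambda>x. x - tanh x) has_real_derivative 1 - sech2 x) (at x)"
          by (intro DERIV_diff DERIV_ident tanh_has_derivative)
        then show "\<exists>D. ((\<lambda>x. x - tanh x) has_real_derivative D) (at x) \<and> 0 \<le> D"
          using sech2_bounds[of x] by (intro exI[of _ "1 - sech2 x"]) auto
      qed
      then show ?thesis by simp
    qed
    have tanh_ge: "tanh x \<ge> x - x ^ 3 / 3" if "x \<ge> 0" for x :: real
    proof -
      have "(\<lambda>x. tanh x - (x - x ^ 3 / 3)) 0 \<le> (\<lambda>x. tanh x - (x - x ^ 3 / 3)) x"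
      proof (rule DERIV_nonneg_imp_nondecreasing[OF that])
        fix x :: real assume x: "0 \<le> x"
        have "((\<lambda>x. x - x ^ 3 / 3) has_real_derivative 1 - x\<^sup>2) (at x)"
          by (auto intro!: derivative_eq_intros)
        from DERIV_diff[OF tanh_has_derivative this]
        have "((\<lambda>x. tanh x - (x - x ^ 3 / 3)) has_real_derivative sech2 x - (1 - x\<^sup>2)) (at x)" .
        moreover have "0 \<le> tanh x" using x by simp
        then have "(tanh x)\<^sup>2 \<le> x\<^sup>2" using tanh_le[OF x] by (intro power_mono)
        ultimately show "\<exists>D. ((\<lambda>x. tanh x - (x - x ^ 3 / 3)) has_real_derivative D) (at x) \<and> 0 \<le> D"
          by (intro exI[of _ "sech2 x - (1 - x\<^sup>2)"]) (auto simp: sech2_def)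
      qed
      then show ?thesis by simp
    qed
    have "(\<lambda>y. lncosh y - (y\<^sup>2 / 2 - y ^ 4 / 12)) 0 \<le> (\<lambda>y. lncosh y - (y\<^sup>2 / 2 - y ^ 4 / 12)) y"
    proof (rule DERIV_nonneg_imp_nondecreasing[OF y])
      fix x :: real assume x: "0 \<le> x"
      have "((\<lambda>y. y\<^sup>2 / 2 - y ^ 4 / 12) has_real_derivative x - x ^ 3 / 3) (at x)"
        by (auto intro!: derivative_eq_intros)
      from DERIV_diff[OF lncosh_has_derivative this]
      have "((\<lambda>y. lncosh y - (y\<^sup>2 / 2 - y ^ 4 / 12)) has_real_derivative tanh x - (x - x ^ 3 / 3)) (at x)" .
      then show "\<exists>D. ((\<lambda>y. lncosh y - (y\<^sup>2 / 2 - y ^ 4 / 12)) has_real_derivative D) (at x) \<and> 0 \<le> D"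
        using tanh_ge[OF x] by (intro exI[of _ "tanh x - (x - x ^ 3 / 3)"]) auto
    qed
    then show ?thesis by (simp add: lncosh_def)
  qed
  have "lncosh y = lncosh \<bar>y\<bar>" by (simp add: lncosh_def abs_if)
  then show ?thesis using nonneg[of "\<bar>y\<bar>"] by simp
qed

text \<open>\<open>lncosh\<close> is convex and vanishes at \<open>0\<close>.\<close>

lemma lncosh_scale:
  assumes "r \<ge> 1" shows "lncosh (r * y) \<ge> r * lncosh y"
proof -
  have nonneg: "lncosh (r * y) \<ge> r * lncosh y" if y: "y \<ge> 0" for y
  proof -
    have "(\<lambda>y. lncosh (r * y) - r * lncosh y) 0 \<le> (\<lambda>y. lncosh (r * y) - r * lncosh y) y"
    proof (rule DERIV_nonneg_imp_nondecreasing[OF y])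
      fix x :: real assume x: "0 \<le> x"
      have "((\<lambda>y. r * y) has_real_derivative r) (at x)" by (auto intro!: derivative_eq_intros)
      from DERIV_diff[OF DERIV_chain2[OF lncosh_has_derivative this] DERIV_cmult[OF lncosh_has_derivative]]
      have "((\<lambda>y. lncosh (r * y) - r * lncosh y) has_real_derivative tanh (r * x) * r - r * tanh x) (at x)" .
      moreover have "tanh x \<le> tanh (r * x)"
        using mult_right_mono[OF assms x] by simp
      then have "tanh x * r \<le> tanh (r * x) * r" using assms by (intro mult_right_mono) auto
      ultimately show "\<exists>D. ((\<lambda>y. lncosh (r * y) - r * lncosh y) has_real_derivative D) (at x) \<and> 0 \<le> D"
        by (intro exI[of _ "tanh (r * x) * r - r * tanh x"]) (auto simp: mult.commute)
    qed
    then show ?thesis by (simp add: lncosh_def)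
  qed
  have e: "lncosh y = lncosh \<bar>y\<bar>" for y by (simp add: lncosh_def abs_if)
  have "lncosh (r * y) = lncosh (r * \<bar>y\<bar>)" using e[of "r * y"] assms by (simp add: abs_mult)
  then show ?thesis using nonneg[of "\<bar>y\<bar>"] e[of y] by simp
qed

text \<open>The Taylor bound is averaged with the Gaussian moments 1 and 3, so that 3/12 becomes
  1/4. It is sharp enough for small \<open>s\<close> only.\<close>

lemma smoothing_lncosh_ge:
  assumes "s \<ge> 0" shows "smoothing s lncosh 0 \<ge> s / 2 - s\<^sup>2 / 4"
proof -
  have i2: "integrable gauss (\<lambda>z. z\<^sup>2)" and i4: "integrable gauss (\<lambda>z. z ^ 4)"
    using integrable_std_normal_moment[of 2] integrable_std_normal_moment[of 4] by (simp_all add: gauss_integral)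
  have m2: "(LINT z|gauss. z\<^sup>2) = 1" and m4: "(LINT z|gauss. z ^ 4) = 3"
    using integral_std_normal_moment_even[of 1] integral_std_normal_moment_even[of 2]
    by (simp_all add: gauss_integral fact_numeral)
  have "s / 2 - s\<^sup>2 / 4 = (LINT z|gauss. s / 2 * z\<^sup>2 - s\<^sup>2 / 12 * z ^ 4)"
    using i2 i4 by (simp add: m2 m4)
  also have "\<dots> \<le> (LINT z|gauss. lncosh (0 + sqrt s * z))"
  proof (rule integral_mono)
    show "integrable gauss (\<lambda>z. s / 2 * z\<^sup>2 - s\<^sup>2 / 12 * z ^ 4)" using i2 i4 by simp
    show "integrable gauss (\<lambda>z. lncosh (0 + sqrt s * z))"
      by (intro smoothing_integrable continuous_functions exp_bounded_functions)
    fix z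
    have "(sqrt s) ^ 4 = s\<^sup>2" using assms by (metis numeral_Bit0 power2_eq_square power_add real_sqrt_pow2)
    then show "s / 2 * z\<^sup>2 - s\<^sup>2 / 12 * z ^ 4 \<le> lncosh (0 + sqrt s * z)"
      using lncosh_ge[of "sqrt s * z"] assms by (simp add: power_mult_distrib)
  qed
  finally show ?thesis by (simp add: smoothing_def)
qed

text \<open>Scaling by sqrt s reduces to variance 1, where the polynomial bound gives 1/2 - 1/4.
  This replaces the polynomial bound once \<open>s\<close> is large.\<close>

lemma smoothing_lncosh_ge_sqrt:
  assumes "s \<ge> 1" shows "smoothing s lncosh 0 \<ge> sqrt s / 4"
proof -
  have "sqrt s * (1 / 4) \<le> sqrt s * smoothing 1 lncosh 0"
    using smoothing_lncosh_ge[of 1] assms by (intro mult_left_mono) auto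
  also have "\<dots> = (LINT z|gauss. sqrt s * lncosh (0 + 1 * z))" by (simp add: smoothing_def)
  also have "\<dots> \<le> (LINT z|gauss. lncosh (0 + sqrt s * z))"
  proof (rule integral_mono)
    show "sqrt s * lncosh (0 + 1 * z) \<le> lncosh (0 + sqrt s * z)" for z
      using lncosh_scale[of "sqrt s" z] assms by simp
  qed (intro integrable_mult_right smoothing_integrable continuous_functions exp_bounded_functions)+
  finally show ?thesis by (simp add: smoothing_def)
qed

text \<open>The pure 1001-spin part makes the model behave like the random energy model: the replica symmetric
  functional stays minimal at \<open>0\<close> although \<open>\<xi>(1) > 8 ln 2\<close>. The small 2-spin part makes \<open>\<xi>''(0) > 0\<close>.\<close>

definition example_model :: "real poly" where
  "example_model = monom (1 / 100) 2 + monom 6 1001"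

lemma example_polys:
  "poly (xi example_model 1) q = q\<^sup>2 / 100 + 6 * q ^ 1001"
  "xi' example_model 1 q = q / 50 + 6006 * q ^ 1000"
  "xi'' example_model 1 q = 1 / 50 + 6006000 * q ^ 999"
  by (simp_all add: xi_def example_model_def pderiv_add pderiv_monom poly_monom)

interpretation ex: spin_glass example_model 1
proof
  show "mixed_pspin_model example_model"
    by (auto simp: mixed_pspin_model_def example_model_def)
  show "0 < poly (pderiv (pderiv example_model)) 0"
    by (simp add: example_model_def pderiv_add pderiv_monom poly_monom)
qed simp

text \<open>\<open>q ^ n\<close> is the smallest of the first \<open>n + 1\<close> terms of the
  geometric series, whose sum times 1 - q is at most 1. This is how a large degree keeps (1 - q)
  \<xi>'(q) under control.\<close>

lemma power_times_one_minus_le: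
  fixes q :: real assumes "0 \<le> q" "q \<le> 1"
  shows "(1 - q) * q ^ n \<le> 1 / real (Suc n)"
proof -
  have "real (Suc n) * q ^ n = (\<Sum>i<Suc n. q ^ n)" by simp
  also have "\<dots> \<le> (\<Sum>i<Suc n. q ^ i)" by (intro sum_mono power_decreasing) (use assms in auto)
  finally have "(1 - q) * (real (Suc n) * q ^ n) \<le> (1 - q) * (\<Sum>i<Suc n. q ^ i)"
    using assms by (intro mult_left_mono) auto
  also have "\<dots> = 1 - q ^ Suc n" by (rule one_diff_power_eq[symmetric])
  also have "\<dots> \<le> 1" using assms by simp
  finally show ?thesis by (simp add: field_simps)
qed

text \<open>The inequality says that the replica symmetric functional at \<open>q\<close> exceeds
  its value at 0. For s = \<xi>'(q) < 1 both sides are compared through the quadratic bound s/2 -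
  s^2/4; for s \<ge> 1 the bound sqrt s / 4 beats a right-hand side of the same order with a smaller
  constant.\<close>

lemma example_rs_gap:
  assumes q: "0 < q" "q \<le> 1"
  shows "smoothing (xi' example_model 1 q) lncosh 0 > (poly (xi example_model 1) q + (1 - q) * xi' example_model 1 q) / 2"
proof -
  define y where "y = q ^ 999"
  define s where "s = xi' example_model 1 q"
  have y: "0 < y" "y \<le> 1" using q by (auto simp: y_def power_le_one)
  have q1000: "q ^ 1000 = q * y" and q1001: "q ^ 1001 = q\<^sup>2 * y"
    using power_add[of q 1 999] power_add[of q 2 999] by (simp_all add: y_def)
  have s: "s = q * (1 / 50 + 6006 * y)" by (simp add: s_def example_polys q1000 algebra_simps)
  have xi: "poly (xi example_model 1) q = q\<^sup>2 * (1 / 100 + 6 * y)" by (simp add: example_polys q1001 algebra_simps)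
  have s0: "s > 0" using q y by (simp add: s add_pos_pos)
  show ?thesis
  proof (cases "s < 1")
    case True
    define b where "b = 6006 * y"
    have b0: "0 < b" using y by (simp add: b_def)
    \<comment> \<open>Near q = 1 the assumption s < 1 itself limits b; away from 1 the power q^999
      is negligible.\<close>
    have b: "b \<le> 6 / 5"
    proof (cases "q \<ge> 9 / 10")
      case True
      have "9 / 10 * (1 / 50 + b) \<le> s" using True b0 unfolding s b_def by (intro mult_right_mono) auto
      then show ?thesis using \<open>s < 1\<close> by simp
    next
      case False
      have "y \<le> (9 / 10) ^ 999" unfolding y_def using False q by (intro power_mono) auto
      also have "\<dots> \<le> (9 / 10) ^ 100" by (intro power_decreasing) auto
      also have "\<dots> \<le> 1 / 6006" by (simp add: power_divide)
      finally show ?thesis by (simp add: b_def)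
    qed
    have "(1 / 50 + b)\<^sup>2 / 2 = 1 / 5000 + b / 50 + b * b / 2" by (simp add: power2_eq_square field_simps)
    also have "b * b \<le> 6 / 5 * b" using b b0 by (intro mult_right_mono) auto
    \<comment> \<open>Multiplied by q^2 this reads s^2/2 < q s - \<xi>(q), since 6 y = b/1001; that
      is the claim with the left side replaced by s/2 - s^2/4.\<close>
    finally have "(1 / 50 + b)\<^sup>2 / 2 < (1 / 50 + b) - (1 / 100 + b / 1001)" using b0 by simp
    then have "q\<^sup>2 * ((1 / 50 + b)\<^sup>2 / 2) < q\<^sup>2 * ((1 / 50 + b) - (1 / 100 + b / 1001))"
      using q by (intro mult_strict_left_mono) auto
    then have "s\<^sup>2 / 2 < q * s - q\<^sup>2 * (1 / 100 + 6 * y)"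
      by (simp add: s b_def power_mult_distrib power2_eq_square algebra_simps)
    then have "(poly (xi example_model 1) q + (1 - q) * s) / 2 < s / 2 - s\<^sup>2 / 4"
      unfolding xi by (simp add: field_simps)
    also have "\<dots> \<le> smoothing s lncosh 0" using s0 by (intro smoothing_lncosh_ge) simp
    finally show ?thesis by (simp add: s_def)
  next
    case False
    define r where "r = sqrt s"
    have r: "r \<ge> 1" "r * r = s" using False by (auto simp: r_def)
    \<comment> \<open>Degree 1001 makes the leading power q^1000 of \<xi>' a perfect square, so sqrt
      s is comparable to p.\<close>
    define p where "p = q ^ 500"
    have p: "0 < p" "p \<le> 1" using q by (auto simp: p_def power_le_one)
    have pp: "p * p = q ^ 1000" by (simp add: p_def flip: power_add)
    \<comment> \<open>3/20 lies just above sqrt(1/50) and 155/2 just above sqrt 6006, which gives a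
      linear bound for sqrt s in p.\<close>
    have "(3 / 20 + 155 / 2 * p)\<^sup>2 = 9 / 400 + 93 / 4 * p + 24025 / 4 * (p * p)" by (simp add: power2_eq_square field_simps)
    moreover have "s = q / 50 + 6006 * (p * p)" by (simp add: s_def example_polys pp)
    moreover have "p * p \<ge> 0" by simp
    ultimately have "s \<le> (3 / 20 + 155 / 2 * p)\<^sup>2" using p q by linarith
    then have r_le: "r \<le> 3 / 20 + 155 / 2 * p" unfolding r_def using p by (intro real_le_lsqrt) auto
    have "(1 - q) * r \<le> (1 - q) * (3 / 20 + 155 / 2 * p)" using r_le q by (intro mult_left_mono) auto
    also have "\<dots> = (1 - q) * (3 / 20) + 155 / 2 * ((1 - q) * p)" by (simp add: algebra_simps)
    also have "\<dots> \<le> 1 * (3 / 20) + 155 / 2 * (1 / 501)"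
      using power_times_one_minus_le[of q 500] q unfolding p_def by (intro add_mono mult_mono mult_left_mono) auto
    finally have h1: "(1 - q) * r \<le> 2 / 5" by simp
    have "r \<le> 78" using r_le p by simp
    \<comment> \<open>Since 6006/1001 = 6, the high-degree part of \<xi>(q) is at most 1/1001 of
      that of \<xi>'(q), and the quadratic part is at most 1/100.\<close>
    have "poly (xi example_model 1) q \<le> 1 / 100 + s / 1001"
    proof -
      have "q * q \<le> 1 * 1" "q * (q * y) \<le> 1 * (q * y)" using q y by (intro mult_mono; simp)+
      moreover have "q\<^sup>2 * (1 / 100 + 6 * y) = q * q / 100 + 6 * (q * (q * y))"
        by (simp add: power2_eq_square algebra_simps)
      moreover have "s / 1001 = q / 50050 + 6 * (q * y)" by (simp add: s field_simps)
      ultimately show ?thesis unfolding xi using q by linarith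
    qed
    also have "s / 1001 \<le> 78 / 1001 * r"
      using mult_right_mono[OF \<open>r \<le> 78\<close>, of r] r by simp
    finally have "poly (xi example_model 1) q + (1 - q) * s \<le> 1 / 100 + 78 / 1001 * r + ((1 - q) * r) * r"
      using r(2) by (simp add: mult.assoc)
    also have "((1 - q) * r) * r \<le> 2 / 5 * r" using r h1 by (intro mult_right_mono) auto
    \<comment> \<open>1/100 + 78/1001 + 2/5 is below 1/2, and 1/100 \<le> r/100 because r \<ge>
      1.\<close>
    finally have "(poly (xi example_model 1) q + (1 - q) * s) / 2 < r / 4" using r(1) by simp
    also have "\<dots> \<le> smoothing s lncosh 0" unfolding r_def using False by (intro smoothing_lncosh_ge_sqrt) simp
    finally show ?thesis by (simp add: s_def)
  qed
qed

section \<open>The two-point measure against the Dirac masses\<close>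

lemma smoothing_sqrtcosh_le: "s \<ge> 0 \<Longrightarrow> smoothing s sqrtcosh 0 \<le> 2 * exp (s / 8)"
proof -
  assume s: "s \<ge> 0"
  have "smoothing s sqrtcosh 0 \<le> (LINT z|gauss. exp (sqrt s / 2 * z) + exp (- sqrt s / 2 * z))"
    unfolding smoothing_def
  proof (rule integral_mono)
    show "integrable gauss (\<lambda>z. sqrtcosh (0 + sqrt s * z))"
      by (intro smoothing_integrable continuous_functions exp_bounded_functions)
    show "integrable gauss (\<lambda>z. exp (sqrt s / 2 * z) + exp (- sqrt s / 2 * z))"
      by (intro Bochner_Integration.integrable_add gauss_exp)
    show "sqrtcosh (0 + sqrt s * z) \<le> exp (sqrt s / 2 * z) + exp (- sqrt s / 2 * z)" for z
      using sqrtcosh_bounds(3)[of "sqrt s * z"] by simp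
  qed
  also have "\<dots> = exp ((sqrt s / 2)\<^sup>2 / 2) + exp ((- sqrt s / 2)\<^sup>2 / 2)"
    by (subst Bochner_Integration.integral_add[OF gauss_exp(1) gauss_exp(1)]) (simp only: gauss_exp(2))
  also have "\<dots> = 2 * exp (s / 8)" using s by (simp add: power_divide)
  finally show ?thesis .
qed

text \<open>The large number \<xi>'(1) cancels: it enters with weight 1/4 through the exponential
  moment exp(\<xi>'(1)/8) and with weight -1/4 through the integral term. What remains compares 2 ln
  2 + \<xi>(1)/4 with \<xi>(1)/2.\<close>

lemma example_two_point_less:
  "parisi_functional two_point example_model 1 0 < parisi_functional (dirac 0) example_model 1 0"
proof -
  let ?A = "xi' example_model 1 1"
  have A1: "?A \<ge> 0" by (simp add: example_polys)
  have xi1: "poly (xi example_model 1) 1 = 601 / 100" by (simp add: example_polys)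
  have "smoothing ?A sqrtcosh 0 > 0" using smoothing_sqrtcosh_ge_1[of ?A 0] by simp
  then have "ln (smoothing ?A sqrtcosh 0) \<le> ln (2 * exp (?A / 8))"
    using smoothing_sqrtcosh_le[OF A1] by (subst ln_le_cancel_iff) auto
  also have "\<dots> = ln 2 + ?A / 8" by (simp add: ln_mult)
  finally have le: "ln (smoothing ?A sqrtcosh 0) \<le> ln 2 + ?A / 8" .
  have "parisi_functional two_point example_model 1 0 \<le> 2 * ln 2 + 601 / 400"
  proof -
    have "2 * L - (a - 601 / 100) / 4 \<le> 2 * l + 601 / 400" if "L \<le> l + a / 8" for L a l :: real
      using that by (simp add: field_simps)
    from this[OF le] show ?thesis
      unfolding ex.parisi_functional_two_point xi1 .
  qed
  \<comment> \<open>ln 2 \<le> 25/36 gives 2 ln 2 \<le> 25/18 < 601/400.\<close>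
  also have "\<dots> < 601 / 200" using ln2_le_25_over_36 by simp
  also have "601 / 200 = parisi_functional (dirac 0) example_model 1 0"
    by (subst ex.parisi_functional_dirac) (simp_all add: example_polys smoothing_0 lncosh_def)
  finally show ?thesis .
qed

text \<open>The value at 0 is \<xi>(1)/2, and the difference to the value at \<open>q\<close> is
  exactly the gap in \<open>example_rs_gap\<close>.\<close>

lemma example_rs_minimum:
  assumes "q \<in> {0..1}" "q \<noteq> 0"
  shows "parisi_functional (dirac 0) example_model 1 0 < parisi_functional (dirac q) example_model 1 0"
proof -
  have "parisi_functional (dirac 0) example_model 1 0 = poly (xi example_model 1) 1 / 2"
    by (subst ex.parisi_functional_dirac) (simp_all add: ex.A_0 ex.\<xi>_0 smoothing_0 lncosh_def)
  moreover have q: "0 < q" "q \<le> 1" using assms by auto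
  moreover have gen: "x1 / 2 < S + (x1 - x - a) / 2" if "(x + a) / 2 < S" for S x x1 a :: real
    using that by (simp add: field_simps)
  ultimately show ?thesis
    unfolding ex.parisi_functional_dirac[OF assms(1)] by (simp only: gen[OF example_rs_gap[OF q]])
qed

theorem mainTheorem2:
  shows "\<exists>(\<xi>0 :: real poly) (\<beta> :: real) (h :: real).
    mixed_pspin_model \<xi>0 \<and> poly (pderiv (pderiv \<xi>0)) 0 > 0 \<and> \<beta> > 0 \<and>
    (\<exists>q. is_arg_min (\<lambda>q. parisi_functional (dirac q) \<xi>0 \<beta> h) (\<lambda>q. q \<in> {0..1}) q \<and>
         (\<forall>q'. is_arg_min (\<lambda>q. parisi_functional (dirac q) \<xi>0 \<beta> h) (\<lambda>q. q \<in> {0..1}) q'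
               \<longrightarrow> q' = q) \<and>
         at_quantity \<xi>0 q \<beta> h < 1) \<and>
    (\<forall>\<mu>. is_parisi_measure \<xi>0 \<beta> h \<mu> \<longrightarrow> (\<forall>q\<in>{0..1}. \<mu> \<noteq> dirac q))"
proof (intro exI conjI)
  let ?F = "\<lambda>\<mu>. parisi_functional \<mu> example_model 1 0"
  show "mixed_pspin_model example_model" "poly (pderiv (pderiv example_model)) 0 > 0" "(1::real) > 0"
    by (rule ex.model, rule ex.pos0, simp)
  have min0: "?F (dirac 0) \<le> ?F (dirac q)" if "q \<in> {0..1}" for q
    using example_rs_minimum[of q] that by (cases "q = 0") auto
  show "is_arg_min (\<lambda>q. ?F (dirac q)) (\<lambda>q. q \<in> {0..1}) 0"
    using min0 by (auto simp: is_arg_min_def not_less)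
  show "\<forall>q'. is_arg_min (\<lambda>q. ?F (dirac q)) (\<lambda>q. q \<in> {0..1}) q' \<longrightarrow> q' = 0"
    unfolding is_arg_min_def
  proof (intro allI impI)
    fix q' assume "q' \<in> {0..1} \<and> (\<nexists>q. q \<in> {0..1} \<and> ?F (dirac q) < ?F (dirac q'))"
    then show "q' = 0" using example_rs_minimum[of q'] by (metis atLeastAtMost_iff order_refl zero_le_one)
  qed
  show "at_quantity example_model 0 1 0 < 1"
    using gauss.prob_space by (simp add: at_quantity_def example_polys)
  show "\<forall>\<mu>. is_parisi_measure example_model 1 0 \<mu> \<longrightarrow> (\<forall>q\<in>{0..1}. \<mu> \<noteq> dirac q)"
  proof (intro allI impI ballI notI)
    fix \<mu> and q :: real assume \<mu>: "is_parisi_measure example_model 1 0 \<mu>" and q: "q \<in> {0..1}" and eq: "\<mu> = dirac q"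
    have "\<not> ?F two_point < ?F \<mu>"
      using \<mu> two_point_in unfolding is_parisi_measure_def is_arg_min_def by blast
    then show False
      using example_two_point_less min0[OF q] unfolding eq by simp
  qed
qed

end
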